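(* Let $E$ be a quasi-complete locally convex space whose separable bounded sets are metrizable, and let $E_w$ denote $E$ endowed with its weak topology $\sigma(E,E')$. Then the following assertions are equivalent: (i) $E$ has the Schur property; (ii) $E$ weakly respects sequential compactness; (iii) $E$ weakly respects compactness; (iv) $E$ weakly respects countable compactness; (v) $E$ weakly respects pseudocompactness; (vi) $E$ weakly respects functional boundedness; (vii) every bounded non-precompact sequence in $E$ has a subsequence which is equivalent to the unit basis of $\ell_1$; (viii) every bounded non-precompact sequence in $E$ has a subsequence which is discrete and $C$-embedded in $E_w$. Moreover, if (i)-(viii) hold, then every functionally bounded subset of $E_w$ is relatively compact in $E$.
   Context: Locally convex spaces are Hausdorff, over $\mathbb{R}$ or $\mathbb{C}$. $E$ is quasi-complete if each closed bounded subset of $E$ is complete. $E$ has the Schur property if $E$ and $E_w$ have the same convergent sequences (every sequence converging in $E_w$ converges in $E$ to the same limit). For a property $\mathcal{P}$ of subsets of topological spaces, let $\mathcal{P}(X)$ be the set of all subsets of $X$ having $\mathcal{P}$; $E$ weakly respects $\mathcal{P}$ if $\mathcal{P}(E_w)=\mathcal{P}(E)$. A subset $A$ of a Tychonoff space $X$ is functionally bounded in $X$ if every continuous real-valued function on $X$ is bounded on $A$. Compactness, sequential compactness (every sequence in the set has a subsequence converging to a point of the set), countable compactness and pseudocompactness (every continuous real-valued function on the set is bounded) refer to the set with the subspace topology. A subset $A$ of a topological space $X$ is $C$-embedded in $X$ if every continuous real-valued function on $A$ (with the subspace topology) extends to a continuous function on $X$; a sequence is discrete and $C$-embedded if its set of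 terms is. A sequence $A=\{a_n\}_{n\in\mathbb{N}}$ in $E$ is equivalent to the unit basis $\{e_n\}_{n\in\mathbb{N}}$ of $\ell_1$ if there is a linear topological isomorphism $R$ from the closure of $\mathrm{span}(A)$ in $E$ onto a subspace of $\ell_1$ with $R(a_n)=e_n$ for every $n$. Precompact means totally bounded. *)

theory Defs
  imports "HOL-Analysis.Analysis"
begin

text \<open>
  The scalar field is \<open>\<real>\<close> or \<open>\<complex>\<close>. This is a type class so that a statement can range over
  both: its models are exactly the reals and the complex numbers. The norm is multiplicative in
  \<^class>\<open>real_normed_field\<close> and extends the absolute value of \<open>\<real>\<close>, so it is the usual modulus.
\<close>

class real_or_complex_field = real_normed_field +
  assumes real_or_complex:
    "(\<forall>z. \<exists>a. z = a *\<^sub>R 1) \<or>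
     (\<exists>i. i * i = - 1 \<and> (\<forall>z. \<exists>a b. z = a *\<^sub>R 1 + b *\<^sub>R i))"

instance real :: real_or_complex_field
  by standard auto

instance complex :: real_or_complex_field
proof
  have "z = Re z *\<^sub>R 1 + Im z *\<^sub>R \<i>" for z :: complex
    by (simp add: complex_eq_iff)
  then show "(\<forall>z::complex. \<exists>a. z = a *\<^sub>R 1) \<or>
     (\<exists>i::complex. i * i = - 1 \<and> (\<forall>z. \<exists>a b. z = a *\<^sub>R 1 + b *\<^sub>R i))"
    using i_squared by blast
qed


section \<open>Locally convex spaces\<close>

text \<open>
  A vector space is a type with a scalar multiplication \<open>smul\<close>. Topologies on it are values of
  type \<open>'a topology\<close>, since the original and the weak topology live on the same type.
\<close>

definition scale_convex ::
  "('k::real_or_complex_field \<Rightarrow> 'a::ab_group_add \<Rightarrow> 'a) \<Rightarrow> 'a set \<Rightarrow> bool" where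
  "scale_convex smul S \<longleftrightarrow>
     (\<forall>x\<in>S. \<forall>y\<in>S. \<forall>u v :: real. 0 \<le> u \<and> 0 \<le> v \<and> u + v = 1 \<longrightarrow>
        smul (of_real u) x + smul (of_real v) y \<in> S)"

locale locally_convex_space = vector_space smul
  for smul :: "'k::real_or_complex_field \<Rightarrow> 'a::ab_group_add \<Rightarrow> 'a" +
  fixes E :: "'a topology"
  assumes topspace_UNIV: "topspace E = UNIV"
    and Hausdorff: "Hausdorff_space E"
    and continuous_add: "continuous_map (prod_topology E E) E (\<lambda>(x, y). x + y)"
    and continuous_scale: "continuous_map (prod_topology euclidean E) E (\<lambda>(c, x). smul c x)"
    and convex_base: "neighbourhood_base_at 0 (scale_convex smul) E"

definition continuous_dual ::
  "('k::real_or_complex_field \<Rightarrow> 'a::ab_group_add \<Rightarrow> 'a) \<Rightarrow> 'a topology \<Rightarrow> ('a \<Rightarrow> 'k) set" where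
  "continuous_dual smul E =
     {f. Vector_Spaces.linear smul (*) f \<and> continuous_map E euclidean f}"

definition weak_topology ::
  "('k::real_or_complex_field \<Rightarrow> 'a::ab_group_add \<Rightarrow> 'a) \<Rightarrow> 'a topology \<Rightarrow> 'a topology" where
  "weak_topology smul E =
     topology_generated_by {f -` U | f U. f \<in> continuous_dual smul E \<and> open U}"

definition bounded_in ::
  "('k::real_or_complex_field \<Rightarrow> 'a::ab_group_add \<Rightarrow> 'a) \<Rightarrow> 'a topology \<Rightarrow> 'a set \<Rightarrow> bool" where
  "bounded_in smul E B \<longleftrightarrow>
     (\<forall>U. openin E U \<and> 0 \<in> U \<longrightarrow> (\<exists>r. \<forall>c. r \<le> norm c \<longrightarrow> B \<subseteq> smul c ` U))"

definition precompact_in :: "'a::ab_group_add topology \<Rightarrow> 'a set \<Rightarrow> bool" where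
  "precompact_in E A \<longleftrightarrow>
     (\<forall>U. openin E U \<and> 0 \<in> U \<longrightarrow> (\<exists>F. finite F \<and> A \<subseteq> (\<Union>x\<in>F. (\<lambda>u. x + u) ` U)))"

definition Cauchy_filter_in :: "'a::ab_group_add topology \<Rightarrow> 'a filter \<Rightarrow> bool" where
  "Cauchy_filter_in E F \<longleftrightarrow>
     (\<forall>U. openin E U \<and> 0 \<in> U \<longrightarrow> (\<forall>\<^sub>F (x, y) in F \<times>\<^sub>F F. x - y \<in> U))"

definition complete_in :: "'a::ab_group_add topology \<Rightarrow> 'a set \<Rightarrow> bool" where
  "complete_in E A \<longleftrightarrow>
     (\<forall>F. F \<noteq> bot \<and> F \<le> principal A \<and> Cauchy_filter_in E F \<longrightarrow>
        (\<exists>l\<in>A. limitin E (\<lambda>x. x) l F))"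

definition quasi_complete ::
  "('k::real_or_complex_field \<Rightarrow> 'a::ab_group_add \<Rightarrow> 'a) \<Rightarrow> 'a topology \<Rightarrow> bool" where
  "quasi_complete smul E \<longleftrightarrow>
     (\<forall>B. closedin E B \<and> bounded_in smul E B \<longrightarrow> complete_in E B)"

definition separable_bounded_sets_metrizable ::
  "('k::real_or_complex_field \<Rightarrow> 'a::ab_group_add \<Rightarrow> 'a) \<Rightarrow> 'a topology \<Rightarrow> bool" where
  "separable_bounded_sets_metrizable smul E \<longleftrightarrow>
     (\<forall>B. bounded_in smul E B \<and> separable_space (subtopology E B) \<longrightarrow>
        metrizable_space (subtopology E B))"

definition Schur_property ::
  "('k::real_or_complex_field \<Rightarrow> 'a::ab_group_add \<Rightarrow> 'a) \<Rightarrow> 'a topology \<Rightarrow> bool" where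
  "Schur_property smul E \<longleftrightarrow>
     (\<forall>(a :: nat \<Rightarrow> 'a) l. limitin (weak_topology smul E) a l sequentially \<longrightarrow>
        limitin E a l sequentially)"


section \<open>Compactness-type properties of subsets of topological spaces\<close>

definition seq_compact_space :: "'a topology \<Rightarrow> bool" where
  "seq_compact_space X \<longleftrightarrow>
     (\<forall>a. range a \<subseteq> topspace X \<longrightarrow>
        (\<exists>l r. strict_mono (r :: nat \<Rightarrow> nat) \<and> limitin X (a \<circ> r) l sequentially))"

definition seq_compactin :: "'a topology \<Rightarrow> 'a set \<Rightarrow> bool" where
  "seq_compactin X A \<longleftrightarrow> A \<subseteq> topspace X \<and> seq_compact_space (subtopology X A)"

definition countably_compact_space :: "'a topology \<Rightarrow> bool" where
  "countably_compact_space X \<longleftrightarrow>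
     (\<forall>\<U>. countable \<U> \<and> (\<forall>U\<in>\<U>. openin X U) \<and> topspace X \<subseteq> \<Union>\<U> \<longrightarrow>
        (\<exists>\<F>. finite \<F> \<and> \<F> \<subseteq> \<U> \<and> topspace X \<subseteq> \<Union>\<F>))"

definition countably_compactin :: "'a topology \<Rightarrow> 'a set \<Rightarrow> bool" where
  "countably_compactin X A \<longleftrightarrow> A \<subseteq> topspace X \<and> countably_compact_space (subtopology X A)"

definition functionally_bounded_in :: "'a topology \<Rightarrow> 'a set \<Rightarrow> bool" where
  "functionally_bounded_in X A \<longleftrightarrow>
     A \<subseteq> topspace X \<and> (\<forall>f. continuous_map X euclideanreal f \<longrightarrow> bounded (f ` A))"

definition pseudocompact_space :: "'a topology \<Rightarrow> bool" where
  "pseudocompact_space X \<longleftrightarrow>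
     (\<forall>f. continuous_map X euclideanreal f \<longrightarrow> bounded (f ` topspace X))"

definition pseudocompactin :: "'a topology \<Rightarrow> 'a set \<Rightarrow> bool" where
  "pseudocompactin X A \<longleftrightarrow> A \<subseteq> topspace X \<and> pseudocompact_space (subtopology X A)"

definition relatively_compact_in :: "'a topology \<Rightarrow> 'a set \<Rightarrow> bool" where
  "relatively_compact_in X A \<longleftrightarrow> A \<subseteq> topspace X \<and> compactin X (X closure_of A)"

definition discrete_subset :: "'a topology \<Rightarrow> 'a set \<Rightarrow> bool" where
  "discrete_subset X A \<longleftrightarrow> A \<subseteq> topspace X \<and> subtopology X A = discrete_topology A"

definition C_embedded :: "'a topology \<Rightarrow> 'a set \<Rightarrow> bool" where
  "C_embedded X A \<longleftrightarrow> A \<subseteq> topspace X \<and>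
     (\<forall>f. continuous_map (subtopology X A) euclideanreal f \<longrightarrow>
        (\<exists>g. continuous_map X euclideanreal g \<and> (\<forall>x\<in>A. g x = f x)))"

definition weakly_respects ::
  "('k::real_or_complex_field \<Rightarrow> 'a::ab_group_add \<Rightarrow> 'a) \<Rightarrow> 'a topology \<Rightarrow>
     ('a topology \<Rightarrow> 'a set \<Rightarrow> bool) \<Rightarrow> bool" where
  "weakly_respects smul E P \<longleftrightarrow> {A. P (weak_topology smul E) A} = {A. P E A}"


section \<open>The unit basis of \<open>\<ell>\<^sub>1\<close>\<close>

definition ell1 :: "(nat \<Rightarrow> 'k::real_or_complex_field) set" where
  "ell1 = {x. (\<lambda>n. norm (x n)) summable_on UNIV}"

definition ell1_dist :: "(nat \<Rightarrow> 'k::real_or_complex_field) \<Rightarrow> (nat \<Rightarrow> 'k) \<Rightarrow> real" where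
  "ell1_dist x y = (\<Sum>\<^sub>\<infinity>n. norm (x n - y n))"

lemma ell1_diff_summable:
  assumes "x \<in> ell1" "y \<in> ell1"
  shows "(\<lambda>n. norm (x n - y n)) summable_on UNIV"
proof (rule summable_on_comparison_test)
  show "(\<lambda>n. norm (x n) + norm (y n)) summable_on UNIV"
    using assms by (auto simp: ell1_def intro: summable_on_add)
qed (auto intro: norm_triangle_ineq4)

lemma Metric_space_ell1: "Metric_space (ell1 :: (nat \<Rightarrow> 'k::real_or_complex_field) set) ell1_dist"
proof
  fix x y z :: "nat \<Rightarrow> 'k"
  show "0 \<le> ell1_dist x y"
    by (simp add: ell1_dist_def infsum_nonneg)
  show "ell1_dist x y = ell1_dist y x"
    by (simp add: ell1_dist_def norm_minus_commute)
  show "ell1_dist x y = 0 \<longleftrightarrow> x = y" if "x \<in> ell1" "y \<in> ell1"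
  proof
    assume "ell1_dist x y = 0"
    then have "norm (x n - y n) = 0" for n
      using nonneg_infsum_le_0D[OF _ ell1_diff_summable[OF that], of n]
      by (simp add: ell1_dist_def)
    then show "x = y"
      by auto
  qed (simp add: ell1_dist_def)
  assume *: "x \<in> ell1" "y \<in> ell1" "z \<in> ell1"
  have "ell1_dist x z \<le> (\<Sum>\<^sub>\<infinity>n. norm (x n - y n) + norm (y n - z n))"
    unfolding ell1_dist_def
    using * by (intro infsum_mono summable_on_add ell1_diff_summable norm_diff_triangle_le) auto
  also have "\<dots> = ell1_dist x y + ell1_dist y z"
    unfolding ell1_dist_def using * by (intro infsum_add ell1_diff_summable)
  finally show "ell1_dist x z \<le> ell1_dist x y + ell1_dist y z" .
qed

definition ell1_topology :: "(nat \<Rightarrow> 'k::real_or_complex_field) topology" where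
  "ell1_topology = Metric_space.mtopology ell1 ell1_dist"

definition ell1_unit :: "nat \<Rightarrow> nat \<Rightarrow> 'k::real_or_complex_field" where
  "ell1_unit n = (\<lambda>k. if k = n then 1 else 0)"

text \<open>
  The isomorphism is only constrained on the closed span \<open>S\<close>. Its range \<open>R ` S\<close> is a linear
  subspace of \<open>\<ell>\<^sub>1\<close>, which \<^const>\<open>embedding_map\<close> equips with the subspace topology.
\<close>

definition equivalent_to_ell1_basis ::
  "('k::real_or_complex_field \<Rightarrow> 'a::ab_group_add \<Rightarrow> 'a) \<Rightarrow> 'a topology \<Rightarrow> (nat \<Rightarrow> 'a) \<Rightarrow> bool" where
  "equivalent_to_ell1_basis smul E a \<longleftrightarrow>
     (let S = E closure_of module.span smul (range a) in
      \<exists>R :: 'a \<Rightarrow> nat \<Rightarrow> 'k.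
        (\<forall>x\<in>S. \<forall>y\<in>S. R (x + y) = (\<lambda>k. R x k + R y k)) \<and>
        (\<forall>c. \<forall>x\<in>S. R (smul c x) = (\<lambda>k. c * R x k)) \<and>
        embedding_map (subtopology E S) ell1_topology R \<and>
        (\<forall>n. R (a n) = ell1_unit n))"

end

theory Submission
  imports Defs
begin

text \<open>
  Everything rests on Rosenthal's dichotomy. A bounded sequence has either a weakly Cauchy
  subsequence or one dominating the norm of \<open>\<ell>\<^sub>1\<close>; metrizability of separable bounded sets lets
  countably many sets of functionals exhaust the dual in the diagonal argument. Under the Schur
  property a separated sequence has no weakly Cauchy subsequence, so it has a subsequence \<open>b\<close>
  equivalent to the basis of \<open>\<ell>\<^sub>1\<close>. Interpolating bounded scalar sequences along \<open>b\<close> by continuous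
  functionals gives a weakly continuous function that is unbounded along \<open>b\<close>. Hence weakly
  functionally bounded sets are precompact, their closures are compact by quasi-completeness, and
  on compact sets the two topologies agree. Conversely, a weakly convergent sequence that does not
  converge is bounded and not precompact, and together with its limit it is weakly compact.
\<close>

section \<open>Independent subsequences\<close>

text \<open>In a Banach space the dual is the union of countably many multiples of one ball, and
  Rosenthal's argument runs on that ball. Here the dual is a union of polars of possibly uncountably
  many neighbourhoods, whereas a diagonal sequence can serve only countably many sets. The remedy is
  to measure functionals only on a countable bounded set: the combinations of the terms with
  coefficients from a countable dense set of scalars and total modulus at most 1. Its relative
  topology has a countable base at 0, and every continuous functional is small on some member of
  that base. The price is a lower estimate that is at first available only for these combinations
  and is then extended by approximation and scaling. Assertions (ii)-(vi) are handled together: each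
  of the properties holds for a weakly convergent sequence with its limit, and each implies
  functional boundedness. The scalar field is given only by axioms; real parts are estimated there
  with a factor 2, from which the factors 4 and 8 further on arise.\<close>

lemma infinite_Int_greaterThan:
  fixes M :: "nat set"
  assumes "infinite M"
  shows "infinite (M \<inter> {l<..})"
proof
  assume "finite (M \<inter> {l<..})"
  moreover have "M \<subseteq> (M \<inter> {l<..}) \<union> {..l}" by auto
  ultimately show False
    using assms finite_subset by blast
qed

text \<open>A diagonal sequence with requirements imposed on the sets that remain after each choice.
  The requirement may depend on the stage or on the chosen point: \<open>rich_split\<close> uses
  only the point, the construction of a weakly Cauchy subsequence only the stage.\<close>

lemma fusion:
  fixes Q :: "nat \<Rightarrow> nat \<Rightarrow> nat set \<Rightarrow> bool"
  assumes inf: "infinite M0"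
    and step: "\<And>k m M. infinite M \<Longrightarrow> M \<subseteq> M0 \<Longrightarrow> m \<in> M0 \<Longrightarrow> \<exists>M'\<subseteq>M. infinite M' \<and> Q k m M'"
  shows "\<exists>ms Ms. strict_mono ms \<and>
    (\<forall>k. ms k \<in> M0 \<and> infinite (Ms k) \<and> Ms k \<subseteq> M0 \<and> Q k (ms k) (Ms k)) \<and> (\<forall>k l. k < l \<longrightarrow> ms l \<in> Ms k)"
proof -
  define P where "P = (\<lambda>k (m, M). m \<in> M0 \<and> infinite M \<and> M \<subseteq> M0 \<and> M \<subseteq> {m<..} \<and> Q k m M)"
  define R where "R = (\<lambda>(k::nat) (m::nat, M) (m', M'::nat set). m' \<in> M \<and> M' \<subseteq> M)"
  have next_state: "\<exists>m\<in>M. \<exists>M'\<subseteq>M. P k (m, M')" if M: "infinite M" "M \<subseteq> M0" for M k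
  proof -
    obtain m where m: "m \<in> M"
      using \<open>infinite M\<close> by fastforce
    \<comment> \<open>Discarding everything up to \<open>m\<close> before \<open>step\<close> is
      applied makes the sequence of points strictly increasing.\<close>
    have "infinite (M \<inter> {m<..})"
      using \<open>infinite M\<close> by (rule infinite_Int_greaterThan)
    then obtain M' where "M' \<subseteq> M \<inter> {m<..}" "infinite M'" "Q k m M'"
      using step[of "M \<inter> {m<..}" m k] M m by blast
    then show ?thesis
      using M m by (auto simp: P_def)
  qed
  have "\<exists>f. \<forall>k. P k (f k) \<and> R k (f k) (f (Suc k))"
  proof (rule dependent_nat_choice)
    show "\<exists>x. P 0 x"
      using next_state[OF inf] by blast
    show "\<exists>y. P (Suc k) y \<and> R k x y" if "P k x" for x k
    proof -
      obtain m M where x: "x = (m, M)" by (metis surj_pair)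
      then have "infinite M" "M \<subseteq> M0"
        using that by (simp_all add: P_def)
      then obtain m' M' where "m' \<in> M" "M' \<subseteq> M" "P (Suc k) (m', M')"
        using next_state by blast
      then show ?thesis
        by (intro exI[of _ "(m', M')"]) (simp add: x R_def)
    qed
  qed
  then obtain f where f: "\<And>k. P k (f k)" "\<And>k. R k (f k) (f (Suc k))"
    by blast
  have P: "fst (f k) \<in> M0" "infinite (snd (f k))" "snd (f k) \<subseteq> M0" "snd (f k) \<subseteq> {fst (f k)<..}"
    "Q k (fst (f k)) (snd (f k))" for k
    using f(1)[of k] by (simp_all add: P_def case_prod_beta)
  have R: "fst (f (Suc k)) \<in> snd (f k)" "snd (f (Suc k)) \<subseteq> snd (f k)" for k
    using f(2)[of k] by (simp_all add: R_def case_prod_beta)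
  have sub: "snd (f l) \<subseteq> snd (f k)" if "k \<le> l" for k l
    by (rule lift_Suc_antimono_le[of "\<lambda>k. snd (f k)", OF R(2) that])
  have mem: "fst (f l) \<in> snd (f k)" if kl: "k < l" for k l
  proof -
    obtain l' where l': "l = Suc l'" "k \<le> l'"
      using kl by (metis Suc_leI Suc_le_D Suc_le_mono)
    then show ?thesis
      using R(1)[of l'] sub[of k l'] by blast
  qed
  have "strict_mono (\<lambda>k. fst (f k))"
    unfolding strict_mono_def using mem P(4) by blast
  then show ?thesis
    using P mem by (intro exI[of _ "\<lambda>k. fst (f k)"] exI[of _ "\<lambda>k. snd (f k)"]) simp
qed

text \<open>In the application \<open>A n\<close> and \<open>B n\<close> collect the functionals
  whose value at the n-th term lies in one of two disjoint discs, so an oscillating \<open>h\<close>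
  shows that the terms indexed by \<open>M\<close> are not weakly Cauchy.\<close>

definition oscillates :: "(nat \<Rightarrow> 'h set) \<Rightarrow> (nat \<Rightarrow> 'h set) \<Rightarrow> nat set \<Rightarrow> 'h \<Rightarrow> bool" where
  "oscillates A B M h \<longleftrightarrow> infinite {n\<in>M. h \<in> A n} \<and> infinite {n\<in>M. h \<in> B n}"

text \<open>Quantifying over all infinite subsets makes the notion hereditary in \<open>M\<close>,
  as diagonal arguments require; where it fails, some infinite subset carries no oscillation by
  points of \<open>S\<close>.\<close>

definition rich :: "(nat \<Rightarrow> 'h set) \<Rightarrow> (nat \<Rightarrow> 'h set) \<Rightarrow> 'h set \<Rightarrow> nat set \<Rightarrow> bool" where
  "rich A B S M \<longleftrightarrow> (\<forall>M'\<subseteq>M. infinite M' \<longrightarrow> (\<exists>h\<in>S. oscillates A B M' h))"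

text \<open>A diagonal sequence lies in the set of each stage only up to finitely many terms, which
  oscillation does not notice.\<close>

lemma oscillates_almost_mono:
  assumes "oscillates A B M h" "finite (M - M')"
  shows "oscillates A B M' h"
proof -
  have "infinite {n\<in>M'. h \<in> X n}" if "infinite {n\<in>M. h \<in> X n}" for X :: "nat \<Rightarrow> 'a set"
  proof
    assume "finite {n\<in>M'. h \<in> X n}"
    moreover have "{n\<in>M. h \<in> X n} \<subseteq> {n\<in>M'. h \<in> X n} \<union> (M - M')" by auto
    ultimately show False
      using that assms(2) finite_subset by blast
  qed
  then show ?thesis
    using assms(1) by (simp add: oscillates_def)
qed

lemma rich_subset: "rich A B S M \<Longrightarrow> M' \<subseteq> M \<Longrightarrow> rich A B S M'"
  unfolding rich_def by blast

text \<open>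
  The heart of Rosenthal's dichotomy: were the conclusion false, a fusion sequence would meet the
  same obstacle \<open>S \<inter> A m\<close> (or \<open>S \<inter> B m\<close>) infinitely often, and a point of \<open>S\<close> oscillating on
  the terms where this happens would overcome it.
\<close>

lemma rich_split:
  assumes "finite F" "infinite M" and rich: "\<And>S. S \<in> F \<Longrightarrow> rich A B S M"
  shows "\<exists>m\<in>M. \<exists>M'\<subseteq>M. infinite M' \<and> (\<forall>S\<in>F. rich A B (S \<inter> A m) M' \<and> rich A B (S \<inter> B m) M')"
proof (rule ccontr)
  assume neg: "\<not> ?thesis"
  define X where "X = (\<lambda>b. if b then A else B)"
  \<comment> \<open>An obstacle is a set \<open>S\<close> together with the side \<open>b\<close> on
    which it fails. As \<open>F\<close> is finite there are finitely many obstacles, so one of them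
    recurs infinitely often.\<close>
  define bad where "bad = (\<lambda>(m::nat) N (S, b). S \<in> F \<and> (\<forall>h\<in>S \<inter> X b m. \<not> oscillates A B N h))"
  have step: "\<exists>N'\<subseteq>N. infinite N' \<and> (\<exists>p. bad m N' p)" if N: "infinite N" "N \<subseteq> M" and m: "m \<in> M" for m N
  proof -
    obtain S where S: "S \<in> F" "\<not> (rich A B (S \<inter> A m) N \<and> rich A B (S \<inter> B m) N)"
      using neg N m by blast
    then obtain b where "\<not> rich A B (S \<inter> X b m) N"
      by (metis X_def)
    then obtain N' where "N' \<subseteq> N" "infinite N'" "\<forall>h\<in>S \<inter> X b m. \<not> oscillates A B N' h"
      unfolding rich_def by auto
    then show ?thesis
      using S(1) by (auto simp: bad_def)
  qed
  have "\<exists>(ms :: nat \<Rightarrow> nat) Ms. strict_mono ms \<and> (\<forall>k. ms k \<in> M \<and> infinite (Ms k) \<and> Ms k \<subseteq> M \<and>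
      (\<exists>p. bad (ms k) (Ms k) p)) \<and> (\<forall>k l. k < l \<longrightarrow> ms l \<in> Ms k)"
    by (rule fusion[OF \<open>infinite M\<close>]) (rule step)
  then obtain ms :: "nat \<Rightarrow> nat" and Ms where ms: "strict_mono ms"
    "\<forall>k. ms k \<in> M \<and> infinite (Ms k) \<and> Ms k \<subseteq> M \<and> (\<exists>p. bad (ms k) (Ms k) p)"
    and "\<forall>k l. k < l \<longrightarrow> ms l \<in> Ms k"
    by (elim exE conjE)
  then have bad: "\<And>k. \<exists>p. bad (ms k) (Ms k) p" and mem: "\<And>k l. k < l \<Longrightarrow> ms l \<in> Ms k"
    by simp_all
  obtain p where p: "\<And>k. bad (ms k) (Ms k) (p k)"
    using bad by metis
  have "fst (p k) \<in> F" for k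
    using p[of k] by (cases "p k") (simp add: bad_def)
  then have "p ` UNIV \<subseteq> F \<times> UNIV"
    by (metis UNIV_I image_subsetI mem_Times_iff)
  then have "finite (p ` UNIV)"
    by (rule finite_subset) (use \<open>finite F\<close> in simp)
  then obtain k0 where "infinite {k. p k = p k0}"
    using pigeonhole_infinite[of UNIV p] by auto
  moreover obtain S b where "p k0 = (S, b)"
    by (cases "p k0")
  moreover define J where "J = {k. p k = p k0}"
  ultimately have J: "infinite J" "\<And>k. k \<in> J \<Longrightarrow> p k = (S, b)"
    by simp_all
  have inj: "inj ms"
    using ms(1) by (simp add: strict_mono_imp_inj_on)
  have "infinite (ms ` J)" "ms ` J \<subseteq> M"
    using J(1) ms(2) inj by (auto simp: finite_image_iff inj_on_subset)
  moreover have "S \<in> F"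
  proof -
    obtain k where "k \<in> J" using J(1) by fastforce
    then show ?thesis
      using p[of k] J(2)[of k] by (simp add: bad_def)
  qed
  ultimately obtain h where h: "h \<in> S" "oscillates A B (ms ` J) h"
    using rich[of S] unfolding rich_def by blast
  then have "infinite {n\<in>ms ` J. h \<in> X b n}"
    by (simp add: oscillates_def X_def)
  then have "{n\<in>ms ` J. h \<in> X b n} \<noteq> {}"
    by force
  then obtain j where j: "j \<in> J" "h \<in> X b (ms j)"
    by auto
  have "ms ` J - Ms j \<subseteq> ms ` {..j}"
  proof
    fix n assume "n \<in> ms ` J - Ms j"
    then obtain k where k: "n = ms k" "ms k \<notin> Ms j" by blast
    then have "\<not> j < k" using mem by blast
    then show "n \<in> ms ` {..j}" using k(1) by simp
  qed
  then have "finite (ms ` J - Ms j)"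
    using finite_subset by blast
  then have "oscillates A B (Ms j) h"
    by (rule oscillates_almost_mono[OF h(2)])
  then show False
    using p[of j] J(2)[of j] j h(1) by (auto simp: bad_def)
qed

text \<open>The family \<open>F\<close> of a state holds the cells into which the choices made so
  far cut \<open>K\<close>. \<open>rich_split\<close> finds an index whose two sets cut every cell
  into two cells that are again rich along a common infinite set, and a cell that is rich along an
  infinite set is non-empty.\<close>

lemma rich_imp_independent:
  fixes A B :: "nat \<Rightarrow> 'h set"
  assumes "infinite M0" "rich A B K M0"
  obtains r :: "nat \<Rightarrow> nat" where "strict_mono r"
    "\<And>n P. \<exists>h\<in>K. \<forall>i<n. h \<in> (if i \<in> P then A (r i) else B (r i))"
proof -
  define P where "P = (\<lambda>(k::nat) (m::nat, F, M). finite F \<and> infinite M \<and> M \<subseteq> {m..} \<and>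
    (k = 0 \<longrightarrow> F = {K}) \<and> (\<forall>S\<in>F. rich A B S M))"
  define R where "R = (\<lambda>(k::nat) (m, F, M :: nat set) (m', F', M' :: nat set). m < m' \<and> M' \<subseteq> M \<and>
    F' = (\<lambda>S. S \<inter> A m') ` F \<union> (\<lambda>S. S \<inter> B m') ` F)"
  have "\<exists>f :: nat \<Rightarrow> nat \<times> 'h set set \<times> nat set. \<forall>k. P k (f k) \<and> R k (f k) (f (Suc k))"
  proof (rule dependent_nat_choice)
    show "\<exists>x. P 0 x"
      using assms by (intro exI[of _ "(0, {K}, M0)"]) (auto simp: P_def)
  next
    fix x k assume x: "P k x"
    obtain m F M where xeq: "x = (m, F, M)" by (metis surj_pair)
    have *: "finite F" "infinite M" "\<forall>S\<in>F. rich A B S M"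
      using x by (auto simp: xeq P_def)
    have inf: "infinite (M \<inter> {l<..})" for l
      using *(2) by (rule infinite_Int_greaterThan)
    obtain m' M' where m': "m' \<in> M \<inter> {m<..}" "M' \<subseteq> M \<inter> {m<..}" "infinite M'"
      "\<And>S. S \<in> F \<Longrightarrow> rich A B (S \<inter> A m') M' \<and> rich A B (S \<inter> B m') M'"
      using rich_split[OF *(1) inf[of m], of A B] *(3) rich_subset by (metis inf_le1)
    define M'' where "M'' = M' \<inter> {m'<..}"
    have "infinite M''"
      unfolding M''_def using m'(3) by (rule infinite_Int_greaterThan)
    then have "P (Suc k) (m', (\<lambda>S. S \<inter> A m') ` F \<union> (\<lambda>S. S \<inter> B m') ` F, M'')"
      using m'(4) * by (auto simp: P_def M''_def intro: rich_subset)
    then show "\<exists>y. P (Suc k) y \<and> R k x y"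
      using m' by (intro exI[of _ "(m', (\<lambda>S. S \<inter> A m') ` F \<union> (\<lambda>S. S \<inter> B m') ` F, M'')"])
        (auto simp: R_def xeq M''_def)
  qed
  then obtain f where f: "\<And>k. P k (f k)" "\<And>k. R k (f k) (f (Suc k))"
    by blast
  have P: "infinite (snd (snd (f k)))" "k = 0 \<Longrightarrow> fst (snd (f k)) = {K}"
    "\<And>S. S \<in> fst (snd (f k)) \<Longrightarrow> rich A B S (snd (snd (f k)))" for k
    using f(1)[of k] by (simp_all add: P_def case_prod_beta)
  \<comment> \<open>State 0 has the undivided cell \<open>K\<close> and an index that cuts nothing;
    the first cutting index belongs to state 1.\<close>
  define r where "r = (\<lambda>k. fst (f (Suc k)))"
  have R: "fst (f k) < r k" "fst (snd (f (Suc k))) = (\<lambda>S. S \<inter> A (r k)) ` fst (snd (f k)) \<union>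
      (\<lambda>S. S \<inter> B (r k)) ` fst (snd (f k))" for k
    using f(2)[of k] by (simp_all add: R_def r_def case_prod_beta)
  have "strict_mono r"
    unfolding strict_mono_Suc_iff using R(1) by (metis r_def)
  moreover have "\<exists>h\<in>K. \<forall>i<n. h \<in> (if i \<in> N then A (r i) else B (r i))" for n N
  proof -
    have "{h\<in>K. \<forall>i<n. h \<in> (if i \<in> N then A (r i) else B (r i))} \<in> fst (snd (f n))"
    proof (induction n)
      case 0
      then show ?case
        using P(2)[of 0] by simp
    next
      case (Suc n)
      let ?S = "\<lambda>n. {h\<in>K. \<forall>i<n. h \<in> (if i \<in> N then A (r i) else B (r i))}"
      have "?S (Suc n) = ?S n \<inter> (if n \<in> N then A (r n) else B (r n))"
        by (auto simp: less_Suc_eq)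
      then show ?case
        using Suc R(2)[of n] by simp
    qed
    then have "rich A B {h\<in>K. \<forall>i<n. h \<in> (if i \<in> N then A (r i) else B (r i))} (snd (snd (f n)))"
      by (rule P(3))
    then show ?thesis
      using P(1)[of n] unfolding rich_def by blast
  qed
  ultimately show thesis
    using that by blast
qed

section \<open>Ultrafilters\<close>

text \<open>Zorn's lemma, downwards: the infimum of a chain of proper filters is proper because a
  chain is directed. A minimal proper filter decides \<open>P\<close>, since meeting it with
  \<open>P\<close> either destroys it or leaves it unchanged.\<close>

lemma ultrafilter_refinement:
  fixes F :: "'a filter"
  assumes "F \<noteq> bot"
  obtains G where "G \<le> F" "G \<noteq> bot" "\<And>P. eventually P G \<or> eventually (\<lambda>x. \<not> P x) G"
proof -
  define A where "A = {G. G \<le> F \<and> G \<noteq> bot}"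
  have "\<exists>G\<in>A. \<forall>H\<in>A. H \<le> G \<longrightarrow> H = G"
  proof (rule predicate_Zorn)
    show "partial_order_on A (relation_of (\<lambda>G H. H \<le> G) A)"
      by (rule partial_order_on_relation_ofI) auto
    fix C assume C: "C \<in> Chains (relation_of (\<lambda>G H. H \<le> G) A)"
    then have CA: "C \<subseteq> A"
      by (auto simp: Chains_def relation_of_def)
    show "\<exists>u\<in>A. \<forall>a\<in>C. u \<le> a"
    proof (cases "C = {}")
      case True
      then show ?thesis using assms by (auto simp: A_def)
    next
      case False
      have "eventually P (Inf C) \<longleftrightarrow> (\<exists>b\<in>C. eventually P b)" for P
        using False C by (intro eventually_Inf_base) (auto simp: Chains_def relation_of_def)
      then have "Inf C \<noteq> bot"
        using CA unfolding A_def trivial_limit_def by blast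
      moreover have "Inf C \<le> F"
        using False CA by (metis A_def Inf_lower2 ex_in_conv mem_Collect_eq subsetD)
      ultimately show ?thesis
        by (auto simp: A_def intro: Inf_lower)
    qed
  qed
  then obtain G where G: "G \<le> F" "G \<noteq> bot" and max: "\<And>H. H \<le> G \<Longrightarrow> H \<noteq> bot \<Longrightarrow> H = G"
    unfolding A_def by force
  have "eventually P G \<or> eventually (\<lambda>x. \<not> P x) G" for P
  proof (cases "inf G (principal {x. P x}) = bot")
    case True
    then have "eventually (\<lambda>x. False) (inf G (principal {x. P x}))"
      by simp
    then show ?thesis
      by (simp add: eventually_inf_principal)
  next
    case False
    then have "inf G (principal {x. P x}) = G"
      by (intro max) auto
    then have "G \<le> principal {x. P x}"
      by (metis inf_le2)
    then show ?thesis
      by (simp add: le_principal)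
  qed
  then show thesis
    using that G by blast
qed

section \<open>Dominated linear functionals\<close>

definition sublinear :: "(real \<Rightarrow> 'a::ab_group_add \<Rightarrow> 'a) \<Rightarrow> ('a \<Rightarrow> real) \<Rightarrow> bool" where
  "sublinear rs q \<longleftrightarrow>
     (\<forall>x y. q (x + y) \<le> q x + q y) \<and> (\<forall>t x. 0 \<le> t \<longrightarrow> q (rs t x) = t * q x)"

text \<open>A pair \<open>(m, r)\<close> stands for the demand \<open>r \<le> f m\<close> on a
  linear functional \<open>f\<close> that is to be found. Such demands can be added and multiplied
  by positive reals, whence a convex cone.\<close>

definition functional_cone :: "(real \<Rightarrow> 'a::ab_group_add \<Rightarrow> 'a) \<Rightarrow> ('a \<times> real) set \<Rightarrow> bool" where
  "functional_cone rs M \<longleftrightarrow> (0, 0) \<in> M \<and>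
     (\<forall>x r y s. (x, r) \<in> M \<and> (y, s) \<in> M \<longrightarrow> (x + y, r + s) \<in> M) \<and>
     (\<forall>t x r. 0 < t \<and> (x, r) \<in> M \<longrightarrow> (rs t x, t * r) \<in> M)"

context
  fixes rs :: "real \<Rightarrow> 'a::ab_group_add \<Rightarrow> 'a"
  assumes rs: "vector_space rs"
begin

interpretation vector_space rs by (rule rs)

lemma sublinear_zero: "sublinear rs q \<Longrightarrow> q 0 = 0"
  using scale_zero_left[of 0] unfolding sublinear_def by (metis mult_zero_left order_refl)

lemma sublinear_minus: "sublinear rs q \<Longrightarrow> - q (- x) \<le> q x"
  using sublinear_zero[of q] unfolding sublinear_def by (smt (verit) add.right_inverse)

lemma functional_cone_ray: "functional_cone rs {(rs t x, t * c) |t. 0 \<le> t}" (is "functional_cone rs ?M")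
  unfolding functional_cone_def
proof (intro conjI allI impI)
  show "(0, 0) \<in> ?M"
    using scale_zero_left[of x] by (auto intro!: exI[of _ 0])
  show "(y + y', r + r') \<in> ?M" if yr: "(y, r) \<in> ?M \<and> (y', r') \<in> ?M" for y r y' r'
  proof -
    from yr obtain t t' where "0 \<le> t" "0 \<le> t'" "y = rs t x" "r = t * c" "y' = rs t' x" "r' = t' * c"
      by blast
    then show ?thesis
      by (auto simp: scale_left_distrib distrib_right intro!: exI[of _ "t + t'"])
  qed
  show "(rs t y, t * r) \<in> ?M" if yr: "0 < t \<and> (y, r) \<in> ?M" for t y r
  proof -
    from yr obtain t' where "0 \<le> t'" "y = rs t' x" "r = t' * c"
      by blast
    then show ?thesis
      using yr by (auto intro!: exI[of _ "t * t'"])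
  qed
qed

text \<open>Take \<open>q' x\<close> to be the infimum of \<open>q (x + m) - r\<close> over the
  cone. Domination of the cone by \<open>q\<close> bounds it below by \<open>- q (- x)\<close>. A
  linear functional below \<open>q'\<close> satisfies \<open>f (- m) \<le> - r\<close>, so all
  demands are now built into the sublinear bound.\<close>

lemma sublinear_cone_Inf:
  assumes q: "sublinear rs q" and M: "functional_cone rs M"
    and le: "\<And>m r. (m, r) \<in> M \<Longrightarrow> r \<le> q m"
  obtains q' where "sublinear rs q'" "\<And>x. q' x \<le> q x" "\<And>m r. (m, r) \<in> M \<Longrightarrow> q' (- m) \<le> - r"
proof -
  define D where "D = (\<lambda>x. (\<lambda>(m, r). q (x + m) - r) ` M)"
  define q' where "q' = (\<lambda>x. Inf (D x))"
  have ne: "D x \<noteq> {}" for x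
    using M by (auto simp: D_def functional_cone_def)
  have lb: "- q (- x) \<le> d" if "d \<in> D x" for x d
  proof -
    obtain m r where mr: "(m, r) \<in> M" "d = q (x + m) - r"
      using \<open>d \<in> D x\<close> by (auto simp: D_def)
    have "q m \<le> q (x + m) + q (- x)"
      using q unfolding sublinear_def by (metis add.commute add_minus_cancel)
    then show ?thesis
      using le[OF mr(1)] mr(2) by linarith
  qed
  have bdd: "bdd_below (D x)" for x
    using lb by (rule bdd_belowI)
  have q'_le: "q' x \<le> q (x + m) - r" if "(m, r) \<in> M" for x m r
    unfolding q'_def by (rule cInf_lower[OF _ bdd]) (use that in \<open>auto simp: D_def\<close>)
  have q'_ge: "c \<le> q' x" if "\<And>m r. (m, r) \<in> M \<Longrightarrow> c \<le> q (x + m) - r" for c x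
    unfolding q'_def by (rule cInf_greatest[OF ne]) (use that in \<open>auto simp: D_def\<close>)
  have M0: "(0, 0) \<in> M"
    using M by (simp add: functional_cone_def)
  have add: "q' (x + y) \<le> q' x + q' y" for x y
  proof -
    have 1: "q' (x + y) \<le> (q (x + m) - r) + (q (y + n) - s)" if "(m, r) \<in> M" "(n, s) \<in> M" for m r n s
    proof -
      have "(m + n, r + s) \<in> M"
        using M that by (simp add: functional_cone_def)
      then have "q' (x + y) \<le> q ((x + y) + (m + n)) - (r + s)"
        by (rule q'_le)
      also have "(x + y) + (m + n) = (x + m) + (y + n)"
        by (simp add: algebra_simps)
      also have "q \<dots> \<le> q (x + m) + q (y + n)"
        using q by (simp add: sublinear_def)
      finally show ?thesis by simp
    qed
    have "q' (x + y) - (q (x + m) - r) \<le> q' y" if "(m, r) \<in> M" for m r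
      by (rule q'_ge) (use 1 that in fastforce)
    then have "q' (x + y) - q' y \<le> q' x"
      by (intro q'_ge) fastforce
    then show ?thesis by simp
  qed
  have scale_le: "q' (rs t x) \<le> t * q' x" if t: "0 < t" for t x
  proof -
    have "q' (rs t x) / t \<le> q' x"
    proof (rule q'_ge)
      fix m r assume mr: "(m, r) \<in> M"
      have "q' (rs t x) \<le> q (rs t x + rs t m) - t * r"
        using q'_le M mr t unfolding functional_cone_def by blast
      also have "\<dots> = t * (q (x + m) - r)"
      proof -
        have "q (rs t (x + m)) = t * q (x + m)"
          using q t unfolding sublinear_def by (meson less_imp_le)
        then show ?thesis
          by (simp add: scale_right_distrib right_diff_distrib)
      qed
      finally show "q' (rs t x) / t \<le> q (x + m) - r"
        using t by (simp add: field_simps)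
    qed
    then show ?thesis
      using t by (simp add: field_simps)
  qed
  have q'0: "q' 0 = 0"
  proof (rule antisym)
    show "q' 0 \<le> 0"
      using q'_le[OF M0, of 0] sublinear_zero[OF q] by simp
    show "0 \<le> q' 0"
      by (rule q'_ge) (use le in simp)
  qed
  have "q' (rs t x) = t * q' x" if t: "0 \<le> t" for t x
  proof (cases "t = 0")
    case False
    then have t: "0 < t" using t by simp
    have "q' (rs (1 / t) (rs t x)) \<le> (1 / t) * q' (rs t x)"
      by (rule scale_le) (use t in simp)
    then have "t * q' x \<le> q' (rs t x)"
      using t by (simp add: field_simps)
    then show ?thesis
      using scale_le[OF t, of x] by simp
  qed (use q'0 in simp)
  then have "sublinear rs q'"
    using add by (simp add: sublinear_def)
  moreover have "q' x \<le> q x" for x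
    using q'_le[OF M0, of x] by simp
  moreover have "q' (- m) \<le> - r" if "(m, r) \<in> M" for m r
    using q'_le[OF that, of "- m"] sublinear_zero[OF q] by simp
  ultimately show thesis
    using that by blast
qed

text \<open>Minimal sublinear functionals turn out to be linear, so this replaces the
  one-dimensional extension steps of the usual Hahn-Banach proof. The pointwise infimum of a chain
  is subadditive because any two members have a smaller one in the chain.\<close>

lemma exists_minimal_sublinear:
  assumes "sublinear rs q"
  obtains s where "sublinear rs s" "s \<le> q" "\<And>s'. sublinear rs s' \<Longrightarrow> s' \<le> s \<Longrightarrow> s' = s"
proof -
  define A where "A = {s. sublinear rs s \<and> s \<le> q}"
  have "\<exists>s\<in>A. \<forall>s'\<in>A. s' \<le> s \<longrightarrow> s' = s"
  proof (rule predicate_Zorn)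
    show "partial_order_on A (relation_of (\<lambda>s s'. s' \<le> s) A)"
      by (rule partial_order_on_relation_ofI) auto
    fix C assume C: "C \<in> Chains (relation_of (\<lambda>s s'. s' \<le> s) A)"
    show "\<exists>u\<in>A. \<forall>s\<in>C. u \<le> s"
    proof (cases "C = {}")
      case True
      then show ?thesis using assms by (auto simp: A_def)
    next
      case False
      have CA: "s \<in> A" if "s \<in> C" for s
        using C that by (auto simp: Chains_def relation_of_def)
      have lin: "s \<le> s' \<or> s' \<le> s" if "s \<in> C" "s' \<in> C" for s s'
        using C that by (auto simp: Chains_def relation_of_def)
      have sub: "sublinear rs s" "s x \<le> q x" if "s \<in> C" for s x
        using CA[OF that] by (auto simp: A_def le_fun_def)
      define u where "u = (\<lambda>x. INF s\<in>C. s x)"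
      have bdd: "bdd_below ((\<lambda>s. s x) ` C)" for x
      proof (rule bdd_belowI2)
        fix s assume "s \<in> C"
        then show "- q (- x) \<le> s x"
          using sub(1)[of s] sub(2)[of s "- x"] sublinear_minus[of s x] by fastforce
      qed
      have u_le: "u x \<le> s x" if "s \<in> C" for s x
        unfolding u_def by (rule cINF_lower[OF bdd that])
      have u_ge: "c \<le> u x" if "\<And>s. s \<in> C \<Longrightarrow> c \<le> s x" for c x
        unfolding u_def by (rule cINF_greatest[OF False that])
      have two: "u (x + y) \<le> s x + s' y" if st: "s \<in> C" "s' \<in> C" for s s' x y
      proof -
        obtain w where w: "w \<in> C" "w \<le> s" "w \<le> s'"
          using lin st by blast
        have "u (x + y) \<le> w (x + y)" by (rule u_le[OF w(1)])
        also have "\<dots> \<le> w x + w y" using sub(1)[OF w(1)] by (simp add: sublinear_def)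
        also have "\<dots> \<le> s x + s' y" using w by (simp add: le_fun_def add_mono)
        finally show ?thesis .
      qed
      have add: "u (x + y) \<le> u x + u y" for x y
      proof -
        have "u (x + y) - s x \<le> u y" if "s \<in> C" for s
          by (rule u_ge) (use two[OF that, of _ x y] in fastforce)
        then have "u (x + y) - u y \<le> u x"
          by (intro u_ge) fastforce
        then show ?thesis by simp
      qed
      have "u (rs t x) = t * u x" if t: "0 \<le> t" for t x
      proof (cases "t = 0")
        case True
        have "(\<lambda>s. s 0) ` C = {0}"
          using sublinear_zero[OF sub(1)] \<open>C \<noteq> {}\<close> by force
        then have "u 0 = 0"
          by (simp add: u_def)
        then show ?thesis using True by simp
      next
        case False
        then have t: "0 < t" using t by simp
        have eq: "s (rs t x) = t * s x" if "s \<in> C" for s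
          using sub(1)[OF that] t by (simp add: sublinear_def)
        show ?thesis
        proof (rule antisym)
          have "u (rs t x) / t \<le> u x"
            by (rule u_ge) (use u_le[of _ "rs t x"] eq t in \<open>fastforce simp: field_simps\<close>)
          then show "u (rs t x) \<le> t * u x"
            using t by (simp add: field_simps)
          show "t * u x \<le> u (rs t x)"
            by (rule u_ge) (use u_le[of _ x] eq t in \<open>fastforce simp: field_simps\<close>)
        qed
      qed
      then have "sublinear rs u"
        using add by (simp add: sublinear_def)
      moreover have "u \<le> q"
        using False sub(2) u_le by (fastforce simp: le_fun_def intro: order_trans)
      ultimately show ?thesis
        using u_le by (auto simp: A_def le_fun_def)
    qed
  qed
  then obtain s where s: "s \<in> A" and min: "\<And>s'. s' \<in> A \<Longrightarrow> s' \<le> s \<Longrightarrow> s' = s"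
    by blast
  show thesis
  proof (rule that)
    show "s' = s" if "sublinear rs s'" "s' \<le> s" for s'
      by (rule min) (use that s in \<open>auto simp: A_def intro: order_trans\<close>)
  qed (use s in \<open>auto simp: A_def\<close>)
qed

text \<open>
  This form of the Hahn--Banach theorem yields extensions if the cone \<open>M\<close> is the graph of a
  functional, and prescribed values or Banach limits for other cones.
\<close>

theorem Mazur_Orlicz:
  assumes q: "sublinear rs q" and M: "functional_cone rs M"
    and le: "\<And>m r. (m, r) \<in> M \<Longrightarrow> r \<le> q m"
  obtains f where "\<And>x y. f (x + y) = f x + f y" "\<And>t x. f (rs t x) = t * f x"
    "\<And>x. f x \<le> q x" "\<And>m r. (m, r) \<in> M \<Longrightarrow> r \<le> f m"
proof -
  obtain q' where q': "sublinear rs q'" "\<And>x. q' x \<le> q x" "\<And>m r. (m, r) \<in> M \<Longrightarrow> q' (- m) \<le> - r"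
    using sublinear_cone_Inf[OF q M le] by blast
  obtain s where s: "sublinear rs s" "s \<le> q'" and min: "\<And>s'. sublinear rs s' \<Longrightarrow> s' \<le> s \<Longrightarrow> s' = s"
    using exists_minimal_sublinear[OF q'(1)] by blast
  \<comment> \<open>Imposing on \<open>s\<close> the demand of having at least its own value at
    \<open>y\<close> cannot lower it, by minimality; hence \<open>s\<close> is odd, and a
    subadditive odd functional is additive.\<close>
  have neg: "s (- y) = - s y" for y
  proof -
    let ?N = "{(rs t y, t * s y) |t. 0 \<le> t}"
    have "functional_cone rs ?N"
      by (rule functional_cone_ray)
    moreover have "r \<le> s m" if "(m, r) \<in> ?N" for m r
      using that s(1) by (auto simp: sublinear_def)
    ultimately obtain s' where s': "sublinear rs s'" "\<And>x. s' x \<le> s x" "\<And>m r. (m, r) \<in> ?N \<Longrightarrow> s' (- m) \<le> - r"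
      using sublinear_cone_Inf[OF s(1)] by blast
    have "(y, s y) \<in> ?N"
      by (auto intro!: exI[of _ 1])
    then have "s' (- y) \<le> - s y"
      by (rule s'(3))
    moreover have "s' = s"
      by (rule min) (use s' in \<open>auto simp: le_fun_def\<close>)
    ultimately show ?thesis
      using sublinear_minus[OF s(1), of y] by simp
  qed
  show thesis
  proof (rule that)
    show "s (x + y) = s x + s y" for x y
    proof (rule antisym)
      show "s (x + y) \<le> s x + s y"
        using s(1) by (simp add: sublinear_def)
      have "s (- x + - y) \<le> s (- x) + s (- y)"
        using s(1) unfolding sublinear_def by blast
      moreover have "s (- x + - y) = - s (x + y)"
        using neg[of "x + y"] by simp
      ultimately show "s x + s y \<le> s (x + y)"
        using neg[of x] neg[of y] by linarith
    qed
    show "s (rs t x) = t * s x" for t x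
    proof (cases "0 \<le> t")
      case False
      then have "0 \<le> - t" by simp
      then have "s (rs (- t) x) = (- t) * s x"
        using s(1) unfolding sublinear_def by blast
      then show ?thesis
        using neg[of "rs t x"] by (simp add: scale_minus_left)
    qed (use s(1) in \<open>simp add: sublinear_def\<close>)
    show "s x \<le> q x" for x
      using s(2) q'(2) by (meson le_funE order_trans)
    show "r \<le> s m" if "(m, r) \<in> M" for m r
    proof -
      have "s (- m) \<le> - r"
        using s(2) q'(3)[OF that] by (meson le_funE order_trans)
      then show ?thesis
        using neg[of m] by simp
    qed
  qed
qed

end

section \<open>The scalar field\<close>

text \<open>Over \<open>\<real>\<close> this is \<open>0\<close>, which lets both fields be treated by the same formulas.\<close>

definition imag_unit :: "'k::real_or_complex_field" where
  "imag_unit = (if \<forall>z::'k. \<exists>a. z = a *\<^sub>R 1 then 0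
     else SOME i. i * i = - 1 \<and> (\<forall>z. \<exists>a b. z = a *\<^sub>R 1 + b *\<^sub>R i))"

text \<open>Over the reals the second coefficient is arbitrary, because \<open>imag_unit\<close> is
  0; uniqueness of the first one is the content of \<open>re_part_eq\<close>.\<close>

definition re_part :: "'k::real_or_complex_field \<Rightarrow> real" where
  "re_part z = (SOME a. \<exists>b. z = a *\<^sub>R 1 + b *\<^sub>R imag_unit)"

lemma imag_unit_cases: "imag_unit = (0::'k::real_or_complex_field) \<or> imag_unit * imag_unit = (- 1 :: 'k)"
  and scalar_representation: "\<exists>a b. (z::'k) = a *\<^sub>R 1 + b *\<^sub>R imag_unit"
proof -
  have "(imag_unit = (0::'k) \<or> imag_unit * imag_unit = (- 1 :: 'k)) \<and>
    (\<forall>z::'k. \<exists>a b. z = a *\<^sub>R 1 + b *\<^sub>R imag_unit)"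
  proof (cases "\<forall>z::'k. \<exists>a. z = a *\<^sub>R 1")
    case True
    then have "imag_unit = (0::'k)"
      by (simp add: imag_unit_def)
    then show ?thesis
      using True by simp
  next
    case False
    then have "\<exists>i::'k. i * i = - 1 \<and> (\<forall>z. \<exists>a b. z = a *\<^sub>R 1 + b *\<^sub>R i)"
      using real_or_complex by blast
    from someI_ex[OF this] have "imag_unit * imag_unit = (- 1 :: 'k) \<and>
        (\<forall>z::'k. \<exists>a b. z = a *\<^sub>R 1 + b *\<^sub>R imag_unit)"
      unfolding imag_unit_def if_not_P[OF False] .
    then show ?thesis by blast
  qed
  then show "imag_unit = (0::'k) \<or> imag_unit * imag_unit = (- 1 :: 'k)"
    and "\<exists>a b. z = a *\<^sub>R 1 + b *\<^sub>R imag_unit"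
    by blast+
qed

lemma norm_imag_unit_le: "norm (imag_unit :: 'k::real_or_complex_field) \<le> 1"
proof (cases "imag_unit = (0::'k)")
  case False
  then have "imag_unit * imag_unit = (- 1 :: 'k)"
    using imag_unit_cases by blast
  then have "norm (imag_unit::'k) * norm (imag_unit::'k) = 1"
    by (metis norm_minus_cancel norm_mult norm_one)
  then show ?thesis
    by (metis abs_norm_cancel abs_square_le_1 order_refl power2_eq_square)
qed simp

text \<open>The product of \<open>z\<close> with its conjugate \<open>z'\<close> is
  \<open>a * a + b * b\<close>. Instead of comparing the two norms, \<open>norm z'\<close> is
  bounded by \<open>\<bar>a\<bar> + \<bar>b\<bar>\<close>; the square of this sum is at most
  \<open>2 * (a * a + b * b)\<close>, which yields the factor 2.\<close>

lemma re_part_aux: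
  fixes a b :: real
  defines "z \<equiv> a *\<^sub>R 1 + b *\<^sub>R (imag_unit :: 'k::real_or_complex_field)"
  shows "\<bar>a\<bar> \<le> 2 * norm z"
proof (cases "imag_unit = (0::'k)")
  case True
  then show ?thesis by (simp add: z_def)
next
  case False
  then have i: "imag_unit * imag_unit = (- 1 :: 'k)"
    using imag_unit_cases by blast
  define z' where "z' = a *\<^sub>R 1 - b *\<^sub>R (imag_unit :: 'k)"
  have "z * z' = (a * a) *\<^sub>R 1 - (b * b) *\<^sub>R (imag_unit * imag_unit)"
    by (simp add: z_def z'_def algebra_simps)
  also have "\<dots> = (a * a + b * b) *\<^sub>R 1"
    by (simp add: i scaleR_add_left)
  finally have "norm z * norm z' = \<bar>a * a + b * b\<bar>"
    by (metis mult.right_neutral norm_mult norm_one norm_scaleR)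
  then have eq: "norm z * norm z' = a * a + b * b"
    by simp
  have "norm z' \<le> \<bar>a\<bar> * 1 + \<bar>b\<bar> * norm (imag_unit :: 'k)"
    unfolding z'_def by (metis norm_one norm_scaleR norm_triangle_ineq4)
  also have "\<dots> \<le> \<bar>a\<bar> + \<bar>b\<bar>"
    using norm_imag_unit_le[where 'k='k] by (simp add: mult_left_le)
  finally have z': "norm z' \<le> \<bar>a\<bar> + \<bar>b\<bar>" .
  have "(\<bar>a\<bar> + \<bar>b\<bar>) * (\<bar>a\<bar> + \<bar>b\<bar>) \<le> 2 * (a * a + b * b)"
    using zero_le_square[of "\<bar>a\<bar> - \<bar>b\<bar>"] by (simp add: algebra_simps)
  also have "\<dots> \<le> 2 * norm z * (\<bar>a\<bar> + \<bar>b\<bar>)"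
    using mult_left_mono[OF z' norm_ge_zero[of z]] eq by simp
  finally have *: "(\<bar>a\<bar> + \<bar>b\<bar>) * (\<bar>a\<bar> + \<bar>b\<bar>) \<le> 2 * norm z * (\<bar>a\<bar> + \<bar>b\<bar>)" .
  show ?thesis
  proof (cases "\<bar>a\<bar> + \<bar>b\<bar> = 0")
    case True
    then have "a = 0" by linarith
    then show ?thesis by simp
  next
    case False
    then have "\<bar>a\<bar> + \<bar>b\<bar> \<le> 2 * norm z"
      using * mult_right_le_imp_le[of "\<bar>a\<bar> + \<bar>b\<bar>" "\<bar>a\<bar> + \<bar>b\<bar>" "2 * norm z"] by linarith
    then show ?thesis by linarith
  qed
qed

lemma re_part_eq: "re_part (a *\<^sub>R 1 + b *\<^sub>R imag_unit :: 'k::real_or_complex_field) = a"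
proof -
  let ?z = "a *\<^sub>R 1 + b *\<^sub>R imag_unit :: 'k"
  have "\<exists>b'. ?z = re_part ?z *\<^sub>R 1 + b' *\<^sub>R imag_unit"
    unfolding re_part_def by (rule someI) blast
  then obtain b' where "?z = re_part ?z *\<^sub>R 1 + b' *\<^sub>R imag_unit" ..
  then have "(a - re_part ?z) *\<^sub>R 1 + (b - b') *\<^sub>R imag_unit = (0::'k)"
    by (simp add: scaleR_diff_left algebra_simps)
  then have "\<bar>a - re_part ?z\<bar> \<le> 0"
    using re_part_aux[of "a - re_part ?z" "b - b'", where 'k='k] by simp
  then show ?thesis by simp
qed

lemma re_part_add: "re_part (x + y) = re_part x + re_part y"
proof -
  obtain a b c d where "x = a *\<^sub>R 1 + b *\<^sub>R imag_unit" "y = c *\<^sub>R 1 + d *\<^sub>R imag_unit"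
    using scalar_representation by metis
  moreover from this have "x + y = (a + c) *\<^sub>R 1 + (b + d) *\<^sub>R imag_unit"
    by (simp add: scaleR_add_left)
  ultimately show ?thesis
    using re_part_eq by metis
qed

lemma re_part_scaleR: "re_part (t *\<^sub>R x) = t * re_part x"
proof -
  obtain a b where "x = a *\<^sub>R 1 + b *\<^sub>R imag_unit"
    using scalar_representation by metis
  moreover from this have "t *\<^sub>R x = (t * a) *\<^sub>R 1 + (t * b) *\<^sub>R imag_unit"
    by (simp add: scaleR_add_right)
  ultimately show ?thesis
    using re_part_eq by metis
qed

lemma re_part_of_real_mult: "re_part (of_real t * x) = t * re_part x"
  by (metis re_part_scaleR scaleR_conv_of_real)

lemma re_part_zero [simp]: "re_part 0 = 0"
  using re_part_scaleR[of 0 0] by simp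

lemma re_part_one [simp]: "re_part 1 = 1"
  using re_part_eq[of 1 0] by simp

lemma re_part_sum: "re_part (sum f A) = (\<Sum>x\<in>A. re_part (f x))"
  by (induction A rule: infinite_finite_induct) (simp_all add: re_part_add)

lemma re_part_minus: "re_part (- x) = - re_part x"
  using re_part_scaleR[of "-1" x] by simp

lemma abs_re_part_le: "\<bar>re_part z\<bar> \<le> 2 * norm z"
proof -
  obtain a b where "z = a *\<^sub>R 1 + b *\<^sub>R imag_unit"
    using scalar_representation by metis
  then show ?thesis
    using re_part_aux re_part_eq by metis
qed

text \<open>Multiplication by \<open>imag_unit\<close> moves minus the imaginary part into the real
  position, so a scalar, and hence a functional, is recovered from real parts alone. Over the reals
  the second term vanishes.\<close>

lemma scalar_decomposition:
  "z = of_real (re_part z) - imag_unit * of_real (re_part (imag_unit * z))"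
proof -
  obtain a b where z: "z = a *\<^sub>R 1 + b *\<^sub>R imag_unit"
    using scalar_representation by metis
  have re: "re_part z = a"
    using re_part_eq z by metis
  consider "imag_unit = (0::'a)" | "imag_unit * imag_unit = (- 1 :: 'a)"
    using imag_unit_cases by blast
  then show ?thesis
  proof cases
    case 1
    then show ?thesis using z re by (simp add: scaleR_conv_of_real)
  next
    case 2
    have "imag_unit * z = (- b) *\<^sub>R 1 + a *\<^sub>R imag_unit"
      using 2 by (simp add: z distrib_left)
    then have "re_part (imag_unit * z) = - b"
      using re_part_eq by metis
    then show ?thesis
      using z re by (simp add: scaleR_conv_of_real mult.commute)
  qed
qed

lemma norm_le_re_parts: "norm z \<le> \<bar>re_part z\<bar> + \<bar>re_part (imag_unit * z)\<bar>"
proof -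
  have "norm z \<le> norm (of_real (re_part z) :: 'a) + norm (imag_unit * of_real (re_part (imag_unit * z)) :: 'a)"
    by (subst scalar_decomposition[of z]) (rule norm_triangle_ineq4)
  also have "\<dots> \<le> \<bar>re_part z\<bar> + \<bar>re_part (imag_unit * z)\<bar>"
    using norm_imag_unit_le[where 'k='a] by (simp add: norm_mult mult_left_le_one_le)
  finally show ?thesis .
qed

lemma tendsto_re_part:
  assumes "(f \<longlongrightarrow> l) F"
  shows "((\<lambda>x. re_part (f x)) \<longlongrightarrow> re_part l) F"
proof -
  have "((\<lambda>x. re_part (f x) - re_part l) \<longlongrightarrow> 0) F"
  proof (rule Lim_null_comparison)
    show "\<forall>\<^sub>F x in F. norm (re_part (f x) - re_part l) \<le> 2 * norm (f x - l)"
      using abs_re_part_le[of "f x - l" for x] re_part_add[of "f x - l" l for x]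
      by (auto intro!: always_eventually simp: algebra_simps)
    show "((\<lambda>x. 2 * norm (f x - l)) \<longlongrightarrow> 0) F"
      using assms by (auto intro!: tendsto_eq_intros)
  qed
  then show ?thesis
    by (simp add: LIM_zero_iff)
qed

lemma continuous_on_re_part: "continuous_on S re_part"
  by (simp add: continuous_on_def tendsto_re_part)

text \<open>For one of the factors 1 and \<open>imag_unit\<close> the real parts carry at least half
  of the sum, and \<open>P\<close> flips exactly the terms where they are negative, so that nothing
  cancels. The constant is 2 for this choice times 2 from \<open>abs_re_part_le\<close>.\<close>

lemma exists_signs:
  fixes c :: "nat \<Rightarrow> 'k::real_or_complex_field"
  shows "\<exists>P. (\<Sum>i<n. norm (c i)) \<le> 4 * norm (\<Sum>i<n. if i \<in> P then c i else - c i)"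
proof -
  have aux: "\<exists>P. (\<Sum>i<n. \<bar>re_part (d * c i)\<bar>) \<le> 2 * norm (\<Sum>i<n. if i \<in> P then c i else - c i)"
    if d: "norm d \<le> 1" for d :: 'k
  proof
    let ?P = "{i. 0 \<le> re_part (d * c i)}"
    let ?s = "\<Sum>i<n. if i \<in> ?P then c i else - c i"
    have "re_part (d * ?s) = (\<Sum>i<n. re_part (d * (if i \<in> ?P then c i else - c i)))"
      by (simp only: sum_distrib_left re_part_sum)
    also have "\<dots> = (\<Sum>i<n. \<bar>re_part (d * c i)\<bar>)"
      by (intro sum.cong) (auto simp: re_part_minus)
    finally have "(\<Sum>i<n. \<bar>re_part (d * c i)\<bar>) \<le> 2 * norm (d * ?s)"
      using abs_re_part_le[of "d * ?s"] by linarith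
    also have "\<dots> \<le> 2 * norm ?s"
      using d by (simp add: norm_mult mult_left_le_one_le)
    finally show "(\<Sum>i<n. \<bar>re_part (d * c i)\<bar>) \<le> 2 * norm ?s" .
  qed
  have "(\<Sum>i<n. norm (c i)) \<le> (\<Sum>i<n. \<bar>re_part (1 * c i)\<bar> + \<bar>re_part (imag_unit * c i)\<bar>)"
    by (intro sum_mono) (use norm_le_re_parts in simp)
  also have "\<dots> = (\<Sum>i<n. \<bar>re_part (1 * c i)\<bar>) + (\<Sum>i<n. \<bar>re_part (imag_unit * c i)\<bar>)"
    by (rule sum.distrib)
  finally consider "(\<Sum>i<n. norm (c i)) \<le> 2 * (\<Sum>i<n. \<bar>re_part (1 * c i)\<bar>)"
    | "(\<Sum>i<n. norm (c i)) \<le> 2 * (\<Sum>i<n. \<bar>re_part (imag_unit * c i)\<bar>)"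
    by linarith
  then show ?thesis
  proof cases
    case 1
    obtain P where "(\<Sum>i<n. \<bar>re_part (1 * c i)\<bar>) \<le> 2 * norm (\<Sum>i<n. if i \<in> P then c i else - c i)"
      using aux[of 1] by auto
    then show ?thesis
      using 1 by (intro exI[of _ P]) linarith
  next
    case 2
    obtain P where "(\<Sum>i<n. \<bar>re_part (imag_unit * c i)\<bar>) \<le> 2 * norm (\<Sum>i<n. if i \<in> P then c i else - c i)"
      using aux[OF norm_imag_unit_le] by auto
    then show ?thesis
      using 2 by (intro exI[of _ P]) linarith
  qed
qed

lemma countable_dense_scalars:
  obtains Q :: "'k::real_or_complex_field set" where "countable Q" "0 \<in> Q"
    "\<And>z e. 0 < e \<Longrightarrow> \<exists>q\<in>Q. norm (z - q) < e"
proof -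
  define Q where "Q = (\<lambda>(a, b). a *\<^sub>R 1 + b *\<^sub>R (imag_unit::'k)) ` (\<rat> \<times> \<rat>)"
  have "countable Q"
    unfolding Q_def using countable_rat by (intro countable_image countable_SIGMA)
  moreover have "0 \<in> Q"
    unfolding Q_def by (intro image_eqI[of _ _ "(0, 0)"]) auto
  moreover have "\<exists>q\<in>Q. norm (z - q) < e" if e: "0 < e" for z e
  proof -
    obtain a b where z: "z = a *\<^sub>R 1 + b *\<^sub>R imag_unit"
      using scalar_representation by metis
    obtain a' where a': "a' \<in> \<rat>" "a < a'" "a' < a + e / 2"
      using Rats_dense_in_real[of a "a + e / 2"] e by auto
    obtain b' where b': "b' \<in> \<rat>" "b < b'" "b' < b + e / 2"
      using Rats_dense_in_real[of b "b + e / 2"] e by auto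
    let ?q = "a' *\<^sub>R 1 + b' *\<^sub>R imag_unit"
    have "z - ?q = (a - a') *\<^sub>R 1 + (b - b') *\<^sub>R imag_unit"
      by (simp add: z scaleR_diff_left)
    then have "norm (z - ?q) \<le> \<bar>a - a'\<bar> * 1 + \<bar>b - b'\<bar> * norm (imag_unit :: 'k)"
      by (metis norm_one norm_scaleR norm_triangle_ineq)
    also have "\<dots> \<le> \<bar>a - a'\<bar> + \<bar>b - b'\<bar>"
      using norm_imag_unit_le[where 'k='k] by (simp add: mult_left_le)
    also have "\<dots> < e"
      using a' b' by linarith
    finally show ?thesis
      using a' b' unfolding Q_def by force
  qed
  ultimately show thesis
    using that by blast
qed

lemma bounded_scalar_sequence:
  fixes z :: "nat \<Rightarrow> 'k::real_or_complex_field"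
  assumes "\<And>n. norm (z n) \<le> C"
  obtains r l where "strict_mono (r :: nat \<Rightarrow> nat)" "(z \<circ> r) \<longlonglongrightarrow> l"
proof -
  have bnd: "bounded (range (\<lambda>n. re_part (d * z (r n))))" if "norm d \<le> 1" for d and r :: "nat \<Rightarrow> nat"
  proof (rule boundedI)
    fix x assume "x \<in> range (\<lambda>n. re_part (d * z (r n)))"
    then obtain n where "x = re_part (d * z (r n))" by blast
    then have "norm x \<le> 2 * norm (d * z (r n))"
      using abs_re_part_le by auto
    also have "\<dots> \<le> 2 * norm (z (r n))"
      using that by (simp add: norm_mult mult_left_le_one_le)
    finally show "norm x \<le> 2 * C"
      using assms[of "r n"] by linarith
  qed
  obtain a r where r: "strict_mono (r :: nat \<Rightarrow> nat)" "((\<lambda>n. re_part (1 * z n)) \<circ> r) \<longlonglongrightarrow> a"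
    using bounded_imp_convergent_subsequence[OF bnd[of 1 "\<lambda>n. n"]] by auto
  obtain b s where s: "strict_mono (s :: nat \<Rightarrow> nat)" "((\<lambda>n. re_part (imag_unit * z (r n))) \<circ> s) \<longlonglongrightarrow> b"
    using bounded_imp_convergent_subsequence[OF bnd[OF norm_imag_unit_le, of r]] by auto
  have "(\<lambda>n. of_real (re_part (z (r (s n)))) - imag_unit * of_real (re_part (imag_unit * z (r (s n))))) \<longlonglongrightarrow>
      of_real a - imag_unit * (of_real b :: 'k)"
    using LIMSEQ_subseq_LIMSEQ[OF r(2) s(1)] s(2)
    by (intro tendsto_diff tendsto_mult tendsto_const tendsto_of_real) (simp_all add: o_def)
  then have "(z \<circ> (r \<circ> s)) \<longlonglongrightarrow> of_real a - imag_unit * of_real b"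
    using scalar_decomposition[symmetric, where 'a='k] by (simp add: o_def)
  then show thesis
    using that[of "r \<circ> s"] r(1) s(1) strict_mono_o by blast
qed

section \<open>Continuous seminorms\<close>

lemma continuous_map_metricI:
  fixes f :: "'a \<Rightarrow> 'b::metric_space"
  assumes "\<And>x e. x \<in> topspace X \<Longrightarrow> 0 < e \<Longrightarrow> \<exists>U. openin X U \<and> x \<in> U \<and> (\<forall>y\<in>U. dist (f y) (f x) < e)"
  shows "continuous_map X euclidean f"
  unfolding continuous_map_def
proof (intro conjI allI impI)
  fix W :: "'b set" assume "openin euclidean W"
  then have W: "open W" by simp
  show "openin X {x \<in> topspace X. f x \<in> W}"
  proof (subst openin_subopen, intro ballI)
    fix x assume x: "x \<in> {x \<in> topspace X. f x \<in> W}"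
    then obtain e where e: "0 < e" "\<And>z. dist z (f x) < e \<Longrightarrow> z \<in> W"
      using W by (auto simp: open_dist)
    then obtain U where U: "openin X U" "x \<in> U" "\<forall>y\<in>U. dist (f y) (f x) < e"
      using assms[of x e] x by blast
    then have "U \<subseteq> {x \<in> topspace X. f x \<in> W}"
      using e(2) openin_subset by blast
    then show "\<exists>T. openin X T \<and> x \<in> T \<and> T \<subseteq> {x \<in> topspace X. f x \<in> W}"
      using U by blast
  qed
qed simp

context locally_convex_space
begin

definition rscale :: "real \<Rightarrow> 'a \<Rightarrow> 'a" where
  "rscale t x = smul (of_real t) x"

lemma vector_space_rscale: "vector_space rscale"
  by unfold_locales (simp_all add: rscale_def scale_right_distrib scale_left_distrib)

text \<open>Continuity is included because only continuous seminorms describe \<open>E\<close>: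
  their open unit balls form a base at 0, and topological statements become numerical
  estimates.\<close>

definition seminorm :: "('a \<Rightarrow> real) \<Rightarrow> bool" where
  "seminorm p \<longleftrightarrow> (\<forall>x y. p (x + y) \<le> p x + p y) \<and> (\<forall>c x. p (smul c x) = norm c * p x) \<and>
     continuous_map E euclideanreal p"

lemma seminorm_triangle: "seminorm p \<Longrightarrow> p (x + y) \<le> p x + p y"
  and seminorm_scale: "seminorm p \<Longrightarrow> p (smul c x) = norm c * p x"
  and seminorm_continuous: "seminorm p \<Longrightarrow> continuous_map E euclideanreal p"
  by (simp_all add: seminorm_def)

lemma seminorm_zero: "seminorm p \<Longrightarrow> p 0 = 0"
  using seminorm_scale[of p 0 0] by simp

lemma seminorm_minus: "seminorm p \<Longrightarrow> p (- x) = p x"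
  using seminorm_scale[of p "-1" x] by simp

lemma seminorm_minus_commute: "seminorm p \<Longrightarrow> p (x - y) = p (y - x)"
  using seminorm_minus[of p "x - y"] by simp

lemma seminorm_nonneg:
  assumes "seminorm p" shows "0 \<le> p x"
proof -
  have "p (x + - x) \<le> p x + p (- x)"
    by (rule seminorm_triangle[OF assms])
  then show ?thesis
    using seminorm_zero[OF assms] seminorm_minus[OF assms, of x] by simp
qed

lemma seminorm_diff_triangle:
  assumes "seminorm p" shows "p (x - z) \<le> p (x - y) + p (y - z)"
  using seminorm_triangle[OF assms, of "x - y" "y - z"] by simp

lemma seminorm_reverse_triangle:
  assumes "seminorm p" shows "\<bar>p x - p y\<bar> \<le> p (x - y)"
  using seminorm_triangle[OF assms, of "x - y" y] seminorm_triangle[OF assms, of "y - x" x]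
    seminorm_minus_commute[OF assms, of x y] by simp

lemma seminorm_sum:
  assumes "seminorm p" shows "p (sum f A) \<le> (\<Sum>x\<in>A. p (f x))"
proof (induction A rule: infinite_finite_induct)
  case (insert x A)
  then show ?case
    using seminorm_triangle[OF assms, of "f x" "sum f A"] by simp
qed (simp_all add: seminorm_zero[OF assms])

lemma seminorm_add:
  assumes "seminorm p" "seminorm q" shows "seminorm (\<lambda>x. p x + q x)"
  unfolding seminorm_def
proof (intro conjI allI)
  show "p (x + y) + q (x + y) \<le> p x + q x + (p y + q y)" for x y
    using seminorm_triangle[OF assms(1), of x y] seminorm_triangle[OF assms(2), of x y] by linarith
  show "p (smul c x) + q (smul c x) = norm c * (p x + q x)" for c x
    by (simp add: assms seminorm_scale distrib_left)
  show "continuous_map E euclideanreal (\<lambda>x. p x + q x)"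
    by (intro continuous_map_add seminorm_continuous assms)
qed

lemma seminorm_cmult:
  assumes "seminorm p" "0 \<le> r" shows "seminorm (\<lambda>x. r * p x)"
  unfolding seminorm_def
proof (intro conjI allI)
  show "r * p (x + y) \<le> r * p x + r * p y" for x y
    using mult_left_mono[OF seminorm_triangle[OF assms(1), of x y] assms(2)] by (simp add: distrib_left)
  show "r * p (smul c x) = norm c * (r * p x)" for c x
    by (simp add: assms seminorm_scale)
  show "continuous_map E euclideanreal (\<lambda>x. r * p x)"
    by (intro continuous_map_real_mult_left seminorm_continuous assms)
qed

lemma sublinear_seminorm: "seminorm p \<Longrightarrow> sublinear rscale p"
  by (simp add: sublinear_def rscale_def seminorm_triangle seminorm_scale)

section \<open>Neighbourhoods of 0 and the seminorms whose balls they contain\<close>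

lemma continuous_map_translation: "continuous_map E E (\<lambda>x. x + a)"
proof -
  have "continuous_map E (prod_topology E E) (\<lambda>x. (x, a))"
    by (simp add: continuous_map_paired topspace_UNIV)
  from continuous_map_compose[OF this continuous_add] show ?thesis
    by (simp add: o_def)
qed

lemma continuous_map_dilation: "continuous_map E E (smul c)"
proof -
  have "continuous_map E (prod_topology euclidean E) (\<lambda>x. (c, x))"
    by (simp add: continuous_map_paired)
  from continuous_map_compose[OF this continuous_scale] show ?thesis
    by (simp add: o_def)
qed

lemma openin_translation:
  assumes "openin E U" shows "openin E {x. x - a \<in> U}"
  using openin_continuous_map_preimage[OF continuous_map_translation[of "- a"] assms]
  by (simp add: topspace_UNIV)

lemma openin_dilation:
  assumes "openin E U" shows "openin E {x. smul c x \<in> U}"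
  using openin_continuous_map_preimage[OF continuous_map_dilation assms]
  by (simp add: topspace_UNIV)

lemma neighbourhood_absorbing:
  assumes "openin E U" "0 \<in> U"
  obtains d where "0 < d" "\<And>c. norm c < d \<Longrightarrow> smul c x \<in> U"
proof -
  have "continuous_map euclidean (prod_topology euclidean E) (\<lambda>c. (c, x))"
    by (simp add: continuous_map_paired topspace_UNIV)
  from continuous_map_compose[OF this continuous_scale]
  have "continuous_map euclidean E (\<lambda>c. smul c x)"
    by (simp add: o_def)
  from openin_continuous_map_preimage[OF this assms(1)]
  have "open {c. smul c x \<in> U}" by simp
  moreover have "0 \<in> {c. smul c x \<in> U}"
    using assms(2) by simp
  ultimately obtain d where "0 < d" "ball 0 d \<subseteq> {c. smul c x \<in> U}"
    by (meson open_contains_ball)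
  then show thesis
    using that[of d] by (auto simp: subset_iff)
qed

lemma neighbourhood_jointly_absorbing:
  assumes "openin E U" "0 \<in> U"
  obtains d N where "0 < d" "openin E N" "0 \<in> N" "\<And>c x. norm c < d \<Longrightarrow> x \<in> N \<Longrightarrow> smul c x \<in> U"
proof -
  have "openin (prod_topology euclidean E) {z. (\<lambda>(c, x). smul c x) z \<in> U}"
    using openin_continuous_map_preimage[OF continuous_scale assms(1)] by (simp add: topspace_UNIV)
  moreover have "(0, 0) \<in> {z. (\<lambda>(c, x). smul c x) z \<in> U}"
    using assms(2) by simp
  ultimately have "\<exists>V N. openin euclidean V \<and> openin E N \<and> 0 \<in> V \<and> 0 \<in> N \<and>
      V \<times> N \<subseteq> {z. (\<lambda>(c, x). smul c x) z \<in> U}"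
    by (simp only: openin_prod_topology_alt)
  then obtain V N where VN: "open V" "openin E N" "0 \<in> V" "0 \<in> N"
    "V \<times> N \<subseteq> {z. (\<lambda>(c, x). smul c x) z \<in> U}"
    by auto
  obtain d where "0 < d" "ball 0 d \<subseteq> V"
    using VN(1,3) by (meson open_contains_ball)
  then show thesis
    using that[of d N] VN by (auto simp: subset_iff)
qed

text \<open>The seminorm is the Minkowski functional of the balanced core \<open>B\<close> of a convex neighbourhood.\<close>

lemma openin_contains_seminorm_ball:
  assumes U: "openin E U" "0 \<in> U"
  obtains p where "seminorm p" "{x. p x < 1} \<subseteq> U"
proof -
  obtain U' V where V: "openin E U'" "scale_convex smul V" "0 \<in> U'" "U' \<subseteq> V" "V \<subseteq> U"
    using convex_base U unfolding neighbourhood_base_at_def by meson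
  define B where "B = {x. \<forall>c. norm c \<le> 1 \<longrightarrow> smul c x \<in> V}"
  obtain d N' where N': "0 < d" "openin E N'" "0 \<in> N'" "\<And>c x. norm c < d \<Longrightarrow> x \<in> N' \<Longrightarrow> smul c x \<in> U'"
    using neighbourhood_jointly_absorbing[OF V(1,3)] by blast
  \<comment> \<open>If \<open>norm c \<le> 1\<close>, then \<open>c * (d / 2)\<close> has norm below
    \<open>d\<close>. Rescaling \<open>N'\<close> by the inverse of \<open>d / 2\<close> therefore
    gives an open neighbourhood of 0 inside the balanced core.\<close>
  define N where "N = {x. smul (of_real (2 / d)) x \<in> N'}"
  have N: "openin E N" "0 \<in> N"
    using openin_dilation[OF N'(2)] N'(3) by (simp_all add: N_def)
  have NB: "x \<in> B" if "x \<in> N" for x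
    unfolding B_def
  proof (intro CollectI allI impI)
    fix c :: 'k assume c: "norm c \<le> 1"
    have "norm (c * of_real (d / 2)) < d"
      using c N'(1) mult_right_mono[OF c, of "d / 2"] by (simp add: norm_mult)
    then have "smul (c * of_real (d / 2)) (smul (of_real (2 / d)) x) \<in> U'"
      using N'(4) that unfolding N_def by blast
    moreover have "c * of_real (d / 2) * of_real (2 / d) = c"
      using N'(1) by (simp add: field_simps)
    ultimately show "smul c x \<in> V"
      using V(4) by auto
  qed
  have balanced: "smul c x \<in> B" if "x \<in> B" "norm c \<le> 1" for c x
    using that by (auto simp: B_def norm_mult mult_le_one)
  have BV: "x \<in> V" if "x \<in> B" for x
  proof -
    have "smul 1 x \<in> V"
      using that unfolding B_def by (metis (mono_tags, lifting) mem_Collect_eq norm_one order_refl)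
    then show ?thesis by simp
  qed
  have convex: "smul (of_real u) x + smul (of_real v) y \<in> B"
    if "x \<in> B" "y \<in> B" "0 \<le> u" "0 \<le> v" "u + v = 1" for x y u v
    unfolding B_def
  proof (intro CollectI allI impI)
    fix c :: 'k assume "norm c \<le> 1"
    then have "smul c x \<in> V" "smul c y \<in> V"
      using that by (auto simp: B_def)
    then have "smul (of_real u) (smul c x) + smul (of_real v) (smul c y) \<in> V"
      using V(2) that(3-5) unfolding scale_convex_def by blast
    then show "smul c (smul (of_real u) x + smul (of_real v) y) \<in> V"
      by (simp add: scale_right_distrib mult.commute)
  qed
  define S where "S = (\<lambda>x. {t. 0 < t \<and> smul (of_real (inverse t)) x \<in> B})"
  define p where "p = (\<lambda>x. Inf (S x))"
  have Sne: "S x \<noteq> {}" for x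
  proof -
    obtain e where e: "0 < e" "\<And>c. norm c < e \<Longrightarrow> smul c x \<in> N"
      using neighbourhood_absorbing[OF N] by blast
    have "smul (of_real (e / 2)) x \<in> N"
      by (rule e(2)) (use e(1) in simp)
    then have "2 / e \<in> S x"
      using e(1) NB by (simp add: S_def)
    then show ?thesis by blast
  qed
  have bdd: "bdd_below (S x)" for x
    by (rule bdd_belowI[of _ 0]) (simp add: S_def)
  have p_le: "p x \<le> t" if "t \<in> S x" for x t
    unfolding p_def by (rule cInf_lower[OF that bdd])
  have p_ge: "c \<le> p x" if "\<And>t. t \<in> S x \<Longrightarrow> c \<le> t" for c x
    unfolding p_def by (rule cInf_greatest[OF Sne that])
  have p0: "0 \<le> p x" for x
    by (rule p_ge) (simp add: S_def)
  have S_add: "s + t \<in> S (x + y)" if "s \<in> S x" "t \<in> S y" for s t x y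
  proof -
    have pos: "0 < s" "0 < t"
      using that by (auto simp: S_def)
    have "smul (of_real (s / (s + t))) (smul (of_real (inverse s)) x) +
        smul (of_real (t / (s + t))) (smul (of_real (inverse t)) y) \<in> B"
      by (rule convex) (use that pos in \<open>auto simp: S_def add_divide_distrib[symmetric]\<close>)
    moreover have "of_real (s / (s + t)) * of_real (inverse s) = (of_real (inverse (s + t)) :: 'k)"
      "of_real (t / (s + t)) * of_real (inverse t) = (of_real (inverse (s + t)) :: 'k)"
      using pos by (simp_all flip: of_real_mult add: field_simps)
    ultimately have "smul (of_real (inverse (s + t))) (x + y) \<in> B"
      by (simp only: scale_scale scale_right_distrib)
    then show ?thesis
      using pos by (simp add: S_def)
  qed
  have tri: "p (x + y) \<le> p x + p y" for x y
  proof -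
    have "p (x + y) - s \<le> p y" if "s \<in> S x" for s
      by (rule p_ge) (use p_le[OF S_add[OF that]] in fastforce)
    then have "p (x + y) - p y \<le> p x"
      by (intro p_ge) fastforce
    then show ?thesis by simp
  qed
  have S_scale: "norm c * t \<in> S (smul c x)" if "t \<in> S x" "c \<noteq> 0" for c t x
  proof -
    have pos: "0 < t" "0 < norm c"
      using that by (auto simp: S_def)
    have "smul (c * of_real (inverse (norm c))) (smul (of_real (inverse t)) x) \<in> B"
      by (rule balanced) (use that pos in \<open>auto simp: S_def norm_mult norm_inverse\<close>)
    moreover have "c * of_real (inverse (norm c)) * of_real (inverse t) = of_real (inverse (norm c * t)) * c"
      by (simp add: mult_ac)
    ultimately show ?thesis
      using pos by (simp add: S_def mult_ac)
  qed
  have scale_le: "p (smul c x) \<le> norm c * p x" if "c \<noteq> 0" for c x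
  proof -
    have "p (smul c x) / norm c \<le> p x"
    proof (rule p_ge)
      fix t assume "t \<in> S x"
      then have "p (smul c x) \<le> norm c * t"
        using S_scale that p_le by blast
      then show "p (smul c x) / norm c \<le> t"
        using that by (simp add: field_simps)
    qed
    then show ?thesis
      using that by (simp add: field_simps)
  qed
  have "p 0 \<le> e" if "0 < e" for e
    by (rule p_le) (use that NB N in \<open>auto simp: S_def\<close>)
  then have pz: "p 0 = 0"
    using p0[of 0] by (meson dense_ge antisym)
  have scale: "p (smul c x) = norm c * p x" for c x
  proof (cases "c = 0")
    case False
    have "p (smul (inverse c) (smul c x)) \<le> norm (inverse c) * p (smul c x)"
      by (rule scale_le) (use False in simp)
    then have "p x \<le> p (smul c x) / norm c"
      using False by (simp add: norm_inverse divide_inverse mult.commute)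
    then have "norm c * p x \<le> p (smul c x)"
      using False by (simp add: pos_le_divide_eq mult.commute)
    then show ?thesis
      using scale_le[OF False, of x] by simp
  qed (simp add: pz)
  have cont: "continuous_map E euclideanreal p"
  proof (rule continuous_map_metricI)
    fix x and e :: real assume e: "0 < e"
    define W where "W = {y. y - x \<in> {z. smul (of_real (2 / e)) z \<in> N}}"
    have "openin E W"
      unfolding W_def by (intro openin_translation openin_dilation N)
    moreover have "x \<in> W"
      using N(2) by (simp add: W_def)
    moreover have "dist (p y) (p x) < e" if "y \<in> W" for y
    proof -
      have "e / 2 \<in> S (y - x)"
        using that e NB by (simp add: W_def S_def)
      then have 1: "p (y - x) \<le> e / 2"
        by (rule p_le)
      have "p (x - y) = p (y - x)"
        using scale[of "-1" "y - x"] by simp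
      then show ?thesis
        using 1 e tri[of "y - x" x] tri[of "x - y" y] by (simp add: dist_real_def)
    qed
    ultimately show "\<exists>W. openin E W \<and> x \<in> W \<and> (\<forall>y\<in>W. dist (p y) (p x) < e)"
      by blast
  qed
  have "x \<in> U" if px: "p x < 1" for x
  proof -
    have "\<exists>t\<in>S x. t < 1"
      using px p_ge[of x 1] by (meson not_less)
    then obtain t where t: "t \<in> S x" "t < 1" ..
    have "smul (of_real t) (smul (of_real (inverse t)) x) \<in> B"
      by (rule balanced) (use t in \<open>auto simp: S_def\<close>)
    moreover have "of_real t * of_real (inverse t) = (1 :: 'k)"
      using t by (simp add: S_def flip: of_real_mult)
    ultimately have "x \<in> B" by simp
    then show ?thesis
      using BV V(5) by blast
  qed
  then show thesis
    using that[of p] tri scale cont by (auto simp: seminorm_def)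
qed

lemma openin_seminorm_ball:
  assumes "seminorm p" shows "openin E {y. p (y - x) < e}"
proof -
  have "openin E {y. p y < e}"
    using openin_continuous_map_preimage[OF seminorm_continuous[OF assms], of "{..<e}"]
    by (simp add: topspace_UNIV)
  from openin_translation[OF this] show ?thesis by simp
qed

lemma openin_iff_seminorm:
  "openin E U \<longleftrightarrow> (\<forall>x\<in>U. \<exists>p. seminorm p \<and> {y. p (y - x) < 1} \<subseteq> U)"
proof
  assume U: "openin E U"
  show "\<forall>x\<in>U. \<exists>p. seminorm p \<and> {y. p (y - x) < 1} \<subseteq> U"
  proof
    fix x assume "x \<in> U"
    then have "openin E {y. y - (- x) \<in> U}" "0 \<in> {y. y - (- x) \<in> U}"
      using openin_translation[OF U, of "- x"] \<open>x \<in> U\<close> by simp_all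
    then obtain p where p: "seminorm p" "{y. p y < 1} \<subseteq> {y. y - (- x) \<in> U}"
      by (rule openin_contains_seminorm_ball)
    have "y \<in> U" if "p (y - x) < 1" for y
      using p(2) that by (auto dest: subsetD[where c = "y - x"])
    then show "\<exists>p. seminorm p \<and> {y. p (y - x) < 1} \<subseteq> U"
      using p(1) by blast
  qed
next
  assume *: "\<forall>x\<in>U. \<exists>p. seminorm p \<and> {y. p (y - x) < 1} \<subseteq> U"
  show "openin E U"
  proof (subst openin_subopen, intro ballI)
    fix x assume "x \<in> U"
    then obtain p where "seminorm p" "{y. p (y - x) < 1} \<subseteq> U"
      using * by blast
    then show "\<exists>T. openin E T \<and> x \<in> T \<and> T \<subseteq> U"
      using openin_seminorm_ball[of p] seminorm_zero[of p] by (intro exI[of _ "{y. p (y - x) < 1}"]) simp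
  qed
qed

lemma separating_seminorm:
  assumes "x \<noteq> 0" obtains p where "seminorm p" "1 \<le> p x"
proof -
  obtain U V where UV: "openin E U" "openin E V" "0 \<in> U" "x \<in> V" "disjnt U V"
    using Hausdorff assms unfolding Hausdorff_space_def topspace_UNIV by (metis UNIV_I)
  obtain p where "seminorm p" "{y. p y < 1} \<subseteq> U"
    using openin_contains_seminorm_ball[OF UV(1,3)] by blast
  then show thesis
    using that[of p] UV(4,5) by (force simp: disjnt_iff)
qed

section \<open>Limits, boundedness and precompactness in terms of seminorms\<close>

lemma limitin_iff_seminorm:
  "limitin E f l F \<longleftrightarrow> (\<forall>p. seminorm p \<longrightarrow> ((\<lambda>x. p (f x - l)) \<longlongrightarrow> 0) F)"
proof
  assume lim: "limitin E f l F"
  show "\<forall>p. seminorm p \<longrightarrow> ((\<lambda>x. p (f x - l)) \<longlongrightarrow> 0) F"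
  proof (intro allI impI tendstoI)
    fix p and e :: real assume p: "seminorm p" and e: "0 < e"
    then have "openin E {y. p (y - l) < e} \<and> l \<in> {y. p (y - l) < e}"
      using openin_seminorm_ball[OF p] seminorm_zero[OF p] by simp
    then have "\<forall>\<^sub>F x in F. f x \<in> {y. p (y - l) < e}"
      using lim unfolding limitin_def by blast
    then show "\<forall>\<^sub>F x in F. dist (p (f x - l)) 0 < e"
      using seminorm_nonneg[OF p] by simp
  qed
next
  assume *: "\<forall>p. seminorm p \<longrightarrow> ((\<lambda>x. p (f x - l)) \<longlongrightarrow> 0) F"
  show "limitin E f l F"
    unfolding limitin_def
  proof (intro conjI allI impI)
    fix U assume "openin E U \<and> l \<in> U"
    then obtain p where p: "seminorm p" "{y. p (y - l) < 1} \<subseteq> U"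
      using openin_iff_seminorm by blast
    then have "\<forall>\<^sub>F x in F. p (f x - l) < 1"
      using * by (auto intro: order_tendstoD)
    then show "\<forall>\<^sub>F x in F. f x \<in> U"
      by (rule eventually_mono) (use p(2) in blast)
  qed (simp add: topspace_UNIV)
qed

lemma bounded_in_iff_seminorm:
  "bounded_in smul E B \<longleftrightarrow> (\<forall>p. seminorm p \<longrightarrow> (\<exists>M. \<forall>x\<in>B. p x \<le> M))"
proof
  assume B: "bounded_in smul E B"
  show "\<forall>p. seminorm p \<longrightarrow> (\<exists>M. \<forall>x\<in>B. p x \<le> M)"
  proof (intro allI impI)
    fix p assume p: "seminorm p"
    have "openin E {y. p y < 1}" "0 \<in> {y. p y < 1}"
      using openin_seminorm_ball[OF p, of 0 1] seminorm_zero[OF p] by simp_all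
    then obtain r where r: "\<And>c. r \<le> norm c \<Longrightarrow> B \<subseteq> smul c ` {y. p y < 1}"
      using B unfolding bounded_in_def by blast
    have "r \<le> norm (of_real (max r 1) :: 'k)" by simp
    then have sub: "B \<subseteq> smul (of_real (max r 1)) ` {y. p y < 1}"
      by (rule r)
    have "p x \<le> max r 1" if x: "x \<in> B" for x
    proof -
      obtain y where "p y < 1" "x = smul (of_real (max r 1)) y"
        using sub x by blast
      then show ?thesis
        by (simp add: seminorm_scale[OF p] mult_left_le)
    qed
    then show "\<exists>M. \<forall>x\<in>B. p x \<le> M" by blast
  qed
next
  assume *: "\<forall>p. seminorm p \<longrightarrow> (\<exists>M. \<forall>x\<in>B. p x \<le> M)"
  show "bounded_in smul E B"
    unfolding bounded_in_def
  proof (intro allI impI)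
    fix U assume "openin E U \<and> 0 \<in> U"
    then obtain p where p: "seminorm p" "{y. p y < 1} \<subseteq> U"
      using openin_contains_seminorm_ball by blast
    then obtain M where M: "\<And>x. x \<in> B \<Longrightarrow> p x \<le> M"
      using * by blast
    have "B \<subseteq> smul c ` U" if c: "\<bar>M\<bar> + 1 \<le> norm c" for c
    proof
      fix x assume x: "x \<in> B"
      have pos: "0 < norm c" using c by linarith
      have "p (smul (inverse c) x) = p x / norm c"
        by (simp add: seminorm_scale[OF p(1)] norm_inverse divide_inverse mult.commute)
      also have "\<dots> < 1"
        using M[OF x] c pos by (simp add: field_simps)
      finally have "smul (inverse c) x \<in> U"
        using p(2) by blast
      moreover have "x = smul c (smul (inverse c) x)"
        using pos by simp
      ultimately show "x \<in> smul c ` U" by blast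
    qed
    then show "\<exists>r. \<forall>c. r \<le> norm c \<longrightarrow> B \<subseteq> smul c ` U" by blast
  qed
qed

lemma precompact_in_iff_seminorm:
  "precompact_in E A \<longleftrightarrow>
    (\<forall>p e. seminorm p \<and> 0 < e \<longrightarrow> (\<exists>F. finite F \<and> A \<subseteq> (\<Union>x\<in>F. {y. p (y - x) < e})))"
proof
  assume A: "precompact_in E A"
  show "\<forall>p e. seminorm p \<and> 0 < e \<longrightarrow> (\<exists>F. finite F \<and> A \<subseteq> (\<Union>x\<in>F. {y. p (y - x) < e}))"
  proof (intro allI impI)
    fix p and e :: real assume p: "seminorm p \<and> 0 < e"
    then have "openin E {y. p y < e}" "0 \<in> {y. p y < e}"
      using openin_seminorm_ball[of p 0 e] seminorm_zero[of p] by simp_all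
    then obtain F where F: "finite F" "A \<subseteq> (\<Union>x\<in>F. (\<lambda>u. x + u) ` {y. p y < e})"
      using A unfolding precompact_in_def by blast
    have "(\<lambda>u. x + u) ` {y. p y < e} \<subseteq> {y. p (y - x) < e}" for x
      by auto
    then have "A \<subseteq> (\<Union>x\<in>F. {y. p (y - x) < e})"
      by (intro order_trans[OF F(2)] UN_mono) auto
    then show "\<exists>F. finite F \<and> A \<subseteq> (\<Union>x\<in>F. {y. p (y - x) < e})"
      using F(1) by blast
  qed
next
  assume *: "\<forall>p e. seminorm p \<and> 0 < e \<longrightarrow> (\<exists>F. finite F \<and> A \<subseteq> (\<Union>x\<in>F. {y. p (y - x) < e}))"
  show "precompact_in E A"
    unfolding precompact_in_def
  proof (intro allI impI)
    fix U assume "openin E U \<and> 0 \<in> U"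
    then obtain p where p: "seminorm p" "{y. p y < 1} \<subseteq> U"
      using openin_contains_seminorm_ball by blast
    obtain F where F: "finite F" "A \<subseteq> (\<Union>x\<in>F. {y. p (y - x) < 1})"
      using *[rule_format, of p 1] p(1) by auto
    have "{y. p (y - x) < 1} \<subseteq> (\<lambda>u. x + u) ` U" for x
    proof
      fix y assume "y \<in> {y. p (y - x) < 1}"
      then have "y - x \<in> U"
        using p(2) by blast
      then show "y \<in> (\<lambda>u. x + u) ` U"
        by (intro image_eqI[of _ _ "y - x"]) simp_all
    qed
    then have "A \<subseteq> (\<Union>x\<in>F. (\<lambda>u. x + u) ` U)"
      by (intro order_trans[OF F(2)] UN_mono) auto
    then show "\<exists>F. finite F \<and> A \<subseteq> (\<Union>x\<in>F. (\<lambda>u. x + u) ` U)"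
      using F(1) by blast
  qed
qed

text \<open>Greedy choice: the finitely many points picked so far never suffice as centres of a
  cover of \<open>A\<close>, so a further point keeps distance \<open>e\<close> from all of
  them.\<close>

lemma exists_separated_sequence:
  assumes "seminorm p" and "\<And>F. finite F \<Longrightarrow> \<not> A \<subseteq> (\<Union>x\<in>F. {y. p (y - x) < e})"
  obtains a :: "nat \<Rightarrow> 'a" where "range a \<subseteq> A" "\<And>m n. m < n \<Longrightarrow> e \<le> p (a n - a m)"
proof -
  have "\<exists>y. y \<in> A \<and> (\<forall>x\<in>F. e \<le> p (y - x))" if "finite F" for F
    using assms(2)[OF that] by (auto simp: not_less)
  then obtain g where g: "\<And>F. finite F \<Longrightarrow> g F \<in> A \<and> (\<forall>x\<in>F. e \<le> p (g F - x))"
    by metis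
  define s where "s = rec_nat {} (\<lambda>_ F. insert (g F) F)"
  have s: "s 0 = {}" "s (Suc n) = insert (g (s n)) (s n)" for n
    by (simp_all add: s_def)
  have fin: "finite (s n)" for n
    by (induction n) (simp_all add: s)
  have mono: "s m \<subseteq> s n" if "m \<le> n" for m n
    by (rule lift_Suc_mono_le[OF _ that]) (auto simp: s)
  show thesis
  proof (rule that[of "\<lambda>n. g (s n)"])
    show "range (\<lambda>n. g (s n)) \<subseteq> A"
      using g[OF fin] by blast
    show "e \<le> p (g (s n) - g (s m))" if "m < n" for m n
      using g[OF fin, of n] mono[of "Suc m" n] that by (simp add: s)
  qed
qed

end

section \<open>The dual and the weak topology\<close>

context locally_convex_space
begin

abbreviation dual :: "('a \<Rightarrow> 'k) set" where
  "dual \<equiv> continuous_dual smul E"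

abbreviation weak :: "'a topology" where
  "weak \<equiv> weak_topology smul E"

lemma dual_add: "f \<in> dual \<Longrightarrow> f (x + y) = f x + f y"
  and dual_scale: "f \<in> dual \<Longrightarrow> f (smul c x) = c * f x"
  by (simp_all add: continuous_dual_def Vector_Spaces.linear_iff)

lemma dual_zero: "f \<in> dual \<Longrightarrow> f 0 = 0"
  using dual_scale[of f 0 0] by simp

lemma dual_minus: "f \<in> dual \<Longrightarrow> f (- x) = - f x"
  using dual_scale[of f "-1" x] by simp

lemma dual_diff: "f \<in> dual \<Longrightarrow> f (x - y) = f x - f y"
  using dual_add[of f x "- y"] dual_minus[of f y] by simp

lemma dual_sum: "f \<in> dual \<Longrightarrow> f (sum g A) = (\<Sum>x\<in>A. f (g x))"
  by (induction A rule: infinite_finite_induct) (simp_all add: dual_zero dual_add)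

lemma dual_dominated:
  assumes "f \<in> dual"
  obtains p where "seminorm p" "\<And>x. norm (f x) \<le> p x"
proof -
  have "openin E {x. f x \<in> ball 0 1}"
    using assms openin_continuous_map_preimage[of E euclidean f "ball 0 1"]
    by (simp add: continuous_dual_def topspace_UNIV)
  then obtain p where p: "seminorm p" "{x. p x < 1} \<subseteq> {x. f x \<in> ball 0 1}"
    using openin_contains_seminorm_ball[of "{x. f x \<in> ball 0 1}"] dual_zero[OF assms] by auto
  have "norm (f x) \<le> t" if t: "p x < t" for x t
  proof -
    have pos: "0 < t"
      using t seminorm_nonneg[OF p(1), of x] by linarith
    have "p (smul (of_real (inverse t)) x) = p x / t"
      using pos by (simp add: seminorm_scale[OF p(1)] norm_inverse divide_inverse mult.commute)
    also have "\<dots> < 1"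
      using t pos by simp
    finally have "norm (f (smul (of_real (inverse t)) x)) < 1"
      using p(2) by auto
    moreover have "norm (f (smul (of_real (inverse t)) x)) = norm (f x) / t"
      using pos by (simp add: dual_scale[OF assms] norm_mult norm_inverse divide_inverse mult.commute)
    ultimately show ?thesis
      using pos by simp
  qed
  then have "norm (f x) \<le> p x" for x
    by (meson dense_ge)
  then show thesis
    using that p(1) by blast
qed

lemma dualI:
  assumes "\<And>x y. f (x + y) = f x + f y" "\<And>c x. f (smul c x) = c * f x"
    and p: "seminorm p" "\<And>x. norm (f x) \<le> p x"
  shows "f \<in> dual"
proof -
  have "Vector_Spaces.linear smul (*) f"
    using assms(1,2) vector_space_axioms vector_space_over_itself.vector_space_axioms
    by (simp add: Vector_Spaces.linear_iff)
  moreover have "continuous_map E euclidean f"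
  proof (rule continuous_map_metricI)
    fix x and e :: real assume e: "0 < e"
    have "dist (f y) (f x) < e" if "p (y - x) < e" for y
    proof -
      have "f y = f (y - x) + f x"
        using assms(1)[of "y - x" x] by simp
      then show ?thesis
        using that p(2)[of "y - x"] by (simp add: dist_norm)
    qed
    then show "\<exists>U. openin E U \<and> x \<in> U \<and> (\<forall>y\<in>U. dist (f y) (f x) < e)"
      using openin_seminorm_ball[OF p(1)] e
      by (intro exI[of _ "{y. p (y - x) < e}"]) (simp add: seminorm_zero[OF p(1)])
  qed
  ultimately show ?thesis
    by (simp add: continuous_dual_def)
qed

text \<open>The usual passage from a real functional to a scalar one, subtracting
  \<open>imag_unit\<close> times the value at \<open>smul imag_unit x\<close>. Over the reals the
  correction is 0, and homogeneity is checked separately for real scalars and for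
  \<open>imag_unit\<close>.\<close>

lemma dual_of_real_functional:
  assumes add: "\<And>x y. F (x + y) = F x + F y" and scale: "\<And>t x. F (rscale t x) = t * F x"
    and p: "seminorm p" "\<And>x. F x \<le> p x"
  obtains f where "f \<in> dual" "\<And>x. re_part (f x) = F x"
proof -
  define f where "f = (\<lambda>x. of_real (F x) - imag_unit * of_real (F (smul imag_unit x)) :: 'k)"
  have F_abs: "\<bar>F x\<bar> \<le> p x" for x
  proof -
    have "F (- x) = - F x"
      using scale[of "-1" x] by (simp add: rscale_def)
    then show ?thesis
      using p(2)[of x] p(2)[of "- x"] seminorm_minus[OF p(1), of x] by linarith
  qed
  have f_add: "f (x + y) = f x + f y" for x y
    by (simp add: f_def add scale_right_distrib algebra_simps)
  have f_real: "f (smul (of_real t) x) = of_real t * f x" for t x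
  proof -
    have "F (smul imag_unit (smul (of_real t) x)) = t * F (smul imag_unit x)"
      using scale[of t "smul imag_unit x"] by (simp add: rscale_def mult.commute)
    then show ?thesis
      using scale[of t x] by (simp add: f_def rscale_def algebra_simps)
  qed
  have f_imag: "f (smul imag_unit x) = imag_unit * f x" for x
  proof -
    have F0: "F 0 = 0"
      using scale[of 0 0] by (simp add: rscale_def)
    have Fm: "F (- x) = - F x"
      using scale[of "-1" x] by (simp add: rscale_def)
    consider "imag_unit = (0::'k)" | "imag_unit * imag_unit = (- 1 :: 'k)"
      using imag_unit_cases by blast
    then show ?thesis
    proof cases
      case 1
      then show ?thesis by (simp add: f_def F0)
    next
      case 2
      then have "imag_unit * (imag_unit * of_real t) = (- of_real t :: 'k)" for t
        by (simp flip: mult.assoc)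
      with 2 show ?thesis
        by (simp add: f_def Fm right_diff_distrib)
    qed
  qed
  have f_scale: "f (smul c x) = c * f x" for c x
  proof -
    define a b where "a = re_part c" and "b = - re_part (imag_unit * c)"
    have c: "c = of_real a + imag_unit * of_real b"
      using scalar_decomposition[of c] by (simp add: a_def b_def)
    have "smul c x = smul (of_real a) x + smul imag_unit (smul (of_real b) x)"
      by (simp add: c scale_left_distrib)
    then have "f (smul c x) = of_real a * f x + imag_unit * (of_real b * f x)"
      by (simp only: f_add f_imag f_real)
    then show ?thesis
      by (simp add: c distrib_right mult.assoc)
  qed
  have re: "re_part (f x) = F x" for x
  proof -
    have "f x = F x *\<^sub>R 1 + (- F (smul imag_unit x)) *\<^sub>R imag_unit"
      by (simp add: f_def scaleR_conv_of_real mult.commute)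
    then show ?thesis
      using re_part_eq by metis
  qed
  have f_norm: "norm (f x) \<le> 2 * p x" for x
  proof -
    have "re_part (imag_unit * f x) = F (smul imag_unit x)"
      using re[of "smul imag_unit x"] by (simp add: f_imag)
    moreover have "p (smul imag_unit x) \<le> p x"
      using norm_imag_unit_le[where 'k='k] seminorm_nonneg[OF p(1), of x]
      by (simp add: seminorm_scale[OF p(1)] mult_left_le_one_le)
    ultimately show ?thesis
      using norm_le_re_parts[of "f x"] F_abs[of x] F_abs[of "smul imag_unit x"] re[of x] by simp
  qed
  have "seminorm (\<lambda>x. 2 * p x)"
    by (rule seminorm_cmult[OF p(1)]) simp
  from dualI[OF f_add f_scale this f_norm] show thesis
    using re that by blast
qed

lemma dual_Mazur_Orlicz:
  assumes p: "seminorm p" and M: "functional_cone rscale M" "\<And>m r. (m, r) \<in> M \<Longrightarrow> r \<le> p m"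
  obtains f where "f \<in> dual" "\<And>x. \<bar>re_part (f x)\<bar> \<le> p x" "\<And>m r. (m, r) \<in> M \<Longrightarrow> r \<le> re_part (f m)"
proof -
  obtain F where F: "\<And>x y. F (x + y) = F x + F y" "\<And>t x. F (rscale t x) = t * F x"
    "\<And>x. F x \<le> p x" "\<And>m r. (m, r) \<in> M \<Longrightarrow> r \<le> F m"
    using Mazur_Orlicz[OF vector_space_rscale sublinear_seminorm[OF p] M] by blast
  obtain f where f: "f \<in> dual" "\<And>x. re_part (f x) = F x"
    using dual_of_real_functional[OF F(1,2) p F(3)] by blast
  have "\<bar>re_part (f x)\<bar> \<le> p x" for x
    using f(2)[of x] f(2)[of "- x"] F(3)[of x] F(3)[of "- x"] seminorm_minus[OF p, of x]
    by (simp add: dual_minus[OF f(1)] re_part_minus)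
  then show thesis
    using that[of f] f F(4) by simp
qed

lemma norm_dual_le:
  assumes f: "f \<in> dual" and p: "seminorm p" "\<And>x. \<bar>re_part (f x)\<bar> \<le> p x"
  shows "norm (f x) \<le> 2 * p x"
proof -
  have "p (smul imag_unit x) \<le> p x"
    using norm_imag_unit_le[where 'k='k] seminorm_nonneg[OF p(1), of x]
    by (simp add: seminorm_scale[OF p(1)] mult_left_le_one_le)
  then show ?thesis
    using norm_le_re_parts[of "f x"] p(2)[of x] p(2)[of "smul imag_unit x"]
    by (simp add: dual_scale[OF f])
qed

lemma norming_functional:
  assumes p: "seminorm p"
  obtains f where "f \<in> dual" "\<And>y. \<bar>re_part (f y)\<bar> \<le> p y" "re_part (f x) = p x"
proof -
  let ?M = "{(rscale t x, t * p x) |t. 0 \<le> t}"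
  have "functional_cone rscale ?M"
    by (rule functional_cone_ray[OF vector_space_rscale])
  moreover have "r \<le> p m" if "(m, r) \<in> ?M" for m r
    using that by (auto simp: rscale_def seminorm_scale[OF p])
  ultimately obtain f where f: "f \<in> dual" "\<And>y. \<bar>re_part (f y)\<bar> \<le> p y"
    "\<And>m r. (m, r) \<in> ?M \<Longrightarrow> r \<le> re_part (f m)"
    using dual_Mazur_Orlicz[OF p] by blast
  have "(x, p x) \<in> ?M"
    by (auto simp: rscale_def intro!: exI[of _ 1])
  then have "p x \<le> re_part (f x)"
    by (rule f(3))
  then have "re_part (f x) = p x"
    using f(2)[of x] by linarith
  then show thesis
    using that f by blast
qed

section \<open>The weak topology and its convergence\<close>

lemma zero_in_dual: "(\<lambda>x. 0) \<in> dual"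
proof -
  obtain p where "seminorm p"
    using openin_contains_seminorm_ball[of UNIV] openin_topspace[of E] topspace_UNIV by auto
  then show ?thesis
    by (intro dualI[of _ p]) (simp_all add: seminorm_nonneg)
qed

lemma topspace_weak [simp]: "topspace weak = UNIV"
proof -
  have "(\<lambda>x. 0 :: 'k) -` UNIV \<in> {f -` U |f U. f \<in> dual \<and> open U}"
    using zero_in_dual open_UNIV by blast
  then show ?thesis
    unfolding weak_topology_def topology_generated_by_topspace by auto
qed

lemma continuous_map_weak_dual:
  assumes "f \<in> dual" shows "continuous_map weak euclidean f"
  unfolding continuous_map_def
proof (intro conjI allI impI)
  fix U :: "'k set" assume "openin euclidean U"
  then have "openin weak (f -` U)"
    unfolding weak_topology_def using assms by (intro topology_generated_by_Basis) auto
  then show "openin weak {x \<in> topspace weak. f x \<in> U}"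
    by (simp add: vimage_def)
qed simp

lemma continuous_map_weak_re_part:
  assumes "f \<in> dual" shows "continuous_map weak euclideanreal (\<lambda>x. re_part (f x))"
proof -
  have "continuous_map euclidean euclideanreal (re_part :: 'k \<Rightarrow> real)"
    by (simp add: continuous_on_re_part)
  from continuous_map_compose[OF continuous_map_weak_dual[OF assms] this] show ?thesis
    by (simp add: o_def)
qed

lemma openin_weak_induct:
  assumes "openin weak W" and "\<And>f U. f \<in> dual \<Longrightarrow> open U \<Longrightarrow> P (f -` U)" "P {}"
    "\<And>S T. P S \<Longrightarrow> P T \<Longrightarrow> P (S \<inter> T)" "\<And>K. (\<And>S. S \<in> K \<Longrightarrow> P S) \<Longrightarrow> P (\<Union>K)"
  shows "P W"
proof -
  have "generate_topology_on {f -` U | f U. f \<in> dual \<and> open U} W"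
    using assms(1) by (simp add: weak_topology_def openin_topology_generated_by_iff)
  then show ?thesis
    by induction (use assms in auto)
qed

lemma openin_weak_imp_openin: "openin weak W \<Longrightarrow> openin E W"
proof (erule openin_weak_induct)
  fix f :: "'a \<Rightarrow> 'k" and U :: "'k set" assume "f \<in> dual" "open U"
  then have "openin E {x \<in> topspace E. f x \<in> U}"
    by (intro openin_continuous_map_preimage[of E euclidean]) (simp_all add: continuous_dual_def)
  then show "openin E (f -` U)"
    by (simp add: topspace_UNIV vimage_def)
qed auto

lemma continuous_map_E_weak: "continuous_map E weak (\<lambda>x. x)"
  using openin_weak_imp_openin by (simp add: continuous_map_def topspace_UNIV)

lemma limitin_weak_iff:
  "limitin weak a l F \<longleftrightarrow> (\<forall>f\<in>dual. ((\<lambda>x. f (a x)) \<longlongrightarrow> f l) F)"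
proof
  assume lim: "limitin weak a l F"
  show "\<forall>f\<in>dual. ((\<lambda>x. f (a x)) \<longlongrightarrow> f l) F"
  proof
    fix f assume "f \<in> dual"
    from continuous_map_limit[OF continuous_map_weak_dual[OF this] lim]
    show "((\<lambda>x. f (a x)) \<longlongrightarrow> f l) F"
      by (simp add: o_def)
  qed
next
  assume *: "\<forall>f\<in>dual. ((\<lambda>x. f (a x)) \<longlongrightarrow> f l) F"
  have "l \<in> W \<longrightarrow> (\<forall>\<^sub>F x in F. a x \<in> W)" if "openin weak W" for W
    using that
  proof (rule openin_weak_induct)
    fix f :: "'a \<Rightarrow> 'k" and U :: "'k set" assume "f \<in> dual" "open U"
    then show "l \<in> f -` U \<longrightarrow> (\<forall>\<^sub>F x in F. a x \<in> f -` U)"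
      using * by (auto simp: tendsto_def)
  next
    fix S T :: "'a set"
    assume "l \<in> S \<longrightarrow> (\<forall>\<^sub>F x in F. a x \<in> S)" "l \<in> T \<longrightarrow> (\<forall>\<^sub>F x in F. a x \<in> T)"
    then show "l \<in> S \<inter> T \<longrightarrow> (\<forall>\<^sub>F x in F. a x \<in> S \<inter> T)"
      by (simp add: eventually_conj)
  next
    fix K :: "'a set set"
    assume K: "\<And>S. S \<in> K \<Longrightarrow> l \<in> S \<longrightarrow> (\<forall>\<^sub>F x in F. a x \<in> S)"
    show "l \<in> \<Union>K \<longrightarrow> (\<forall>\<^sub>F x in F. a x \<in> \<Union>K)"
    proof
      assume "l \<in> \<Union>K"
      then obtain S where S: "S \<in> K" "l \<in> S" by blast
      with K have "\<forall>\<^sub>F x in F. a x \<in> S" by blast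
      then show "\<forall>\<^sub>F x in F. a x \<in> \<Union>K"
        by (rule eventually_mono) (use S(1) in blast)
    qed
  qed simp
  then show "limitin weak a l F"
    by (simp add: limitin_def)
qed

lemma Hausdorff_weak: "Hausdorff_space weak"
  unfolding Hausdorff_space_def
proof (intro allI impI)
  fix x y assume xy: "x \<in> topspace weak \<and> y \<in> topspace weak \<and> x \<noteq> y"
  then obtain p where p: "seminorm p" "1 \<le> p (x - y)"
    using separating_seminorm[of "x - y"] by auto
  obtain f where f: "f \<in> dual" "re_part (f (x - y)) = p (x - y)"
    using norming_functional[OF p(1)] by blast
  then have "f x \<noteq> f y"
    using p(2) by (auto simp: dual_diff)
  then obtain U V where UV: "open U" "open V" "f x \<in> U" "f y \<in> V" "U \<inter> V = {}"
    by (meson hausdorff)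
  have "openin weak (f -` W)" if "open W" for W
    using openin_continuous_map_preimage[OF continuous_map_weak_dual[OF f(1)], of W] that
    by (simp add: vimage_def)
  then show "\<exists>U V. openin weak U \<and> openin weak V \<and> x \<in> U \<and> y \<in> V \<and> disjnt U V"
    using UV by (intro exI[of _ "f -` U"] exI[of _ "f -` V"]) (auto simp: disjnt_def)
qed

text \<open>
  Mackey's theorem by a gliding hump: \<open>S n\<close> are partial sums of \<open>\<Sum>k. \<plusminus> 3\<^sup>-\<^sup>k F k\<close> with \<open>F k\<close>
  norming \<open>x k\<close>, where the sign makes \<open>S (Suc n)\<close> large at \<open>x n\<close> and later terms do not spoil this.
\<close>

lemma weakly_bounded_imp_bounded:
  assumes A: "\<And>f. f \<in> dual \<Longrightarrow> \<exists>M. \<forall>x\<in>A. norm (f x) \<le> M"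
  shows "bounded_in smul E A"
proof (rule ccontr)
  assume "\<not> bounded_in smul E A"
  then obtain p where p: "seminorm p" "\<And>M. \<exists>x\<in>A. M < p x"
    unfolding bounded_in_iff_seminorm by (meson not_le)
  \<comment> \<open>The power of 3 undoes the weight of \<open>F n\<close>. The factor 2 pays for
    the tail of the series after the n-th term, which is at most 3/2 of the next weight, hence half
    of the value secured at \<open>x n\<close>.\<close>
  have "\<exists>x\<in>A. 2 * real n * 3 ^ n < p x" for n
    by (rule p(2))
  then obtain x where x: "\<And>n. x n \<in> A" "\<And>n. 2 * real n * 3 ^ n < p (x n)"
    by metis
  have "\<exists>f. f \<in> dual \<and> (\<forall>y. \<bar>re_part (f y)\<bar> \<le> p y) \<and> re_part (f (x n)) = p (x n)" for n
    using norming_functional[OF p(1), of "x n"] by blast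
  then obtain f where f: "\<And>n. f n \<in> dual" "\<And>n y. \<bar>re_part (f n y)\<bar> \<le> p y"
    "\<And>n. re_part (f n (x n)) = p (x n)"
    by metis
  define F where "F = (\<lambda>n y. re_part (f n y) / 3 ^ n)"
  have F_add: "F n (y + z) = F n y + F n z" for n y z
    by (simp add: F_def dual_add[OF f(1)] re_part_add add_divide_distrib)
  have F_scale: "F n (rscale t y) = t * F n y" for n t y
    by (simp add: F_def rscale_def dual_scale[OF f(1)] re_part_of_real_mult)
  have F_abs: "\<bar>F n y\<bar> \<le> p y / 3 ^ n" for n y
    using f(2)[of n y] by (simp add: F_def divide_right_mono)
  have F_x: "F n (x n) = p (x n) / 3 ^ n" for n
    by (simp add: F_def f(3))
  define S where "S = rec_nat (\<lambda>y. 0)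
    (\<lambda>n s y. if p (x n) / 3 ^ n \<le> \<bar>s (x n) + F n (x n)\<bar> then s y + F n y else s y - F n y)"
  have S0: "S 0 y = 0" and S_Suc: "S (Suc n) y =
      (if p (x n) / 3 ^ n \<le> \<bar>S n (x n) + F n (x n)\<bar> then S n y + F n y else S n y - F n y)" for n y
    by (simp_all add: S_def)
  have S_add: "S n (y + z) = S n y + S n z" for n y z
    by (induction n) (simp_all add: S0 S_Suc F_add)
  have S_scale: "S n (rscale t y) = t * S n y" for n t y
    by (induction n) (simp_all add: S0 S_Suc F_scale algebra_simps)
  have S_large: "p (x n) / 3 ^ n \<le> \<bar>S (Suc n) (x n)\<bar>" for n
    using F_x[of n] seminorm_nonneg[OF p(1), of "x n"] by (auto simp: S_Suc)
  have S_step: "\<bar>S (Suc n) y - S n y\<bar> \<le> p y / 3 ^ n" for n y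
    using F_abs[of n y] by (simp add: S_Suc)
  have S_tail: "\<bar>S (n + j) y - S n y\<bar> \<le> 3 / 2 * (p y / 3 ^ n) * (1 - 1 / 3 ^ j)" for n j y
  proof (induction j)
    case (Suc j)
    have "\<bar>S (n + Suc j) y - S n y\<bar> \<le> 3 / 2 * (p y / 3 ^ n) * (1 - 1 / 3 ^ j) + p y / 3 ^ (n + j)"
      using Suc S_step[of "n + j" y] by simp
    also have "\<dots> = 3 / 2 * (p y / 3 ^ n) * (1 - 1 / 3 ^ Suc j)"
      by (simp add: field_simps power_add)
    finally show ?case .
  qed simp
  have S_tail': "\<bar>S m y - S n y\<bar> \<le> 3 / 2 * (p y / 3 ^ n)" if "n \<le> m" for n m y
  proof -
    have "3 / 2 * (p y / 3 ^ n) * (1 - 1 / 3 ^ (m - n)) \<le> 3 / 2 * (p y / 3 ^ n)"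
      by (rule mult_left_le) (use seminorm_nonneg[OF p(1), of y] in simp_all)
    then show ?thesis
      using S_tail[of n "m - n" y] that by simp
  qed
  have "convergent (\<lambda>n. S n y)" for y
  proof -
    have "Cauchy (\<lambda>n. S n y)"
    proof (rule metric_CauchyI)
      fix e :: real assume e: "0 < e"
      have "(\<lambda>n. 3 / 2 * (p y * (1 / 3) ^ n)) \<longlonglongrightarrow> 3 / 2 * (p y * 0)"
        by (intro tendsto_intros LIMSEQ_power_zero) simp
      then have "\<forall>\<^sub>F n in sequentially. 3 / 2 * (p y * (1 / 3) ^ n) < e / 2"
        by (rule order_tendstoD(2)) (use e in simp)
      then obtain N where "3 / 2 * (p y * (1 / 3) ^ N) < e / 2"
        by (auto simp: eventually_sequentially)
      then have N: "3 / 2 * (p y / 3 ^ N) < e / 2"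
        by (simp add: power_divide)
      have "dist (S m y) (S n y) < e" if "N \<le> m" "N \<le> n" for m n
        using S_tail'[OF that(1), of y] S_tail'[OF that(2), of y] N by (simp add: dist_real_def)
      then show "\<exists>N. \<forall>m\<ge>N. \<forall>n\<ge>N. dist (S m y) (S n y) < e"
        by blast
    qed
    then show ?thesis
      by (simp add: Cauchy_convergent)
  qed
  then obtain s where s: "\<And>y. (\<lambda>n. S n y) \<longlonglongrightarrow> s y"
    unfolding convergent_def by metis
  have s_add: "s (y + z) = s y + s z" for y z
    using LIMSEQ_unique[OF s[of "y + z"]] tendsto_add[OF s[of y] s[of z]] by (simp add: S_add)
  have s_scale: "s (rscale t y) = t * s y" for t y
    using LIMSEQ_unique[OF s[of "rscale t y"]] tendsto_mult_left[OF s[of y], of t] by (simp add: S_scale)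
  have s_tail: "\<bar>s y - S n y\<bar> \<le> 3 / 2 * (p y / 3 ^ n)" for n y
  proof (rule LIMSEQ_le_const2)
    show "(\<lambda>m. \<bar>S m y - S n y\<bar>) \<longlonglongrightarrow> \<bar>s y - S n y\<bar>"
      by (intro tendsto_intros s)
    show "\<exists>N. \<forall>m\<ge>N. \<bar>S m y - S n y\<bar> \<le> 3 / 2 * (p y / 3 ^ n)"
      using S_tail' by blast
  qed
  have "seminorm (\<lambda>y. 3 / 2 * p y)"
    by (rule seminorm_cmult[OF p(1)]) simp
  moreover have "s y \<le> 3 / 2 * p y" for y
    using s_tail[of y 0] by (simp add: S0)
  ultimately obtain g where g: "g \<in> dual" "\<And>y. re_part (g y) = s y"
    using dual_of_real_functional[OF s_add s_scale] by metis
  obtain M where M: "\<And>y. y \<in> A \<Longrightarrow> norm (g y) \<le> M"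
    using A[OF g(1)] by blast
  obtain n where n: "2 * M < real n"
    using reals_Archimedean2 by blast
  have "real n < (p (x n) / 3 ^ n) / 2"
    using x(2)[of n] by (simp add: field_simps)
  also have "\<dots> \<le> \<bar>s (x n)\<bar>"
    using S_large[of n] s_tail[of "x n" "Suc n"] by simp
  also have "\<dots> \<le> 2 * norm (g (x n))"
    using abs_re_part_le[of "g (x n)"] by (simp add: g(2))
  also have "\<dots> \<le> 2 * M"
    using M[OF x(1)] by simp
  finally show False
    using n by simp
qed

lemma bounded_in_weakly_convergent:
  assumes "limitin weak a l sequentially"
  shows "bounded_in smul E (range a)"
proof (rule weakly_bounded_imp_bounded)
  fix f assume "f \<in> dual"
  then have "(\<lambda>n. f (a n)) \<longlonglongrightarrow> f l"
    using assms by (simp add: limitin_weak_iff)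
  then obtain M where "\<And>n. norm (f (a n)) \<le> M"
    using convergent_imp_Bseq[of "\<lambda>n. f (a n)"] by (auto simp: convergent_def Bseq_def)
  then show "\<exists>M. \<forall>x\<in>range a. norm (f x) \<le> M" by blast
qed

lemma bounded_in_functionally_bounded:
  assumes "functionally_bounded_in weak A"
  shows "bounded_in smul E A"
proof (rule weakly_bounded_imp_bounded)
  fix f assume "f \<in> dual"
  then have "continuous_map weak euclideanreal (\<lambda>x. norm (f x))"
    using continuous_map_weak_dual by (intro continuous_map_norm) simp
  then have "bounded ((\<lambda>x. norm (f x)) ` A)"
    using assms by (simp add: functionally_bounded_in_def)
  then show "\<exists>M. \<forall>x\<in>A. norm (f x) \<le> M"
    by (auto simp: bounded_iff)
qed

end

section \<open>Compactness\<close>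

lemma ultrafilter_finite_union:
  assumes "G \<noteq> bot" "\<And>P. eventually P G \<or> eventually (\<lambda>x. \<not> P x) G"
    and "finite F" "eventually (\<lambda>y. \<exists>x\<in>F. P x y) G"
  shows "\<exists>x\<in>F. eventually (P x) G"
proof (rule ccontr)
  assume "\<not> ?thesis"
  then have "\<forall>x\<in>F. eventually (\<lambda>y. \<not> P x y) G"
    using assms(2) by blast
  then have "eventually (\<lambda>y. \<forall>x\<in>F. \<not> P x y) G"
    using \<open>finite F\<close> by (simp add: eventually_ball_finite)
  then have "eventually (\<lambda>y. False) G"
    using assms(4) by eventually_elim blast
  then show False
    using \<open>G \<noteq> bot\<close> by simp
qed

text \<open>If a cover has no finite subcover, the complements of its members in \<open>C\<close>
  generate a proper filter. An ultrafilter finer than this has a limit in some member of the cover,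
  although it avoids every member.\<close>

lemma compactin_ultrafilterI:
  assumes "C \<subseteq> topspace X"
    and conv: "\<And>G. G \<noteq> bot \<Longrightarrow> G \<le> principal C \<Longrightarrow>
      (\<And>P. eventually P G \<or> eventually (\<lambda>x. \<not> P x) G) \<Longrightarrow> \<exists>l\<in>C. limitin X (\<lambda>x. x) l G"
  shows "compactin X C"
  unfolding compactin_def
proof (intro conjI allI impI)
  show "C \<subseteq> topspace X" by fact
  fix \<U> assume \<U>: "Ball \<U> (openin X) \<and> C \<subseteq> \<Union>\<U>"
  show "\<exists>\<F>. finite \<F> \<and> \<F> \<subseteq> \<U> \<and> C \<subseteq> \<Union>\<F>"
  proof (rule ccontr)
    assume neg: "\<nexists>\<F>. finite \<F> \<and> \<F> \<subseteq> \<U> \<and> C \<subseteq> \<Union>\<F>"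
    define F where "F = (INF u\<in>\<U>. principal (C - u))"
    have "F \<noteq> bot"
      unfolding F_def
    proof (rule INF_filter_not_bot)
      fix \<V> assume V: "\<V> \<subseteq> \<U>" "finite \<V>"
      then obtain x where "x \<in> C - \<Union>\<V>"
        using neg by blast
      then have "(\<Inter>u\<in>\<V>. C - u) \<noteq> {}"
        by blast
      then show "(INF u\<in>\<V>. principal (C - u)) \<noteq> bot"
        using V by (simp add: INF_principal_finite principal_eq_bot_iff)
    qed
    then obtain G where G: "G \<le> F" "G \<noteq> bot" "\<And>P. eventually P G \<or> eventually (\<lambda>x. \<not> P x) G"
      using ultrafilter_refinement by blast
    have G_le: "G \<le> principal (C - u)" if "u \<in> \<U>" for u
      using G(1) that unfolding F_def by (meson INF_lower order_trans)
    have "\<U> \<noteq> {}"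
      using neg \<U> by (metis empty_subsetI finite.emptyI)
    then have "G \<le> principal C"
      using G_le by (metis Diff_subset all_not_in_conv order_trans principal_le_iff)
    then obtain l where l: "l \<in> C" "limitin X (\<lambda>x. x) l G"
      using conv G by blast
    then obtain u where u: "u \<in> \<U>" "l \<in> u"
      using \<U> by blast
    then have "eventually (\<lambda>x. x \<in> u) G"
      using l \<U> by (simp add: limitin_def)
    moreover have "eventually (\<lambda>x. x \<in> C - u) G"
      using G_le[OF u(1)] by (simp add: le_principal)
    ultimately have "eventually (\<lambda>x. False) G"
      by eventually_elim blast
    then show False
      using G(2) by simp
  qed
qed

section \<open>Implications between the compactness properties\<close>

lemma compactin_imp_countably_compactin: "compactin X A \<Longrightarrow> countably_compactin X A"
  unfolding countably_compactin_def countably_compact_space_def compactin_subspace compact_space_alt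
  by blast

lemma countably_compact_imp_pseudocompact_space:
  assumes "countably_compact_space X" shows "pseudocompact_space X"
  unfolding pseudocompact_space_def
proof (intro allI impI)
  fix f assume f: "continuous_map X euclideanreal f"
  define U where "U = (\<lambda>n::nat. {x \<in> topspace X. f x \<in> {- real n<..<real n}})"
  have "openin X (U n)" for n
    unfolding U_def by (rule openin_continuous_map_preimage[OF f]) simp
  moreover have "topspace X \<subseteq> \<Union>(range U)"
  proof
    fix x assume "x \<in> topspace X"
    moreover obtain n where "\<bar>f x\<bar> < real n"
      using reals_Archimedean2 by blast
    ultimately have "x \<in> U n"
      by (auto simp: U_def)
    then show "x \<in> \<Union>(range U)" by blast
  qed
  moreover have "countable (range U)" by simp
  ultimately obtain \<F> where \<F>: "finite \<F>" "\<F> \<subseteq> range U" "topspace X \<subseteq> \<Union>\<F>"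
    using assms unfolding countably_compact_space_def by (metis rangeE)
  then obtain N where N: "finite N" "\<F> = U ` N"
    by (meson finite_subset_image)
  have "\<bar>f x\<bar> \<le> real (Max (insert 0 N))" if x: "x \<in> topspace X" for x
  proof -
    obtain n where n: "n \<in> N" "x \<in> U n"
      using \<F>(3) N(2) x by blast
    then have "n \<le> Max (insert 0 N)"
      using N(1) by simp
    then show ?thesis
      using n(2) by (auto simp: U_def)
  qed
  then show "bounded (f ` topspace X)"
    by (auto simp: bounded_iff)
qed

lemma seq_compact_imp_pseudocompact_space:
  assumes "seq_compact_space X" shows "pseudocompact_space X"
  unfolding pseudocompact_space_def
proof (intro allI impI)
  fix f assume f: "continuous_map X euclideanreal f"
  show "bounded (f ` topspace X)"
  proof (rule ccontr)
    assume "\<not> bounded (f ` topspace X)"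
    then have "\<exists>x\<in>topspace X. real n < \<bar>f x\<bar>" for n :: nat
      by (auto simp: bounded_iff not_le)
    then obtain a where a: "\<And>n. a n \<in> topspace X" "\<And>n :: nat. real n < \<bar>f (a n)\<bar>"
      by metis
    then obtain l r where r: "strict_mono (r :: nat \<Rightarrow> nat)" "limitin X (a \<circ> r) l sequentially"
      using assms unfolding seq_compact_space_def by (metis image_subsetI)
    have "(\<lambda>n. f (a (r n))) \<longlonglongrightarrow> f l"
      using continuous_map_limit[OF f r(2)] by (simp add: o_def)
    then obtain M where M: "\<And>n. norm (f (a (r n))) \<le> M"
      using convergent_imp_Bseq[of "\<lambda>n. f (a (r n))"] by (auto simp: convergent_def Bseq_def)
    obtain n where "M < real n"
      using reals_Archimedean2 by blast
    then show False
      using M[of n] a(2)[of "r n"] seq_suble[OF r(1), of n] by simp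
  qed
qed

lemma pseudocompactin_imp_functionally_bounded:
  assumes "pseudocompactin X A" shows "functionally_bounded_in X A"
  using assms continuous_map_from_subtopology[of X euclideanreal _ A]
  unfolding pseudocompactin_def pseudocompact_space_def functionally_bounded_in_def
  by (metis topspace_subtopology_subset)

lemma countably_compactin_imp_pseudocompactin: "countably_compactin X A \<Longrightarrow> pseudocompactin X A"
  by (simp add: countably_compactin_def pseudocompactin_def countably_compact_imp_pseudocompact_space)

lemma seq_compactin_imp_pseudocompactin: "seq_compactin X A \<Longrightarrow> pseudocompactin X A"
  by (simp add: seq_compactin_def pseudocompactin_def seq_compact_imp_pseudocompact_space)

lemma functionally_bounded_continuous_map:
  assumes "continuous_map X Y (\<lambda>x. x)" "functionally_bounded_in X A"
  shows "functionally_bounded_in Y A"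
  unfolding functionally_bounded_in_def
proof (intro conjI allI impI)
  show "A \<subseteq> topspace Y"
    using assms continuous_map_funspace[OF assms(1)] by (auto simp: functionally_bounded_in_def)
  fix f assume "continuous_map Y euclideanreal f"
  from continuous_map_compose[OF assms(1) this] show "bounded (f ` A)"
    using assms(2) by (simp add: functionally_bounded_in_def o_def)
qed

lemma constant_subsequence:
  assumes "infinite {n::nat. b n = v}"
  obtains r where "strict_mono (r :: nat \<Rightarrow> nat)" "\<And>n. b (r n) = v"
  using infinite_enumerate[OF assms] by auto

text \<open>For sequential compactness, let \<open>b\<close> be a sequence in the set. Either it
  takes some value infinitely often and has a constant subsequence, or it converges to
  \<open>l\<close> itself: outside a neighbourhood of \<open>l\<close> it can take only finitely
  many values, each finitely often.\<close>

lemma convergent_sequence_compactness: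
  assumes a: "limitin X a l sequentially" and "range a \<subseteq> topspace X"
  shows "compactin X (insert l (range a))" "seq_compactin X (insert l (range a))"
proof -
  have lX: "l \<in> topspace X"
    using a by (simp add: limitin_def)
  show "compactin X (insert l (range a))"
    using compactin_sequence_with_limit[OF a] assms(2) by simp
  show "seq_compactin X (insert l (range a))"
    unfolding seq_compactin_def seq_compact_space_def
  proof (intro conjI allI impI)
    show sub: "insert l (range a) \<subseteq> topspace X"
      using assms lX by simp
    fix b :: "nat \<Rightarrow> 'a"
    assume "range b \<subseteq> topspace (subtopology X (insert l (range a)))"
    then have b: "b n \<in> insert l (range a)" for n
      by auto
    show "\<exists>l' r. strict_mono (r :: nat \<Rightarrow> nat) \<and>
        limitin (subtopology X (insert l (range a))) (b \<circ> r) l' sequentially"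
    proof (cases "\<exists>v. infinite {n. b n = v}")
      case True
      then obtain v r where r: "strict_mono (r :: nat \<Rightarrow> nat)" "\<And>n. b (r n) = v"
        using constant_subsequence by metis
      have "v \<in> insert l (range a)"
        using b[of "r 0"] r(2)[of 0] by simp
      then have "limitin (subtopology X (insert l (range a))) (b \<circ> r) v sequentially"
        using r(2) sub by (auto simp: limitin_subtopology limitin_def o_def)
      then show ?thesis
        using r(1) by blast
    next
      case False
      have "\<exists>k. b n = l \<or> b n = a k" for n
        using b[of n] by blast
      then obtain k where k: "\<And>n. b n = l \<or> b n = a (k n)"
        by metis
      have "limitin X b l sequentially"
        unfolding limitin_def
      proof (intro conjI allI impI lX)
        fix U assume U: "openin X U \<and> l \<in> U"
        then have "\<forall>\<^sub>F n in sequentially. a n \<in> U"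
          using a by (simp add: limitin_def)
        then obtain N where N: "\<And>n. N \<le> n \<Longrightarrow> a n \<in> U"
          by (auto simp: eventually_sequentially)
        have "{n. b n \<notin> U} \<subseteq> (\<Union>i<N. {n. b n = a i})"
        proof
          fix n assume n: "n \<in> {n. b n \<notin> U}"
          then have "b n = a (k n)"
            using k[of n] U by auto
          moreover from this have "\<not> N \<le> k n"
            using N n by auto
          ultimately show "n \<in> (\<Union>i<N. {n. b n = a i})"
            by (intro UN_I[of "k n"]) simp_all
        qed
        moreover have "finite (\<Union>i<N. {n. b n = a i})"
          using False by simp
        ultimately have "finite {n. b n \<notin> U}"
          by (rule finite_subset)
        then show "\<forall>\<^sub>F n in sequentially. b n \<in> U"
          by (simp add: eventually_cofinite flip: cofinite_eq_sequentially)
      qed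
      then have "limitin (subtopology X (insert l (range a))) (b \<circ> (\<lambda>n. n)) l sequentially"
        using b by (simp add: limitin_subtopology o_def)
      then show ?thesis
        using strict_mono_id[unfolded id_def] by blast
    qed
  qed
qed

context locally_convex_space
begin

section \<open>Closures, precompact sets and quasi-completeness\<close>

lemma in_closure_ofD:
  assumes "x \<in> E closure_of A" "seminorm p" "0 < e"
  obtains a where "a \<in> A" "p (a - x) < e"
proof -
  have "x \<in> {y. p (y - x) < e}"
    using assms(3) seminorm_zero[OF assms(2)] by simp
  then have "x \<in> {y. p (y - x) < e} \<and> openin E {y. p (y - x) < e}"
    using openin_seminorm_ball[OF assms(2)] by blast
  moreover have "\<forall>T. x \<in> T \<and> openin E T \<longrightarrow> (\<exists>a. a \<in> A \<and> a \<in> T)"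
    using assms(1) by (simp add: in_closure_of)
  ultimately have "\<exists>a. a \<in> A \<and> a \<in> {y. p (y - x) < e}"
    by (metis (no_types))
  then show thesis
    using that by auto
qed

lemma bounded_in_subset: "bounded_in smul E B \<Longrightarrow> A \<subseteq> B \<Longrightarrow> bounded_in smul E A"
  unfolding bounded_in_def by (meson order_trans)

lemma precompact_in_subset: "precompact_in E B \<Longrightarrow> A \<subseteq> B \<Longrightarrow> precompact_in E A"
  unfolding precompact_in_def by (meson order_trans)

lemma bounded_in_closure:
  assumes "bounded_in smul E A" shows "bounded_in smul E (E closure_of A)"
  unfolding bounded_in_iff_seminorm
proof (intro allI impI)
  fix p assume p: "seminorm p"
  then obtain M where M: "\<And>a. a \<in> A \<Longrightarrow> p a \<le> M"
    using assms bounded_in_iff_seminorm by blast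
  have "p x \<le> M + 1" if x: "x \<in> E closure_of A" for x
  proof -
    obtain a where "a \<in> A" "p (a - x) < 1"
      using in_closure_ofD[OF x p zero_less_one] by blast
    then show ?thesis
      using M[of a] seminorm_reverse_triangle[OF p, of a x] by linarith
  qed
  then show "\<exists>M. \<forall>x\<in>E closure_of A. p x \<le> M" by blast
qed

lemma precompact_in_closure:
  assumes "precompact_in E A" shows "precompact_in E (E closure_of A)"
  unfolding precompact_in_iff_seminorm
proof (intro allI impI)
  fix p and e :: real assume p: "seminorm p \<and> 0 < e"
  obtain F where F: "finite F" "A \<subseteq> (\<Union>x\<in>F. {y. p (y - x) < e / 2})"
    using assms[unfolded precompact_in_iff_seminorm, rule_format, of p "e / 2"] p by auto
  have "E closure_of A \<subseteq> (\<Union>x\<in>F. {y. p (y - x) < e})"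
  proof
    fix y assume y: "y \<in> E closure_of A"
    then obtain a where a: "a \<in> A" "p (a - y) < e / 2"
      using in_closure_ofD[OF y, of p "e / 2"] p by auto
    then obtain x where x: "x \<in> F" "p (a - x) < e / 2"
      using F(2) by blast
    have "p (y - x) \<le> p (y - a) + p (a - x)"
      using p seminorm_diff_triangle by blast
    also have "\<dots> < e"
      using a(2) x(2) seminorm_minus_commute[of p y a] p by simp
    finally show "y \<in> (\<Union>x\<in>F. {y. p (y - x) < e})"
      using x(1) by blast
  qed
  then show "\<exists>F. finite F \<and> E closure_of A \<subseteq> (\<Union>x\<in>F. {y. p (y - x) < e})"
    using F(1) by blast
qed

text \<open>Among the finitely many small balls covering \<open>C\<close>, an ultrafilter on
  \<open>C\<close> has to select one.\<close>

lemma precompact_ultrafilter_Cauchy: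
  assumes "precompact_in E C" "G \<noteq> bot" "G \<le> principal C"
    and ultra: "\<And>P. eventually P G \<or> eventually (\<lambda>x. \<not> P x) G"
  shows "Cauchy_filter_in E G"
  unfolding Cauchy_filter_in_def
proof (intro allI impI)
  fix U assume "openin E U \<and> 0 \<in> U"
  then obtain p where p: "seminorm p" "{x. p x < 1} \<subseteq> U"
    using openin_contains_seminorm_ball by blast
  obtain F where F: "finite F" "C \<subseteq> (\<Union>x\<in>F. {y. p (y - x) < 1 / 2})"
    using assms(1)[unfolded precompact_in_iff_seminorm, rule_format, of p "1 / 2"] p by auto
  have "eventually (\<lambda>y. y \<in> C) G"
    using assms(3) by (simp add: le_principal)
  then have "eventually (\<lambda>y. \<exists>x\<in>F. p (y - x) < 1 / 2) G"
    by (rule eventually_mono) (use F(2) in blast)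
  from ultrafilter_finite_union[OF assms(2) ultra F(1) this]
  obtain x where x: "eventually (\<lambda>y. p (y - x) < 1 / 2) G" ..
  have "y - z \<in> U" if "p (y - x) < 1 / 2" "p (z - x) < 1 / 2" for y z
  proof -
    have "p (y - z) \<le> p (y - x) + p (x - z)"
      by (rule seminorm_diff_triangle[OF p(1)])
    then have "p (y - z) < 1"
      using that seminorm_minus_commute[OF p(1), of x z] by simp
    then show ?thesis
      using p(2) by blast
  qed
  then show "\<forall>\<^sub>F (y, z) in G \<times>\<^sub>F G. y - z \<in> U"
    unfolding eventually_prod_filter using x by fast
qed

lemma compactin_closure_of_precompact:
  assumes "quasi_complete smul E" "bounded_in smul E A" "precompact_in E A"
  shows "compactin E (E closure_of A)"
proof (rule compactin_ultrafilterI)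
  show "E closure_of A \<subseteq> topspace E"
    by (rule closure_of_subset_topspace)
  fix G :: "'a filter"
  assume G: "G \<noteq> bot" "G \<le> principal (E closure_of A)"
    "\<And>P. eventually P G \<or> eventually (\<lambda>x. \<not> P x) G"
  have "complete_in E (E closure_of A)"
    using assms(1) bounded_in_closure[OF assms(2)] by (simp add: quasi_complete_def)
  moreover have "Cauchy_filter_in E G"
    by (rule precompact_ultrafilter_Cauchy[OF precompact_in_closure[OF assms(3)] G])
  ultimately show "\<exists>l\<in>E closure_of A. limitin E (\<lambda>x. x) l G"
    using G by (simp add: complete_in_def)
qed

text \<open>The identity is a continuous bijection from a compact space onto a Hausdorff space: a
  relatively closed subset is compact for \<open>E\<close>, hence weakly compact, hence weakly
  closed.\<close>

lemma compactin_imp_subtopology_eq_weak: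
  assumes C: "compactin E C"
  shows "subtopology E C = subtopology weak C"
proof (rule topology_eq[THEN iffD2], rule allI, rule iffI)
  fix S assume "openin (subtopology weak C) S"
  then show "openin (subtopology E C) S"
    using openin_weak_imp_openin by (auto simp: openin_subtopology)
next
  fix S assume S: "openin (subtopology E C) S"
  have "S \<subseteq> C"
    using openin_subset[OF S] by simp
  have "closedin (subtopology E C) (C - S)"
    using S by (simp add: closedin_def topspace_UNIV double_diff \<open>S \<subseteq> C\<close>)
  moreover have "compact_space (subtopology E C)"
    using C by (simp add: compactin_subspace)
  ultimately have "compactin (subtopology E C) (C - S)"
    by (rule closedin_compact_space[rotated])
  then have "compactin E (C - S)"
    by (simp add: compactin_subtopology)
  then have "compactin weak (C - S)"
    using image_compactin[OF _ continuous_map_E_weak] by simp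
  then have "closedin weak (C - S)"
    using Hausdorff_weak compactin_imp_closedin by blast
  then have "openin weak (UNIV - (C - S))"
    by (simp add: closedin_def)
  moreover have "S = (UNIV - (C - S)) \<inter> C"
    using \<open>S \<subseteq> C\<close> by blast
  ultimately show "openin (subtopology weak C) S"
    unfolding openin_subtopology by blast
qed

text \<open>The closure of the range is compact in \<open>E\<close>, hence weakly closed, so it
  contains \<open>l\<close>; on it the two topologies coincide.\<close>

lemma weak_limit_of_precompact:
  assumes "quasi_complete smul E" and lim: "limitin weak a l sequentially"
    and "precompact_in E (range a)"
  shows "limitin E a l sequentially"
proof -
  define C where "C = E closure_of (range a)"
  have C: "compactin E C"
    unfolding C_def using assms bounded_in_weakly_convergent[OF lim] compactin_closure_of_precompact by blast
  have aC: "a n \<in> C" for n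
    using closure_of_subset[of "range a" E] by (auto simp: C_def topspace_UNIV)
  have "closedin weak C"
    using image_compactin[OF C continuous_map_E_weak] Hausdorff_weak compactin_imp_closedin by auto
  then have "l \<in> C"
    using limitin_closedin[OF lim] aC by simp
  then have "limitin (subtopology weak C) a l sequentially"
    using lim aC by (simp add: limitin_subtopology)
  then have "limitin (subtopology E C) a l sequentially"
    by (simp add: compactin_imp_subtopology_eq_weak[OF C])
  then show ?thesis
    by (simp add: limitin_subtopology)
qed

text \<open>In contrast to \<open>exists_separated_sequence\<close> the separated points have to
  form a subsequence. Keeping distance from all terms up to index \<open>N\<close> forces the index
  of the new term beyond \<open>N\<close>.\<close>

lemma not_precompact_subsequence:
  assumes "\<not> precompact_in E (range a)"
  obtains p e r where "seminorm p" "0 < e" "strict_mono (r :: nat \<Rightarrow> nat)"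
    "\<And>m n. m < n \<Longrightarrow> e \<le> p (a (r n) - a (r m))"
proof -
  obtain p and e :: real where p: "seminorm p" "0 < e"
    and neg: "\<And>F. finite F \<Longrightarrow> \<not> range a \<subseteq> (\<Union>x\<in>F. {y. p (y - x) < e})"
    using assms unfolding precompact_in_iff_seminorm by blast
  have "\<exists>k. \<forall>i\<le>N. e \<le> p (a k - a i)" for N
  proof -
    obtain k where "a k \<notin> (\<Union>x\<in>a ` {..N}. {y. p (y - x) < e})"
      using neg[of "a ` {..N}"] by blast
    then show ?thesis
      by (intro exI[of _ k]) (auto simp: not_less)
  qed
  then obtain g where g: "\<And>N i. i \<le> N \<Longrightarrow> e \<le> p (a (g N) - a i)"
    by metis
  have g_gt: "N < g N" for N
    using g[of "g N" N] p seminorm_zero[OF p(1)] by (force simp: not_less[symmetric])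
  define r where "r = rec_nat 0 (\<lambda>_. g)"
  have r_Suc: "r (Suc n) = g (r n)" for n
    by (simp add: r_def)
  have r: "strict_mono r"
    unfolding strict_mono_Suc_iff by (simp add: r_Suc g_gt)
  have "e \<le> p (a (r n) - a (r m))" if mn: "m < n" for m n
  proof -
    obtain n' where n': "n = Suc n'" "m \<le> n'"
      using mn by (metis Suc_leI Suc_le_D Suc_le_mono)
    then have "r m \<le> r n'"
      using r by (simp add: strict_mono_less_eq)
    then show ?thesis
      using g by (simp add: n'(1) r_Suc)
  qed
  then show thesis
    using that p r by blast
qed

lemma not_precompact_sequence:
  assumes "\<not> precompact_in E A"
  obtains p e a where "seminorm p" "0 < e" "range (a :: nat \<Rightarrow> 'a) \<subseteq> A"
    "\<And>m n. m < n \<Longrightarrow> e \<le> p (a n - a m)"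
proof -
  obtain p and e :: real where p: "seminorm p" "0 < e"
    and neg: "\<And>F. finite F \<Longrightarrow> \<not> A \<subseteq> (\<Union>x\<in>F. {y. p (y - x) < e})"
    using assms unfolding precompact_in_iff_seminorm by blast
  obtain a :: "nat \<Rightarrow> 'a" where "range a \<subseteq> A" "\<And>m n. m < n \<Longrightarrow> e \<le> p (a n - a m)"
    using exists_separated_sequence[OF p(1) neg] by blast
  then show thesis
    using that p by blast
qed

text \<open>
  If \<open>a\<close> is a sequence of pairwise distant points, \<open>u x = (INF n. p (x - a n) + 1 / (n + 1))\<close> is
  continuous and positive, and \<open>1 / u\<close> is unbounded along \<open>a\<close>.
\<close>

lemma functionally_bounded_imp_precompact:
  assumes A: "functionally_bounded_in E A"
  shows "precompact_in E A"
proof (rule ccontr)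
  assume "\<not> precompact_in E A"
  then obtain p e a where p: "seminorm p" "0 < e" and a: "range (a :: nat \<Rightarrow> 'a) \<subseteq> A"
    and sep: "\<And>m n. m < n \<Longrightarrow> e \<le> p (a n - a m)"
    using not_precompact_sequence by blast
  define g where "g = (\<lambda>x n. p (x - a n) + 1 / (real n + 1))"
  define u where "u = (\<lambda>x. INF n. g x n)"
  have g_nonneg: "0 \<le> g x n" for x n
    by (simp add: g_def seminorm_nonneg[OF p(1)])
  have bdd: "bdd_below (range (g x))" for x
    using g_nonneg by (intro bdd_belowI2)
  have u_le: "u x \<le> g x n" for x n
    unfolding u_def by (rule cINF_lower[OF bdd]) simp
  have u_ge: "c \<le> u x" if "\<And>n. c \<le> g x n" for c x
    unfolding u_def by (rule cINF_greatest) (use that in auto)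
  have u_diff: "u x \<le> u y + p (x - y)" for x y
  proof -
    have "u x - p (x - y) \<le> u y"
    proof (rule u_ge)
      fix n
      have "g x n \<le> g y n + p (x - y)"
        using seminorm_diff_triangle[OF p(1), of x "a n" y] by (simp add: g_def)
      then show "u x - p (x - y) \<le> g y n"
        using u_le[of x n] by simp
    qed
    then show ?thesis by simp
  qed
  have u_cont: "continuous_map E euclideanreal u"
  proof (rule continuous_map_metricI)
    fix x and d :: real assume d: "0 < d"
    have "dist (u y) (u x) < d" if "p (y - x) < d" for y
      using that u_diff[of x y] u_diff[of y x] seminorm_minus_commute[OF p(1), of x y]
      by (simp add: dist_real_def)
    then show "\<exists>U. openin E U \<and> x \<in> U \<and> (\<forall>y\<in>U. dist (u y) (u x) < d)"
      using openin_seminorm_ball[OF p(1)] d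
      by (intro exI[of _ "{y. p (y - x) < d}"]) (simp add: seminorm_zero[OF p(1)])
  qed
  have u_pos: "0 < u x" for x
  proof (cases "\<exists>N. p (x - a N) < e / 2")
    case True
    then obtain N where N: "p (x - a N) < e / 2" ..
    \<comment> \<open>The index \<open>N\<close> contributes at least
      \<open>1 / (real N + 1)\<close> to the infimum. Any other term is at distance at least
      \<open>e\<close> from \<open>a N\<close>, so its distance from \<open>x\<close> is at least
      the first entry of the minimum.\<close>
    have "min (e / 2 - p (x - a N)) (1 / (real N + 1)) \<le> u x"
    proof (rule u_ge)
      fix n
      show "min (e / 2 - p (x - a N)) (1 / (real N + 1)) \<le> g x n"
      proof (cases "n = N")
        case True
        then show ?thesis
          using seminorm_nonneg[OF p(1), of "x - a N"] by (simp add: g_def min_def)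
      next
        case False
        then have "e \<le> p (a n - a N)"
          using sep[of n N] sep[of N n] seminorm_minus_commute[OF p(1), of "a n" "a N"] by linarith
        also have "\<dots> \<le> p (a n - x) + p (x - a N)"
          by (rule seminorm_diff_triangle[OF p(1)])
        finally have "e / 2 - p (x - a N) \<le> p (x - a n)"
          using seminorm_minus_commute[OF p(1), of "a n" x] p(2) by linarith
        moreover have "p (x - a n) \<le> g x n"
          by (simp add: g_def)
        ultimately show ?thesis by linarith
      qed
    qed
    moreover have "0 < min (e / 2 - p (x - a N)) (1 / (real N + 1))"
      using N by simp
    ultimately show ?thesis by linarith
  next
    case False
    then have "e / 2 \<le> g x n" for n
      unfolding g_def by (meson add_increasing2 divide_nonneg_nonneg le_add_same_cancel2 not_less of_nat_0_le_iff zero_le_one)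
    then have "e / 2 \<le> u x"
      by (rule u_ge)
    then show ?thesis
      using p(2) by linarith
  qed
  have "continuous_map E euclideanreal (\<lambda>x. inverse (u x))"
    using u_cont u_pos by (intro continuous_map_real_inverse) (auto simp: less_imp_neq[symmetric])
  then have "bounded ((\<lambda>x. inverse (u x)) ` A)"
    using A by (simp add: functionally_bounded_in_def)
  then obtain M where M: "\<And>x. x \<in> A \<Longrightarrow> \<bar>inverse (u x)\<bar> \<le> M"
    by (auto simp: bounded_iff)
  obtain n where n: "M < real n"
    using reals_Archimedean2 by blast
  have "u (a n) \<le> 1 / (real n + 1)"
    using u_le[of "a n" n] by (simp add: g_def seminorm_zero[OF p(1)])
  then have "inverse (1 / (real n + 1)) \<le> inverse (u (a n))"
    using u_pos by (intro le_imp_inverse_le) auto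
  then have "real n + 1 \<le> inverse (u (a n))"
    by simp
  also have "\<dots> \<le> M"
    using order_trans[OF abs_ge_self M] a by blast
  finally have "real n + 1 \<le> M" .
  with n show False
    by simp
qed

lemma Schur_if_weakly_compact_bounded:
  assumes "quasi_complete smul E"
    and "\<And>a l. limitin weak a l sequentially \<Longrightarrow> functionally_bounded_in E (insert l (range a))"
  shows "Schur_property smul E"
  unfolding Schur_property_def
proof (intro allI impI)
  fix a :: "nat \<Rightarrow> 'a" and l assume lim: "limitin weak a l sequentially"
  from assms(2)[OF this] have "precompact_in E (range a)"
    using functionally_bounded_imp_precompact precompact_in_subset by blast
  then show "limitin E a l sequentially"
    using weak_limit_of_precompact[OF assms(1) lim] by blast
qed

end

section \<open>Rosenthal's theorem\<close>

text \<open>The sequence has two distinct cluster points, at distance \<open>D\<close>. Moving both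
  into \<open>Q\<close> by less than \<open>D / 64\<close> leaves the radius
  \<open>norm (w1 - w2) / 16\<close> above \<open>D / 32\<close>, which covers this shift and a tail
  within another \<open>D / 64\<close> of the cluster point. Centres in a countable \<open>Q\<close>
  mean countably many pairs of discs.\<close>

lemma nonconvergent_two_clusters:
  fixes z :: "nat \<Rightarrow> 'k::real_or_complex_field"
  assumes bnd: "\<And>n. norm (z n) \<le> C" and "\<not> convergent z"
    and dense: "\<And>w e. 0 < e \<Longrightarrow> \<exists>q\<in>Q. norm (w - q) < e"
  shows "\<exists>w1\<in>Q. \<exists>w2\<in>Q. w1 \<noteq> w2 \<and> infinite {n. norm (z n - w1) \<le> norm (w1 - w2) / 16} \<and>
    infinite {n. norm (z n - w2) \<le> norm (w1 - w2) / 16}"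
proof -
  obtain r l1 where r: "strict_mono (r :: nat \<Rightarrow> nat)" "(z \<circ> r) \<longlonglongrightarrow> l1"
    using bounded_scalar_sequence[of z C] bnd by metis
  have "\<not> z \<longlonglongrightarrow> l1"
    using assms(2) by (auto simp: convergent_def)
  then obtain e where e: "0 < e" "\<not> (\<forall>\<^sub>F n in sequentially. dist (z n) l1 < e)"
    by (auto simp: tendsto_iff)
  have "infinite {n. \<not> dist (z n) l1 < e}"
    using e(2) by (simp add: eventually_cofinite flip: cofinite_eq_sequentially)
  then obtain s where s: "strict_mono (s :: nat \<Rightarrow> nat)" "\<And>n. \<not> dist (z (s n)) l1 < e"
    using infinite_enumerate by blast
  obtain r' l2 where r': "strict_mono (r' :: nat \<Rightarrow> nat)" "((\<lambda>n. z (s n)) \<circ> r') \<longlonglongrightarrow> l2"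
    using bounded_scalar_sequence[of "\<lambda>n. z (s n)" C] bnd by metis
  have "(\<lambda>n. dist (z (s (r' n))) l1) \<longlonglongrightarrow> dist l2 l1"
    using r'(2) by (intro tendsto_intros) (simp add: o_def)
  then have "e \<le> dist l2 l1"
    by (rule LIMSEQ_le_const) (use s(2) in \<open>auto simp: not_less\<close>)
  define D where "D = norm (l1 - l2)"
  have D: "0 < D"
    using \<open>e \<le> dist l2 l1\<close> e(1) unfolding D_def dist_norm norm_minus_commute[of l2] by linarith
  obtain w1 where w1: "w1 \<in> Q" "norm (l1 - w1) < D / 64"
    using dense[of "D / 64"] D by auto
  obtain w2 where w2: "w2 \<in> Q" "norm (l2 - w2) < D / 64"
    using dense[of "D / 64"] D by auto
  have "D \<le> norm (l1 - w1) + norm (w1 - w2) + norm (l2 - w2)"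
    unfolding D_def using norm_triangle_ineq[of "l1 - w1" "w1 - w2"]
      norm_triangle_ineq4[of "(l1 - w1) + (w1 - w2)" "l2 - w2"] by simp
  then have w12: "D / 32 < norm (w1 - w2) / 16"
    using w1(2) w2(2) D by linarith
  have cluster: "infinite {n. norm (z n - w) \<le> norm (w1 - w2) / 16}"
    if q: "strict_mono (q :: nat \<Rightarrow> nat)" "(\<lambda>n. z (q n)) \<longlonglongrightarrow> l" "norm (l - w) < D / 64" for q l w
  proof -
    have "\<forall>\<^sub>F n in sequentially. dist (z (q n)) l < D / 64"
      using q(2) D by (intro tendstoD) simp_all
    then obtain N where N: "\<And>n. N \<le> n \<Longrightarrow> dist (z (q n)) l < D / 64"
      by (auto simp: eventually_sequentially)
    have "norm (z (q n) - w) \<le> norm (w1 - w2) / 16" if "N \<le> n" for n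
      using norm_triangle_ineq[of "z (q n) - l" "l - w"] N[OF that] q(3) w12 by (simp add: dist_norm)
    then have "q ` {N..} \<subseteq> {n. norm (z n - w) \<le> norm (w1 - w2) / 16}"
      by auto
    moreover have "infinite (q ` {N..})"
      using q(1) by (simp add: finite_image_iff strict_mono_imp_inj_on infinite_Ici inj_on_subset)
    ultimately show ?thesis
      using infinite_super by blast
  qed
  have "infinite {n. norm (z n - w1) \<le> norm (w1 - w2) / 16}"
    by (rule cluster[OF r(1) _ w1(2)]) (use r(2) in \<open>simp add: o_def\<close>)
  moreover have "infinite {n. norm (z n - w2) \<le> norm (w1 - w2) / 16}"
    by (rule cluster[of "s \<circ> r'", OF _ _ w2(2)]) (use r' s(1) in \<open>simp_all add: o_def strict_mono_def\<close>)
  moreover have "w1 \<noteq> w2"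
    using w12 D by auto
  ultimately show ?thesis
    using w1(1) w2(1) by blast
qed

section \<open>Domination of the \<open>\<ell>\<^sub>1\<close> norm and interpolation by
  functionals\<close>

context locally_convex_space
begin

definition dominates_ell1 :: "('a \<Rightarrow> real) \<Rightarrow> (nat \<Rightarrow> 'a) \<Rightarrow> bool" where
  "dominates_ell1 p b \<longleftrightarrow> (\<forall>n c. (\<Sum>i<n. norm (c i)) \<le> p (\<Sum>i<n. smul (c i) (b i)))"

text \<open>The demands that \<open>b i\<close> be sent to \<open>t i\<close>, reduced to real
  parts. Parametrizing by coefficients instead of by points of the span avoids the question whether
  a functional on the span is well defined.\<close>

definition bounded_pairing :: "(nat \<Rightarrow> 'a) \<Rightarrow> (nat \<Rightarrow> 'k) \<Rightarrow> ('a \<times> real) set" where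
  "bounded_pairing b t =
    {(\<Sum>i<n. smul (c i) (b i), re_part (\<Sum>i<n. c i * t i)) |n c. True}"

lemma functional_cone_bounded_pairing: "functional_cone rscale (bounded_pairing b t)"
  unfolding functional_cone_def
proof (intro conjI allI impI)
  show "(0, 0) \<in> bounded_pairing b t"
    unfolding bounded_pairing_def by (intro CollectI exI[of _ 0]) simp
next
  fix x r y s assume "(x, r) \<in> bounded_pairing b t \<and> (y, s) \<in> bounded_pairing b t"
  then obtain n c m d where
    x: "x = (\<Sum>i<n. smul (c i) (b i))" "r = re_part (\<Sum>i<n. c i * t i)" and
    y: "y = (\<Sum>i<m. smul (d i) (b i))" "s = re_part (\<Sum>i<m. d i * t i)"
    unfolding bounded_pairing_def by blast
  define c' d' where "c' = (\<lambda>i. if i < n then c i else 0)" and "d' = (\<lambda>i. if i < m then d i else 0)"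
  have c': "(\<Sum>i<n. smul (c i) (b i)) = (\<Sum>i<n+m. smul (c' i) (b i))"
    "(\<Sum>i<n. c i * t i) = (\<Sum>i<n+m. c' i * t i)"
    by (rule sum.mono_neutral_cong_left; simp add: c'_def)+
  have d': "(\<Sum>i<m. smul (d i) (b i)) = (\<Sum>i<n+m. smul (d' i) (b i))"
    "(\<Sum>i<m. d i * t i) = (\<Sum>i<n+m. d' i * t i)"
    by (rule sum.mono_neutral_cong_left; simp add: d'_def)+
  have "x + y = (\<Sum>i<n+m. smul (c' i + d' i) (b i))"
    by (simp only: x y c' d' scale_left_distrib sum.distrib)
  moreover have "r + s = re_part (\<Sum>i<n+m. (c' i + d' i) * t i)"
    by (simp only: x y c' d' distrib_right sum.distrib re_part_add)
  ultimately show "(x + y, r + s) \<in> bounded_pairing b t"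
    unfolding bounded_pairing_def by (intro CollectI exI[of _ "n + m"] exI[of _ "\<lambda>i. c' i + d' i"]) simp
next
  fix u :: real and x r assume "0 < u \<and> (x, r) \<in> bounded_pairing b t"
  then obtain n c where
    x: "x = (\<Sum>i<n. smul (c i) (b i))" "r = re_part (\<Sum>i<n. c i * t i)"
    unfolding bounded_pairing_def by blast
  have "rscale u x = (\<Sum>i<n. smul (of_real u * c i) (b i))"
    by (simp add: x rscale_def scale_sum_right)
  moreover have "u * r = re_part (\<Sum>i<n. (of_real u * c i) * t i)"
    by (simp add: x mult.assoc flip: sum_distrib_left re_part_of_real_mult)
  ultimately show "(rscale u x, u * r) \<in> bounded_pairing b t"
    unfolding bounded_pairing_def by (intro CollectI exI[of _ n] exI[of _ "\<lambda>i. of_real u * c i"]) simp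
qed

text \<open>Applying the demands to \<open>d\<close> and to \<open>- d\<close> turns them into
  equalities, and \<open>d = 1\<close>, \<open>d = imag_unit\<close> recover the scalar value. One
  factor 2 of the bound comes from \<open>abs_re_part_le\<close>, the other from passing back from
  real parts to norms.\<close>

lemma ell1_interpolation:
  assumes p: "seminorm p" "dominates_ell1 p b" and t: "\<And>n. norm (t n) \<le> 1"
  obtains f where "f \<in> dual" "\<And>n. f (b n) = t n" "\<And>x. norm (f x) \<le> 4 * p x"
proof -
  have p2: "seminorm (\<lambda>x. 2 * p x)"
    by (rule seminorm_cmult[OF p(1)]) simp
  have "r \<le> 2 * p m" if "(m, r) \<in> bounded_pairing b t" for m r
  proof -
    obtain n c where m: "m = (\<Sum>i<n. smul (c i) (b i))" "r = re_part (\<Sum>i<n. c i * t i)"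
      using \<open>(m, r) \<in> bounded_pairing b t\<close> unfolding bounded_pairing_def by blast
    have "r \<le> 2 * norm (\<Sum>i<n. c i * t i)"
      using abs_re_part_le[of "\<Sum>i<n. c i * t i"] m(2) by linarith
    also have "\<dots> \<le> 2 * (\<Sum>i<n. norm (c i))"
      using t by (intro mult_left_mono sum_norm_le) (simp_all add: norm_mult mult_left_le)
    also have "\<dots> \<le> 2 * p m"
      using p(2) by (simp add: dominates_ell1_def m(1))
    finally show ?thesis .
  qed
  from dual_Mazur_Orlicz[OF p2 functional_cone_bounded_pairing this]
  obtain f where f: "f \<in> dual" "\<And>x. \<bar>re_part (f x)\<bar> \<le> 2 * p x"
    "\<And>m r. (m, r) \<in> bounded_pairing b t \<Longrightarrow> r \<le> re_part (f m)"
    by metis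
  have le: "re_part (d * t k) \<le> re_part (d * f (b k))" for d k
  proof -
    let ?c = "\<lambda>i. if i = k then d else 0"
    have "(\<Sum>i<Suc k. smul (?c i) (b i)) = smul d (b k)" "(\<Sum>i<Suc k. ?c i * t i) = d * t k"
      by (simp_all add: if_distrib if_distribR sum.delta cong: if_cong)
    then have "(smul d (b k), re_part (d * t k)) \<in> bounded_pairing b t"
      unfolding bounded_pairing_def by (intro CollectI exI[of _ "Suc k"] exI[of _ ?c]) simp
    from f(3)[OF this] show ?thesis
      by (simp add: dual_scale[OF f(1)])
  qed
  have eq: "re_part (d * t k) = re_part (d * f (b k))" for d k
    using le[of d k] le[of "- d" k] by (simp add: re_part_minus)
  have "f (b k) = t k" for k
    using scalar_decomposition[of "f (b k)"] scalar_decomposition[of "t k"] eq[of 1 k] eq[of imag_unit k]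
    by simp
  moreover have "norm (f x) \<le> 4 * p x" for x
    using norm_dual_le[OF f(1) p2 f(2), of x] by simp
  ultimately show thesis
    using that f(1) by blast
qed

text \<open>
  Countably many coefficients make this set separable without any closure argument, so the
  metrizability hypothesis applies to it.
\<close>

definition countable_hull :: "'k set \<Rightarrow> (nat \<Rightarrow> 'a) \<Rightarrow> 'a set" where
  "countable_hull Q b = (\<lambda>xs. sum_list (map (\<lambda>(c, i). smul c (b i)) xs)) `
     {xs \<in> lists (Q \<times> UNIV). sum_list (map (\<lambda>(c, i). norm c) xs) \<le> 1}"

lemma countable_countable_hull: "countable Q \<Longrightarrow> countable (countable_hull Q b)"
  unfolding countable_hull_def
  by (intro countable_image countable_subset[OF _ countable_lists[of "Q \<times> (UNIV :: nat set)"]]) auto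

lemma zero_in_countable_hull: "0 \<in> countable_hull Q b"
  unfolding countable_hull_def by (intro image_eqI[of _ _ "[]"]) auto

text \<open>The hull is formed once, for the whole sequence; the reindexing \<open>r\<close> locates
  the combinations of a later subsequence in it.\<close>

lemma sum_in_countable_hull:
  fixes n :: nat and r :: "nat \<Rightarrow> nat"
  assumes "\<And>i. i < n \<Longrightarrow> c i \<in> Q" "(\<Sum>i<n. norm (c i)) \<le> 1"
  shows "(\<Sum>i<n. smul (c i) (b (r i))) \<in> countable_hull Q b"
proof -
  let ?xs = "map (\<lambda>i. (c i, r i)) [0..<n]"
  have "(\<Sum>i<n. smul (c i) (b (r i))) = sum_list (map (\<lambda>(c, i). smul c (b i)) ?xs)"
    by (simp add: o_def interv_sum_list_conv_sum_set_nat atLeast0LessThan)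
  moreover have "sum_list (map (\<lambda>(c, i). norm c) ?xs) \<le> 1"
    using assms(2) by (simp add: o_def interv_sum_list_conv_sum_set_nat atLeast0LessThan)
  moreover have "?xs \<in> lists (Q \<times> UNIV)"
    using assms(1) by auto
  ultimately show ?thesis
    unfolding countable_hull_def by blast
qed

lemma bounded_in_countable_hull:
  assumes "bounded_in smul E (range b)"
  shows "bounded_in smul E (countable_hull Q b)"
  unfolding bounded_in_iff_seminorm
proof (intro allI impI)
  fix p assume p: "seminorm p"
  then obtain M where M: "\<And>n. p (b n) \<le> M"
    using assms bounded_in_iff_seminorm by (metis rangeI)
  then have "0 \<le> M"
    using seminorm_nonneg[OF p] order_trans by blast
  have le: "p (sum_list (map (\<lambda>(c, i). smul c (b i)) xs)) \<le> M * sum_list (map (\<lambda>(c, i). norm c) xs)"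
    for xs :: "('k \<times> nat) list"
  proof (induction xs)
    case (Cons x xs)
    obtain c i where x: "x = (c, i)" by (cases x)
    have "p (smul c (b i)) \<le> M * norm c"
      using mult_left_mono[OF M[of i], of "norm c"] by (simp add: seminorm_scale[OF p] mult.commute)
    then show ?case
      using Cons seminorm_triangle[OF p, of "smul c (b i)"] by (fastforce simp: x distrib_left intro: order_trans)
  qed (simp add: seminorm_zero[OF p])
  have "p x \<le> M" if x: "x \<in> countable_hull Q b" for x
  proof -
    obtain xs where xs: "x = sum_list (map (\<lambda>(c, i). smul c (b i)) xs)"
      "sum_list (map (\<lambda>(c, i). norm c) xs) \<le> (1 :: real)"
      using x unfolding countable_hull_def by auto
    show ?thesis
      using le[of xs] xs mult_left_mono[OF xs(2) \<open>0 \<le> M\<close>] by simp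
  qed
  then show "\<exists>M. \<forall>x\<in>countable_hull Q b. p x \<le> M" by blast
qed

text \<open>The metrizability hypothesis is exploited here: a countable bounded set is separable,
  hence first countable at 0.\<close>

lemma countable_neighbourhood_base_hull:
  assumes "separable_bounded_sets_metrizable smul E" "bounded_in smul E B" "countable B" "0 \<in> B"
  obtains V :: "nat \<Rightarrow> 'a set" where "\<And>j. openin (subtopology E B) (V j)" "\<And>j. 0 \<in> V j"
    "\<And>W. openin (subtopology E B) W \<Longrightarrow> 0 \<in> W \<Longrightarrow> \<exists>j. V j \<subseteq> W"
proof -
  have tB: "topspace (subtopology E B) = B"
    by (simp add: topspace_UNIV)
  have "separable_space (subtopology E B)"
    unfolding separable_space_def using assms(3) tB closure_of_topspace by (metis subset_refl)
  then have "first_countable (subtopology E B)"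
    using assms(1,2) metrizable_imp_first_countable by (auto simp: separable_bounded_sets_metrizable_def)
  then obtain \<B> where \<B>: "countable \<B>" "\<And>V. V \<in> \<B> \<Longrightarrow> openin (subtopology E B) V"
    "\<And>U. openin (subtopology E B) U \<Longrightarrow> 0 \<in> U \<Longrightarrow> \<exists>V\<in>\<B>. 0 \<in> V \<and> V \<subseteq> U"
    unfolding first_countable_def tB using assms(4) by meson
  define \<C> where "\<C> = {V\<in>\<B>. 0 \<in> V}"
  have "countable \<C>"
    using \<B>(1) by (simp add: \<C>_def)
  moreover have "\<C> \<noteq> {}"
    using \<B>(3)[of B] assms(4) openin_topspace[of "subtopology E B"] unfolding tB \<C>_def by blast
  ultimately obtain V :: "nat \<Rightarrow> 'a set" where V: "range V = \<C>"
    using uncountable_def by blast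
  have VC: "V j \<in> \<C>" for j
    using V by blast
  show thesis
  proof (rule that)
    show "openin (subtopology E B) (V j)" "0 \<in> V j" for j
      using VC[of j] \<B>(2) by (auto simp: \<C>_def)
    show "\<exists>j. V j \<subseteq> W" if W: "openin (subtopology E B) W" "0 \<in> W" for W
    proof -
      obtain V' where "V' \<in> \<C>" "V' \<subseteq> W"
        using \<B>(3)[OF W] by (auto simp: \<C>_def)
      then show ?thesis
        using V by blast
    qed
  qed
qed

text \<open>The estimate is known only for coefficients in \<open>Q\<close> with total modulus
  between 1/2 and 1. Scaling the total to 3/4, the middle of this range, leaves room for an
  approximation from \<open>Q\<close>; scaling back gives the bound for all coefficients.\<close>

lemma dominates_ell1_if_rational:
  assumes p: "seminorm p" and M: "\<And>n. p (b n) \<le> M"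
    and dense: "\<And>w e. 0 < e \<Longrightarrow> \<exists>q\<in>Q. norm (w - q) < e"
    and lower: "\<And>n c. (\<And>i. i < n \<Longrightarrow> c i \<in> Q) \<Longrightarrow> 1 / 2 \<le> (\<Sum>i<n. norm (c i)) \<Longrightarrow>
      (\<Sum>i<n. norm (c i)) \<le> 1 \<Longrightarrow> 1 \<le> p (\<Sum>i<n. smul (c i) (b i))"
  shows "dominates_ell1 (\<lambda>x. 2 * p x) b"
  unfolding dominates_ell1_def
proof (intro allI)
  fix n and c :: "nat \<Rightarrow> 'k"
  define S where "S = (\<Sum>i<n. norm (c i))"
  define M' where "M' = max 1 M"
  have M': "1 \<le> M'" "\<And>n. p (b n) \<le> M'"
    using M by (auto simp: M'_def intro: max.coboundedI2)
  show "(\<Sum>i<n. norm (c i)) \<le> 2 * p (\<Sum>i<n. smul (c i) (b i))"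
  proof (cases "S = 0")
    case True
    then show ?thesis
      using seminorm_nonneg[OF p] by (simp add: S_def)
  next
    case False
    then have S: "0 < S"
      using sum_nonneg[of "{..<n}" "\<lambda>i. norm (c i)"] by (simp add: S_def)
    define c' where "c' = (\<lambda>i. of_real (3 / 4 / S) * c i)"
    \<comment> \<open>Summed over \<open>n\<close> coefficients the error is at most
      \<open>1 / (4 * M')\<close>. It changes the total modulus by at most 1/4 because
      \<open>1 \<le> M'\<close>, and the value of \<open>p\<close> by at most 1/4 because
      \<open>p (b i) \<le> M'\<close>.\<close>
    define d where "d = 1 / (4 * M' * (real n + 1))"
    have d: "0 < d"
      using M'(1) by (simp add: d_def)
    have "\<exists>q. q \<in> Q \<and> norm (c' i - q) < d" for i
      using dense[OF d] by blast
    then obtain q where q: "\<And>i. q i \<in> Q" "\<And>i. norm (c' i - q i) < d"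
      by metis
    have sum_c': "(\<Sum>i<n. norm (c' i)) = 3 / 4"
    proof -
      have "(\<Sum>i<n. norm (c' i)) = 3 / 4 / S * (\<Sum>i<n. norm (c i))"
        unfolding sum_distrib_left c'_def norm_mult using S by (intro sum.cong) (simp_all add: norm_divide)
      then show ?thesis
        using S by (simp flip: S_def)
    qed
    have small: "(\<Sum>i<n. norm (c' i - q i)) \<le> 1 / (4 * M')"
    proof -
      have "(\<Sum>i<n. norm (c' i - q i)) \<le> (\<Sum>i<n. d)"
        by (intro sum_mono less_imp_le q)
      also have "\<dots> = real n * d" by simp
      also have "\<dots> \<le> (real n + 1) * d"
        using d by (simp add: distrib_right)
      also have "\<dots> = 1 / (4 * M')"
        using M'(1) by (simp add: d_def)
      finally show ?thesis .
    qed
    have "1 / (4 * M') \<le> 1 / 4"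
      using M'(1) by (simp add: field_simps)
    with small have small': "(\<Sum>i<n. norm (c' i - q i)) \<le> 1 / 4"
      by linarith
    have "(\<Sum>i<n. norm (q i)) \<le> (\<Sum>i<n. norm (c' i) + norm (c' i - q i))"
      by (intro sum_mono) (metis add.commute norm_minus_commute norm_triangle_sub)
    then have q_le: "(\<Sum>i<n. norm (q i)) \<le> 1"
      using small' sum_c' by (simp add: sum.distrib)
    have "(\<Sum>i<n. norm (c' i)) \<le> (\<Sum>i<n. norm (q i) + norm (c' i - q i))"
      by (intro sum_mono) (metis norm_triangle_sub)
    then have q_ge: "1 / 2 \<le> (\<Sum>i<n. norm (q i))"
      using small' sum_c' by (simp add: sum.distrib)
    have 1: "1 \<le> p (\<Sum>i<n. smul (q i) (b i))"
      by (rule lower) (use q q_le q_ge in auto)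
    have "p ((\<Sum>i<n. smul (q i) (b i)) - (\<Sum>i<n. smul (c' i) (b i))) \<le> (\<Sum>i<n. norm (c' i - q i) * M')"
    proof -
      have "(\<Sum>i<n. smul (q i) (b i)) - (\<Sum>i<n. smul (c' i) (b i)) = (\<Sum>i<n. smul (q i - c' i) (b i))"
        by (simp add: sum_subtractf scale_left_diff_distrib)
      also have "p \<dots> \<le> (\<Sum>i<n. p (smul (q i - c' i) (b i)))"
        by (rule seminorm_sum[OF p])
      also have "\<dots> \<le> (\<Sum>i<n. norm (c' i - q i) * M')"
        using M'(2) by (intro sum_mono) (simp add: seminorm_scale[OF p] norm_minus_commute mult_left_mono)
      finally show ?thesis .
    qed
    also have "\<dots> = (\<Sum>i<n. norm (c' i - q i)) * M'"
      by (simp add: sum_distrib_right)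
    also have "\<dots> \<le> 1 / (4 * M') * M'"
      using small M'(1) by (intro mult_right_mono) auto
    also have "\<dots> = 1 / 4"
      using M'(1) by simp
    finally have "3 / 4 \<le> p (\<Sum>i<n. smul (c' i) (b i))"
      using 1 seminorm_reverse_triangle[OF p, of "\<Sum>i<n. smul (q i) (b i)" "\<Sum>i<n. smul (c' i) (b i)"]
      by linarith
    moreover have "(\<Sum>i<n. smul (c' i) (b i)) = smul (of_real (3 / 4 / S)) (\<Sum>i<n. smul (c i) (b i))"
      by (simp add: c'_def scale_sum_right)
    moreover have "norm (of_real (3 / 4 / S) :: 'k) = 3 / 4 / S"
      unfolding norm_of_real using S by simp
    ultimately have "3 / 4 \<le> 3 / 4 / S * p (\<Sum>i<n. smul (c i) (b i))"
      by (simp only: seminorm_scale[OF p])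
    then have "S \<le> p (\<Sum>i<n. smul (c i) (b i))"
      using S by (simp add: field_simps)
    then show ?thesis
      using S by (simp flip: S_def)
  qed
qed

text \<open>With the signs of \<open>exists_signs\<close>, take \<open>f\<close> near
  \<open>w1\<close> on \<open>P\<close> and near \<open>w2\<close> off \<open>P\<close>, and
  \<open>g\<close> the other way round. Then \<open>f - g\<close> is \<open>w1 - w2\<close> up to
  sign at each \<open>y i\<close>, with error at most \<open>D / 8\<close>. Hence
  \<open>D * S / 4\<close> is at most the two small values \<open>D / 64\<close> plus
  \<open>S * D / 8\<close>, so \<open>S \<le> 1 / 4\<close>.\<close>

lemma independent_functionals_lower_bound:
  fixes y :: "nat \<Rightarrow> 'a"
  assumes K: "K \<subseteq> dual" and small: "\<And>f. f \<in> K \<Longrightarrow> norm (f (\<Sum>i<n. smul (c i) (y i))) \<le> norm (w1 - w2) / 64"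
    and indep: "\<And>P. \<exists>f\<in>K. \<forall>i<n. norm (f (y i) - (if i \<in> P then w1 else w2)) \<le> norm (w1 - w2) / 16"
    and w: "w1 \<noteq> w2"
  shows "(\<Sum>i<n. norm (c i)) < 1 / 2"
proof -
  define D where "D = norm (w1 - w2)"
  have D: "0 < D"
    using w by (simp add: D_def)
  define x where "x = (\<Sum>i<n. smul (c i) (y i))"
  define S where "S = (\<Sum>i<n. norm (c i))"
  obtain P where P: "S \<le> 4 * norm (\<Sum>i<n. if i \<in> P then c i else - c i)"
    using exists_signs[of c n] by (auto simp: S_def)
  obtain f where f: "f \<in> K" "\<And>i. i < n \<Longrightarrow> norm (f (y i) - (if i \<in> P then w1 else w2)) \<le> D / 16"
    using indep[of P] by (auto simp: D_def)
  have swap: "(if i \<in> - P then w1 else w2) = (if i \<in> P then w2 else w1)" for i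
    by simp
  have "\<exists>g\<in>K. \<forall>i<n. norm (g (y i) - (if i \<in> P then w2 else w1)) \<le> D / 16"
    using indep[of "- P"] unfolding swap D_def .
  then obtain g where g: "g \<in> K" "\<And>i. i < n \<Longrightarrow> norm (g (y i) - (if i \<in> P then w2 else w1)) \<le> D / 16"
    by auto
  define err where "err = (\<lambda>i. f (y i) - g (y i) - (if i \<in> P then w1 - w2 else w2 - w1))"
  have err: "norm (err i) \<le> D / 8" if "i < n" for i
  proof -
    have "err i = (f (y i) - (if i \<in> P then w1 else w2)) - (g (y i) - (if i \<in> P then w2 else w1))"
      by (simp add: err_def)
    then show ?thesis
      using norm_triangle_ineq4[of "f (y i) - (if i \<in> P then w1 else w2)" "g (y i) - (if i \<in> P then w2 else w1)"]
        f(2)[OF that] g(2)[OF that] by simp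
  qed
  have fx: "f x = (\<Sum>i<n. c i * f (y i))" "g x = (\<Sum>i<n. c i * g (y i))"
    using f(1) g(1) K by (auto simp: x_def dual_sum dual_scale subset_iff)
  have "c i * f (y i) - c i * g (y i) = (w1 - w2) * (if i \<in> P then c i else - c i) + c i * err i" for i
    by (simp add: err_def algebra_simps)
  then have "f x - g x = (\<Sum>i<n. (w1 - w2) * (if i \<in> P then c i else - c i) + c i * err i)"
    by (simp add: fx flip: sum_subtractf)
  also have "\<dots> = (w1 - w2) * (\<Sum>i<n. if i \<in> P then c i else - c i) + (\<Sum>i<n. c i * err i)"
    by (simp only: sum.distrib sum_distrib_left)
  finally have eq: "f x - g x = (w1 - w2) * (\<Sum>i<n. if i \<in> P then c i else - c i) + (\<Sum>i<n. c i * err i)" .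
  have "norm (\<Sum>i<n. c i * err i) \<le> (\<Sum>i<n. norm (c i) * (D / 8))"
    using err by (intro sum_norm_le) (simp add: norm_mult mult_left_mono del: times_divide_eq_right)
  also have "\<dots> = S * (D / 8)"
    by (simp only: S_def sum_distrib_right)
  finally have e: "norm (\<Sum>i<n. c i * err i) \<le> S * (D / 8)" .
  have "D * (S / 4) \<le> norm ((w1 - w2) * (\<Sum>i<n. if i \<in> P then c i else - c i))"
    unfolding norm_mult D_def[symmetric] using P D by (intro mult_left_mono) auto
  also have "\<dots> \<le> norm (f x - g x) + norm (\<Sum>i<n. c i * err i)"
    using norm_triangle_ineq4[of "f x - g x" "\<Sum>i<n. c i * err i"] unfolding eq add_diff_cancel_right' .
  also have "norm (f x - g x) \<le> norm (f x) + norm (g x)"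
    by (rule norm_triangle_ineq4)
  finally have "D * (S / 4) \<le> D / 64 + D / 64 + S * (D / 8)"
    using small[OF f(1)] small[OF g(1)] e by (simp add: x_def D_def)
  then have "D * S \<le> D * (1 / 4)"
    by (simp add: algebra_simps)
  then have "S \<le> 1 / 4"
    using D by simp
  then show ?thesis
    by (simp add: S_def)
qed

end

text \<open>The Weierstrass M-test: a partial sum is continuous, and the tails are uniformly
  small.\<close>

lemma continuous_map_suminf_geometric:
  fixes w :: "nat \<Rightarrow> 'a \<Rightarrow> real"
  assumes cont: "\<And>j. continuous_map X euclideanreal (w j)"
    and bnd: "\<And>j x. 0 \<le> w j x" "\<And>j x. w j x \<le> (1 / 2) ^ j"
  shows "continuous_map X euclideanreal (\<lambda>x. \<Sum>j. w j x)"
proof (rule continuous_map_metricI)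
  have geo: "summable (\<lambda>j. (1 / 2 :: real) ^ (j + n))" for n
    by (simp add: summable_geometric summable_iff_shift)
  have summable: "summable (\<lambda>j. w j x)" for x
    by (rule summable_comparison_test'[OF geo[of 0], of 0]) (use bnd in simp)
  have shift: "summable (\<lambda>j. w (j + n) x)" for n x
    by (rule summable_ignore_initial_segment[OF summable])
  have geo_sum: "(\<Sum>j. (1 / 2 :: real) ^ (j + n)) = 2 * (1 / 2) ^ n" for n
    by (simp add: power_add suminf_mult2[symmetric] summable_geometric suminf_geometric)
  have tail: "0 \<le> (\<Sum>j. w (j + n) x)" "(\<Sum>j. w (j + n) x) \<le> 2 * (1 / 2) ^ n" for n x
  proof -
    show "0 \<le> (\<Sum>j. w (j + n) x)"
      using shift bnd(1) by (intro suminf_nonneg)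
    have "(\<Sum>j. w (j + n) x) \<le> (\<Sum>j. (1 / 2) ^ (j + n))"
      by (intro suminf_le shift geo bnd(2))
    then show "(\<Sum>j. w (j + n) x) \<le> 2 * (1 / 2) ^ n"
      by (simp only: geo_sum)
  qed
  fix x and e :: real assume x: "x \<in> topspace X" and e: "0 < e"
  have "(\<lambda>n. 2 * (1 / 2 :: real) ^ n) \<longlonglongrightarrow> 2 * 0"
    by (intro tendsto_intros LIMSEQ_power_zero) simp
  then have "\<forall>\<^sub>F n in sequentially. 2 * (1 / 2 :: real) ^ n < e / 2"
    by (rule order_tendstoD(2)) (use e in simp)
  then obtain n where n: "2 * (1 / 2 :: real) ^ n < e / 2"
    by (auto simp: eventually_sequentially)
  have "continuous_map X euclideanreal (\<lambda>x. \<Sum>j<n. w j x)"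
    by (intro continuous_map_sum cont) simp
  then have "openin X {y \<in> topspace X. (\<Sum>j<n. w j y) \<in> ball (\<Sum>j<n. w j x) (e / 2)}"
    by (rule openin_continuous_map_preimage) simp
  moreover have "dist (\<Sum>j. w j y) (\<Sum>j. w j x) < e"
    if y: "y \<in> {y \<in> topspace X. (\<Sum>j<n. w j y) \<in> ball (\<Sum>j<n. w j x) (e / 2)}" for y
  proof -
    have split: "(\<Sum>j. w j z) = (\<Sum>j. w (j + n) z) + (\<Sum>j<n. w j z)" for z
      by (rule suminf_split_initial_segment[OF summable])
    have "\<bar>(\<Sum>j<n. w j x) - (\<Sum>j<n. w j y)\<bar> < e / 2"
      using y by (simp add: dist_real_def)
    then show ?thesis
      using split[of x] split[of y] tail[of n x] tail[of n y] n unfolding dist_real_def by linarith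
  qed
  moreover have "x \<in> {y \<in> topspace X. (\<Sum>j<n. w j y) \<in> ball (\<Sum>j<n. w j x) (e / 2)}"
    using x e by simp
  ultimately show "\<exists>U. openin X U \<and> x \<in> U \<and> (\<forall>y\<in>U. dist (\<Sum>j. w j y) (\<Sum>j. w j x) < e)"
    by blast
qed

text \<open>Along a subsequence on which \<open>g\<close> grows by at least 1 at each step, the
  values of \<open>g\<close> form a closed discrete set of reals. A function on the terms becomes a
  function of these values, is extended to the line by Tietze's theorem and pulled back along
  \<open>g\<close>.\<close>

lemma discrete_C_embedded_subsequence:
  assumes g: "continuous_map X euclideanreal g" and a: "\<And>n. a n \<in> topspace X"
    and large: "\<And>n. real n \<le> g (a n)"
  obtains r :: "nat \<Rightarrow> nat" where "strict_mono r" "discrete_subset X (range (a \<circ> r))"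
    "C_embedded X (range (a \<circ> r))"
proof -
  have "\<exists>m>k. g (a k) + 1 \<le> g (a m)" for k
  proof -
    obtain m where "g (a k) + 1 < real m"
      using reals_Archimedean2 by blast
    then have "g (a k) + 1 \<le> g (a (max m (Suc k)))"
      using large[of "max m (Suc k)"] by linarith
    then show ?thesis
      by (intro exI[of _ "max m (Suc k)"]) simp
  qed
  then obtain h where h: "\<And>k. k < h k" "\<And>k. g (a k) + 1 \<le> g (a (h k))"
    by metis
  define r where "r = rec_nat 0 (\<lambda>_. h)"
  have r_Suc: "r (Suc n) = h (r n)" for n
    by (simp add: r_def)
  have r: "strict_mono r"
    unfolding strict_mono_Suc_iff by (simp add: r_Suc h)
  define s where "s = (\<lambda>n. g (a (r n)))"
  have step: "s n + 1 \<le> s (Suc n)" for n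
    using h(2)[of "r n"] by (simp add: s_def r_Suc)
  have mono: "s m + 1 \<le> s n" if mn: "m < n" for m n
  proof -
    obtain n' where n': "n = Suc n'" "m \<le> n'"
      using mn by (metis Suc_leI Suc_le_D Suc_le_mono)
    have "s m \<le> s n'"
      using step by (intro lift_Suc_mono_le[OF _ n'(2)]) (smt (verit))
    then show ?thesis
      using step[of n'] by (simp add: n'(1))
  qed
  have gap: "m = n" if "\<bar>s m - s n\<bar> < 1" for m n
    using mono[of m n] mono[of n m] that by (cases m n rule: linorder_cases) auto
  define A where "A = range (a \<circ> r)"
  have AX: "A \<subseteq> topspace X"
    using a by (auto simp: A_def)
  have "subtopology X A = discrete_topology A"
  proof (rule sym, subst discrete_topology_unique, intro conjI ballI)
    show "topspace (subtopology X A) = A"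
      using AX by auto
    fix x assume "x \<in> A"
    then obtain n where n: "x = a (r n)"
      by (auto simp: A_def)
    have "openin X {y \<in> topspace X. g y \<in> ball (s n) 1}"
      by (rule openin_continuous_map_preimage[OF g]) simp
    moreover have "{x} = {y \<in> topspace X. g y \<in> ball (s n) 1} \<inter> A"
    proof (intro equalityI subsetI)
      fix y assume y: "y \<in> {y \<in> topspace X. g y \<in> ball (s n) 1} \<inter> A"
      then obtain m where m: "y = a (r m)"
        by (auto simp: A_def)
      then have "\<bar>s n - s m\<bar> < 1"
        using y by (simp add: s_def dist_real_def)
      then show "y \<in> {x}"
        using gap m n by auto
    qed (use n AX in \<open>auto simp: A_def s_def\<close>)
    ultimately show "openin (subtopology X A) {x}"
      unfolding openin_subtopology by blast
  qed
  then have "discrete_subset X A"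
    using AX by (simp add: discrete_subset_def)
  moreover have "C_embedded X A"
    unfolding C_embedded_def
  proof (intro conjI allI impI AX)
    fix f assume "continuous_map (subtopology X A) euclideanreal f"
    define F where "F = (\<lambda>y. f (a (r (inv s y))))"
    have "inj s"
      using gap by (intro injI) simp
    then have F: "F (s n) = f (a (r n))" for n
      by (simp add: F_def)
    have sep: "y = x" if "x \<in> range s" "y \<in> range s" "dist y x < 1" for x y
      using that gap by (auto simp: dist_real_def)
    have "continuous_on (range s) F"
      unfolding continuous_on_iff using sep by (metis dist_self zero_less_one)
    moreover have "closedin (top_of_set UNIV) (range s)"
    proof -
      have "\<forall>x\<in>range s. \<forall>y\<in>range s. dist y x < 1 \<longrightarrow> y = x"
        using sep by metis
      then have "closed (range s)"
        by (rule discrete_imp_closed[OF zero_less_one])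
      then show ?thesis by simp
    qed
    ultimately obtain G where G: "continuous_on UNIV G" "\<And>y. y \<in> range s \<Longrightarrow> G y = F y"
      by (rule Tietze_unbounded) auto
    have "continuous_map X euclideanreal (G \<circ> g)"
      using G(1) by (intro continuous_map_compose[OF g]) simp
    moreover have "(G \<circ> g) x = f x" if xA: "x \<in> A" for x
    proof -
      obtain n where "x = a (r n)"
        using xA by (auto simp: A_def)
      then show ?thesis
        using G(2)[of "s n"] F by (simp add: s_def)
    qed
    ultimately show "\<exists>g. continuous_map X euclideanreal g \<and> (\<forall>x\<in>A. g x = f x)"
      by blast
  qed
  ultimately show thesis
    using that r by (simp add: A_def)
qed

context locally_convex_space
begin

text \<open>
  Either the sets \<open>K j w1 w2\<close> of functionals are nowhere rich, and then a diagonal subsequence is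
  weakly Cauchy because every \<open>f\<close> in the dual belongs to some of them for each pair of discs; or one
  of them carries an independent sequence of pairs of discs, which forces a lower \<open>\<ell>\<^sub>1\<close>-bound.
\<close>

theorem Rosenthal_dichotomy:
  assumes sbm: "separable_bounded_sets_metrizable smul E" and b: "bounded_in smul E (range b)"
  shows "(\<exists>r. strict_mono (r :: nat \<Rightarrow> nat) \<and> (\<forall>f\<in>dual. convergent (\<lambda>n. f (b (r n))))) \<or>
    (\<exists>r p. strict_mono (r :: nat \<Rightarrow> nat) \<and> seminorm p \<and> dominates_ell1 p (b \<circ> r))"
proof -
  obtain Q :: "'k set" where Q: "countable Q" "0 \<in> Q" "\<And>z e. 0 < e \<Longrightarrow> \<exists>q\<in>Q. norm (z - q) < e"
    using countable_dense_scalars by metis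
  define B where "B = countable_hull Q b"
  obtain V :: "nat \<Rightarrow> 'a set" where V: "\<And>j. openin (subtopology E B) (V j)" "\<And>j. 0 \<in> V j"
    "\<And>W. openin (subtopology E B) W \<Longrightarrow> 0 \<in> W \<Longrightarrow> \<exists>j. V j \<subseteq> W"
    using countable_neighbourhood_base_hull[OF sbm bounded_in_countable_hull[OF b]
        countable_countable_hull[OF Q(1)] zero_in_countable_hull] unfolding B_def by metis
  \<comment> \<open>The fraction 1/16 here and 1/64 in \<open>K\<close> are those of
    \<open>independent_functionals_lower_bound\<close>, which then contradicts a coefficient sum of
    at least 1/2.\<close>
  define near where "near = (\<lambda>w v n. {f :: 'a \<Rightarrow> 'k. norm (f (b n) - w) \<le> norm (w - v) / 16})"
  define K where "K = (\<lambda>j w1 w2. {f \<in> dual. \<forall>x\<in>V j. norm (f x) \<le> norm (w1 - w2 :: 'k) / 64})"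
  show ?thesis
  proof (cases "\<exists>j w1 w2 M. w1 \<noteq> w2 \<and> infinite M \<and>
      rich (near w1 w2) (near w2 w1) (K j w1 w2) M")
    case True
    then obtain j w1 w2 M where w: "w1 \<noteq> w2" and rich: "infinite M"
      "rich (near w1 w2) (near w2 w1) (K j w1 w2) M"
      by blast
    obtain r :: "nat \<Rightarrow> nat" where r: "strict_mono r" and
      indep: "\<And>n P. \<exists>h\<in>K j w1 w2. \<forall>i<n. h \<in> (if i \<in> P then near w1 w2 (r i)
        else near w2 w1 (r i))"
      using rich_imp_independent[OF rich] by metis
    obtain T where T: "openin E T" "V j = T \<inter> B"
      using V(1)[of j] by (auto simp: openin_subtopology)
    then obtain p where p: "seminorm p" "{x. p x < 1} \<subseteq> T"
      using openin_contains_seminorm_ball[of T] V(2)[of j] by blast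
    obtain M where M: "\<And>n. p (b n) \<le> M"
      using b p(1) bounded_in_iff_seminorm by (metis rangeI)
    have "dominates_ell1 (\<lambda>x. 2 * p x) (b \<circ> r)"
    proof (rule dominates_ell1_if_rational[OF p(1) _ Q(3)])
      show "p ((b \<circ> r) n) \<le> M" for n
        using M by simp
      fix n and c :: "nat \<Rightarrow> 'k"
      assume c: "\<And>i. i < n \<Longrightarrow> c i \<in> Q" "1 / 2 \<le> (\<Sum>i<n. norm (c i))" "(\<Sum>i<n. norm (c i)) \<le> 1"
      show "1 \<le> p (\<Sum>i<n. smul (c i) ((b \<circ> r) i))"
      proof (rule ccontr)
        assume "\<not> ?thesis"
        \<comment> \<open>A value of \<open>p\<close> below 1 puts the combination into
          \<open>T\<close>, and its coefficients put it into the hull \<open>B\<close>; on the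
          intersection all functionals of \<open>K j w1 w2\<close> are small.\<close>
        then have "(\<Sum>i<n. smul (c i) (b (r i))) \<in> V j"
          using p(2) sum_in_countable_hull[OF c(1,3)] unfolding T(2) B_def by auto
        then have small: "norm (f (\<Sum>i<n. smul (c i) (b (r i)))) \<le> norm (w1 - w2) / 64" if "f \<in> K j w1 w2" for f
          using that by (simp add: K_def)
        have indep': "\<exists>f\<in>K j w1 w2. \<forall>i<n. norm (f (b (r i)) - (if i \<in> P then w1 else w2)) \<le> norm (w1 - w2) / 16" for P
        proof -
          obtain f where f: "f \<in> K j w1 w2" "\<forall>i<n. f \<in> (if i \<in> P then near w1 w2 (r i)
              else near w2 w1 (r i))"
            using indep by blast
          have "norm (f (b (r i)) - (if i \<in> P then w1 else w2)) \<le> norm (w1 - w2) / 16" if i: "i < n" for i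
            using f(2)[rule_format, OF i] by (cases "i \<in> P") (simp_all add: near_def norm_minus_commute[of w2 w1])
          then show ?thesis
            using f(1) by blast
        qed
        have "K j w1 w2 \<subseteq> dual"
          by (auto simp: K_def)
        then have "(\<Sum>i<n. norm (c i)) < 1 / 2"
          by (rule independent_functionals_lower_bound[where y = "\<lambda>i. b (r i)"]) (fact small indep' w)+
        then show False
          using c(2) by linarith
      qed
    qed
    moreover have "seminorm (\<lambda>x. 2 * p x)"
      by (rule seminorm_cmult[OF p(1)]) simp
    ultimately show ?thesis
      using r by blast
  next
    case False
    define I where "I = (UNIV :: nat set) \<times> Q \<times> Q"
    have I: "countable I" "I \<noteq> {}"
      using Q(1,2) by (auto simp: I_def)
    define idx where "idx = from_nat_into I"
    \<comment> \<open>Centres in \<open>Q\<close> keep the list of requirements countable, and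
      \<open>nonconvergent_two_clusters\<close> finds its discs among them. Equal centres carry no
      requirement.\<close>
    define quiet where "quiet = (\<lambda>k (m::nat) M. case idx k of (j, w1, w2) \<Rightarrow>
      w1 \<noteq> w2 \<longrightarrow> (\<forall>f\<in>K j w1 w2. \<not> oscillates (near w1 w2) (near w2 w1) M f))"
    have "\<exists>M'\<subseteq>M. infinite M' \<and> quiet k m M'" if M: "infinite M" for k m M
    proof -
      obtain j w1 w2 where ij: "idx k = (j, w1, w2)"
        by (cases "idx k")
      show ?thesis
      proof (cases "w1 = w2")
        case True
        then show ?thesis
          using M by (intro exI[of _ M]) (simp add: quiet_def ij)
      next
        case neq: False
        with False M have "\<not> rich (near w1 w2) (near w2 w1) (K j w1 w2) M"
          by blast
        then show ?thesis
          unfolding rich_def by (auto simp: quiet_def ij)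
      qed
    qed
    then have "\<exists>(ms :: nat \<Rightarrow> nat) Ms. strict_mono ms \<and> (\<forall>k. ms k \<in> UNIV \<and> infinite (Ms k) \<and> Ms k \<subseteq> UNIV \<and>
        quiet k (ms k) (Ms k)) \<and> (\<forall>k l. k < l \<longrightarrow> ms l \<in> Ms k)"
      by (intro fusion) simp_all
    then obtain ms :: "nat \<Rightarrow> nat" and Ms where ms: "strict_mono ms"
      and quiet: "\<And>k. quiet k (ms k) (Ms k)" and mem: "\<And>k l. k < l \<Longrightarrow> ms l \<in> Ms k"
      by auto
    have "convergent (\<lambda>n. f (b (ms n)))" if f: "f \<in> dual" for f
    proof (rule ccontr)
      assume nonconv: "\<not> convergent (\<lambda>n. f (b (ms n)))"
      obtain q where q: "seminorm q" "\<And>x. norm (f x) \<le> q x"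
        using dual_dominated[OF f] by blast
      obtain C where C: "\<And>n. q (b n) \<le> C"
        using b q(1) bounded_in_iff_seminorm by (metis rangeI)
      have "norm (f (b (ms n))) \<le> C" for n
        using q(2) C order_trans by blast
      from nonconvergent_two_clusters[OF this nonconv Q(3)]
      obtain w1 w2 where w: "w1 \<in> Q" "w2 \<in> Q" "w1 \<noteq> w2"
        "infinite {n. norm (f (b (ms n)) - w1) \<le> norm (w1 - w2) / 16}"
        "infinite {n. norm (f (b (ms n)) - w2) \<le> norm (w1 - w2) / 16}"
        by blast
      define W where "W = {x \<in> topspace (subtopology E B). f x \<in> ball 0 (norm (w1 - w2) / 64)}"
      have "openin (subtopology E B) W"
        unfolding W_def using f
        by (intro openin_continuous_map_preimage[of _ euclidean] continuous_map_from_subtopology)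
          (simp_all add: continuous_dual_def)
      moreover have "0 \<in> W"
        using w(3) zero_in_countable_hull[of Q b] by (simp add: W_def topspace_UNIV dual_zero[OF f] B_def)
      ultimately obtain j where "V j \<subseteq> W"
        using V(3) by blast
      then have fK: "f \<in> K j w1 w2"
        using f by (auto simp: K_def W_def)
      have "(j, w1, w2) \<in> I"
        using w by (simp add: I_def)
      then obtain k where k: "idx k = (j, w1, w2)"
        unfolding idx_def using I by (metis from_nat_into_surj)
      have inf: "infinite {n \<in> range ms. f \<in> near w v n}"
        if inf': "infinite {n. norm (f (b (ms n)) - w) \<le> norm (w - v) / 16}" for w v
      proof -
        have "{n \<in> range ms. f \<in> near w v n} = ms ` {n. norm (f (b (ms n)) - w) \<le> norm (w - v) / 16}"
          by (auto simp: near_def)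
        moreover have "inj ms"
          using ms by (rule strict_mono_imp_inj_on)
        ultimately show ?thesis
          using inf' by (simp add: finite_image_iff inj_on_subset)
      qed
      have "oscillates (near w1 w2) (near w2 w1) (range ms) f"
        unfolding oscillates_def
        using inf[OF w(4)] inf[of w2 w1] w(5) by (simp add: norm_minus_commute[of w2 w1])
      moreover have "finite (range ms - Ms k)"
      proof (rule finite_subset)
        show "range ms - Ms k \<subseteq> ms ` {..k}"
        proof
          fix n assume "n \<in> range ms - Ms k"
          then obtain l where l: "n = ms l" "ms l \<notin> Ms k" by blast
          then have "\<not> k < l" using mem by blast
          then show "n \<in> ms ` {..k}" using l(1) by simp
        qed
      qed simp
      ultimately have "oscillates (near w1 w2) (near w2 w1) (Ms k) f"
        by (rule oscillates_almost_mono)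
      then show False
        using quiet[of k] w(3) fK by (simp add: quiet_def k)
    qed
    then show ?thesis
      using ms by blast
  qed
qed

text \<open>Consecutive differences of a weakly Cauchy sequence converge weakly to 0, hence also in
  \<open>E\<close> by the Schur property, but separation keeps them away from 0. This excludes the
  first alternative of the dichotomy.\<close>

lemma Schur_separated_subsequence:
  assumes "Schur_property smul E" "separable_bounded_sets_metrizable smul E"
    and b: "bounded_in smul E (range b)" and p0: "seminorm p0" "0 < e" and sep: "\<And>m n. m < n \<Longrightarrow> e \<le> p0 (b n - b m)"
  obtains r p where "strict_mono (r :: nat \<Rightarrow> nat)" "seminorm p" "dominates_ell1 p (b \<circ> r)"
proof -
  have False if r: "strict_mono (r :: nat \<Rightarrow> nat)" "\<forall>f\<in>dual. convergent (\<lambda>n. f (b (r n)))" for r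
  proof -
    define d where "d = (\<lambda>n. b (r (Suc n)) - b (r n))"
    have "limitin weak d 0 sequentially"
      unfolding limitin_weak_iff
    proof
      fix f assume f: "f \<in> dual"
      then obtain l where l: "(\<lambda>n. f (b (r n))) \<longlonglongrightarrow> l"
        using r(2) by (auto simp: convergent_def)
      have "(\<lambda>n. f (b (r (Suc n))) - f (b (r n))) \<longlonglongrightarrow> l - l"
        by (intro tendsto_diff l LIMSEQ_Suc[OF l])
      then show "(\<lambda>n. f (d n)) \<longlonglongrightarrow> f 0"
        by (simp add: d_def dual_diff[OF f] dual_zero[OF f])
    qed
    then have "limitin E d 0 sequentially"
      using assms(1) by (simp add: Schur_property_def)
    then have "(\<lambda>n. p0 (d n - 0)) \<longlonglongrightarrow> 0"
      using p0(1) limitin_iff_seminorm by blast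
    moreover have "e \<le> p0 (d n - 0)" for n
      using sep[of "r n" "r (Suc n)"] r(1) by (simp add: d_def strict_mono_Suc_iff)
    ultimately have "e \<le> 0"
      by (intro LIMSEQ_le_const) auto
    then show False
      using p0(2) by simp
  qed
  then show thesis
    using Rosenthal_dichotomy[OF assms(2) b] that by blast
qed

text \<open>
  The functionals \<open>\<phi> j\<close> have the values \<open>1\<close> at \<open>b n\<close> for \<open>n \<ge> j\<close> and \<open>0\<close> otherwise, and \<open>h\<close> is a
  Banach limit of them. No point can satisfy \<open>\<phi> j x = 1\<close> for all \<open>j\<close> and \<open>h x = 0\<close>, but \<open>b n\<close>
  nearly does for large \<open>n\<close>.
\<close>

lemma unbounded_weakly_continuous_function:
  assumes p: "seminorm p" "dominates_ell1 p b"
  obtains g where "continuous_map weak euclideanreal g" "\<And>n. real n \<le> g (b n)"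
proof -
  have "\<exists>f. f \<in> dual \<and> (\<forall>n. f (b n) = (if j \<le> n then 1 else 0)) \<and> (\<forall>x. norm (f x) \<le> 4 * p x)" for j :: nat
  proof -
    have "norm (if j \<le> n then 1 else 0 :: 'k) \<le> 1" for n
      by simp
    then show ?thesis
      by (rule ell1_interpolation[OF p, of "\<lambda>n. if j \<le> n then 1 else 0"]) blast
  qed
  from choice[OF allI, OF this]
  obtain \<phi> where "\<forall>j. \<phi> j \<in> dual \<and> (\<forall>n. \<phi> j (b n) = (if j \<le> n then 1 else 0)) \<and> (\<forall>x. norm (\<phi> j x) \<le> 4 * p x)" ..
  then have \<phi>: "\<And>j. \<phi> j \<in> dual" "\<And>j n. \<phi> j (b n) = (if j \<le> n then 1 else 0)"
    "\<And>j x. norm (\<phi> j x) \<le> 4 * p x"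
    by blast+
  \<comment> \<open>Demanding every eventual lower bound as a lower bound for \<open>h\<close>
    places the real part of \<open>h x\<close> above the limit inferior of the real parts of
    \<open>\<phi> j x\<close> and, applied to \<open>- x\<close>, below their limit
    superior.\<close>
  define M where "M = {(x, r). \<forall>\<^sub>F j in sequentially. r \<le> re_part (\<phi> j x)}"
  have cone: "functional_cone rscale M"
    unfolding functional_cone_def
  proof (intro conjI allI impI)
    show "(0, 0) \<in> M"
      by (simp add: M_def dual_zero[OF \<phi>(1)])
    show "(x + y, r + s) \<in> M" if "(x, r) \<in> M \<and> (y, s) \<in> M" for x r y s
    proof -
      have "\<forall>\<^sub>F j in sequentially. r \<le> re_part (\<phi> j x) \<and> s \<le> re_part (\<phi> j y)"
        using that by (simp add: M_def eventually_conj)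
      then have "\<forall>\<^sub>F j in sequentially. r + s \<le> re_part (\<phi> j (x + y))"
        by (rule eventually_mono) (simp add: dual_add[OF \<phi>(1)] re_part_add add_mono)
      then show ?thesis by (simp add: M_def)
    qed
    show "(rscale t x, t * r) \<in> M" if t: "0 < t \<and> (x, r) \<in> M" for t x r
    proof -
      have "\<forall>\<^sub>F j in sequentially. r \<le> re_part (\<phi> j x)"
        using t by (simp add: M_def)
      then have "\<forall>\<^sub>F j in sequentially. t * r \<le> re_part (\<phi> j (rscale t x))"
        by (rule eventually_mono)
          (use t in \<open>simp add: rscale_def dual_scale[OF \<phi>(1)] re_part_of_real_mult\<close>)
      then show ?thesis by (simp add: M_def)
    qed
  qed
  have dom: "r \<le> 8 * p x" if "(x, r) \<in> M" for x r
  proof -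
    have "\<forall>\<^sub>F j in sequentially. r \<le> re_part (\<phi> j x)"
      using that by (simp add: M_def)
    then obtain j where "r \<le> re_part (\<phi> j x)"
      by (auto simp: eventually_sequentially)
    then show ?thesis
      using abs_re_part_le[of "\<phi> j x"] \<phi>(3)[of j x] by linarith
  qed
  have "seminorm (\<lambda>x. 8 * p x)"
    by (rule seminorm_cmult[OF p(1)]) simp
  from dual_Mazur_Orlicz[OF this cone dom]
  obtain h where h: "h \<in> dual" "\<And>x r. (x, r) \<in> M \<Longrightarrow> r \<le> re_part (h x)"
    by metis
  have h_b: "re_part (h (b n)) = 0" for n
  proof -
    have "\<phi> j (b n) = 0" if "Suc n \<le> j" for j
      using that by (simp add: \<phi>(2))
    then have "\<forall>\<^sub>F j in sequentially. \<phi> j (b n) = 0"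
      unfolding eventually_sequentially by blast
    then have "(b n, 0) \<in> M" "(- b n, 0) \<in> M"
      by (auto simp: M_def dual_minus[OF \<phi>(1)] elim: eventually_mono)
    then show ?thesis
      using h(2)[of "b n" 0] h(2)[of "- b n" 0] by (simp add: dual_minus[OF h(1)] re_part_minus)
  qed
  \<comment> \<open>Truncation at 1 and the weights give geometric bounds, so the sum is weakly
    continuous although the \<open>\<phi> j\<close> are unbounded; a zero of the sum still forces
    real part 1 of \<open>\<phi> j x\<close> for every \<open>j\<close>.\<close>
  define w where "w = (\<lambda>j x. (1 / 2) ^ j * min 1 \<bar>re_part (\<phi> j x) - 1\<bar>)"
  have w_cont: "continuous_map weak euclideanreal (w j)" for j
    unfolding w_def
    by (intro continuous_map_real_mult continuous_map_real_min continuous_map_real_abs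
        continuous_map_diff continuous_map_weak_re_part \<phi>(1)) simp_all
  have w_bnd: "0 \<le> w j x" "w j x \<le> (1 / 2) ^ j" for j x
    by (simp_all add: w_def mult_left_le)
  have w_summable: "summable (\<lambda>j. w j x)" for x
    by (rule summable_comparison_test'[of "\<lambda>j. (1 / 2) ^ j" 0]) (use w_bnd in \<open>simp_all add: summable_geometric\<close>)
  define u where "u = (\<lambda>x. \<bar>re_part (h x)\<bar> + (\<Sum>j. w j x))"
  have u_cont: "continuous_map weak euclideanreal u"
    unfolding u_def
    by (intro continuous_map_add continuous_map_real_abs continuous_map_weak_re_part h(1)
        continuous_map_suminf_geometric w_cont w_bnd)
  have u_pos: "0 < u x" for x
  proof (rule ccontr)
    assume "\<not> 0 < u x"
    moreover have "0 \<le> (\<Sum>j. w j x)"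
      using w_summable w_bnd(1) by (rule suminf_nonneg)
    ultimately have 0: "re_part (h x) = 0" "(\<Sum>j. w j x) = 0"
      by (auto simp: u_def)
    then have "w j x = 0" for j
      using suminf_eq_zero_iff[OF w_summable w_bnd(1)] by blast
    then have "min 1 \<bar>re_part (\<phi> j x) - 1\<bar> = 0" for j
      by (simp add: w_def)
    then have "re_part (\<phi> j x) = 1" for j
      by (metis abs_eq_0 eq_iff_diff_eq_0 min_def zero_neq_one)
    then have "(x, 1) \<in> M"
      by (simp add: M_def)
    then show False
      using h(2)[of x 1] 0 by simp
  qed
  have u_b: "u (b n) \<le> (1 / 2) ^ n" for n
  proof -
    \<comment> \<open>Since \<open>\<phi> j (b n) = 1\<close> for \<open>j \<le> n\<close>, the
      first \<open>Suc n\<close> terms vanish, and the bounds of the remaining ones sum to exactly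
      \<open>(1 / 2) ^ n\<close>.\<close>
    have "w j (b n) = 0" if "j < Suc n" for j
      using that by (simp add: w_def \<phi>(2))
    then have "(\<Sum>j. w j (b n)) = (\<Sum>j. w (j + Suc n) (b n))"
      using suminf_split_initial_segment[OF w_summable, of "b n" "Suc n"] by (simp del: sum.lessThan_Suc)
    also have "\<dots> \<le> (\<Sum>j. (1 / 2) ^ (j + Suc n))"
    proof (rule suminf_le)
      show "w (j + Suc n) (b n) \<le> (1 / 2) ^ (j + Suc n)" for j
        by (rule w_bnd(2))
      show "summable (\<lambda>j. w (j + Suc n) (b n))"
        by (rule summable_ignore_initial_segment[OF w_summable])
      show "summable (\<lambda>j. (1 / 2 :: real) ^ (j + Suc n))"
        by (rule summable_ignore_initial_segment) (simp add: summable_geometric)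
    qed
    also have "\<dots> = (1 / 2) ^ n"
    proof -
      have "(\<Sum>j. (1 / 2 :: real) ^ (j + Suc n)) = (\<Sum>j. (1 / 2) ^ j * (1 / 2) ^ Suc n)"
        by (simp only: power_add)
      also have "\<dots> = (\<Sum>j. (1 / 2) ^ j) * (1 / 2) ^ Suc n"
        by (rule suminf_mult2[symmetric]) (simp add: summable_geometric)
      also have "\<dots> = (1 / 2) ^ n"
        by (simp add: suminf_geometric)
      finally show ?thesis .
    qed
    finally show ?thesis
      by (simp add: u_def h_b)
  qed
  show thesis
  proof (rule that)
    show "continuous_map weak euclideanreal (\<lambda>x. inverse (u x))"
      using u_cont u_pos by (intro continuous_map_real_inverse) (auto simp: less_imp_neq[symmetric])
    show "real n \<le> inverse (u (b n))" for n
    proof -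
      have "real n \<le> 2 ^ n"
        using of_nat_less_two_power[of n, where 'a=real] by simp
      also have "\<dots> = inverse ((1 / 2) ^ n)"
        by (simp add: power_divide)
      also have "\<dots> \<le> inverse (u (b n))"
        using u_b u_pos by (intro le_imp_inverse_le) auto
      finally show ?thesis .
    qed
  qed
qed

end

lemma closure_of_le:
  assumes "continuous_map X euclideanreal g" "\<And>x. x \<in> A \<Longrightarrow> g x \<le> 0" "x \<in> X closure_of A"
  shows "g x \<le> 0"
proof -
  have "closedin X {x \<in> topspace X. g x \<in> {..0}}"
    by (rule closedin_continuous_map_preimage[OF assms(1)]) simp
  moreover have "topspace X \<inter> A \<subseteq> {x \<in> topspace X. g x \<in> {..0}}"
    using assms(2) by auto
  ultimately have "X closure_of (topspace X \<inter> A) \<subseteq> {x \<in> topspace X. g x \<in> {..0}}"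
    by (rule closure_of_minimal[rotated])
  then have "X closure_of A \<subseteq> {x \<in> topspace X. g x \<in> {..0}}"
    unfolding closure_of_restrict[of X A, symmetric] .
  then show ?thesis
    using assms(3) by auto
qed

context locally_convex_space
begin

section \<open>Equivalence to the unit basis of \<open>\<ell>\<^sub>1\<close>\<close>

lemma in_closure_of_iff_seminorm:
  "x \<in> E closure_of A \<longleftrightarrow> (\<forall>p. seminorm p \<longrightarrow> (\<exists>a\<in>A. p (a - x) < 1))"
proof
  assume x: "x \<in> E closure_of A"
  show "\<forall>p. seminorm p \<longrightarrow> (\<exists>a\<in>A. p (a - x) < 1)"
  proof (intro allI impI)
    fix p assume "seminorm p"
    then obtain a where "a \<in> A" "p (a - x) < 1"
      by (rule in_closure_ofD[OF x _ zero_less_one])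
    then show "\<exists>a\<in>A. p (a - x) < 1" ..
  qed
next
  assume *: "\<forall>p. seminorm p \<longrightarrow> (\<exists>a\<in>A. p (a - x) < 1)"
  show "x \<in> E closure_of A"
    unfolding in_closure_of
  proof (intro conjI allI impI)
    fix T assume "x \<in> T \<and> openin E T"
    then obtain p where p: "seminorm p" "{y. p (y - x) < 1} \<subseteq> T"
      using openin_iff_seminorm by blast
    then obtain a where "a \<in> A" "p (a - x) < 1"
      using * by blast
    then show "\<exists>y. y \<in> A \<and> y \<in> T"
      using p(2) by blast
  qed (simp add: topspace_UNIV)
qed

lemma closure_of_subspace_add:
  assumes A: "subspace A" and x: "x \<in> E closure_of A" and y: "y \<in> E closure_of A"
  shows "x + y \<in> E closure_of A"
  unfolding in_closure_of_iff_seminorm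
proof (intro allI impI)
  fix p assume p: "seminorm p"
  obtain a where a: "a \<in> A" "p (a - x) < 1 / 2"
    using in_closure_ofD[OF x p, of "1 / 2"] by auto
  obtain b where b: "b \<in> A" "p (b - y) < 1 / 2"
    using in_closure_ofD[OF y p, of "1 / 2"] by auto
  have "p ((a + b) - (x + y)) \<le> p (a - x) + p (b - y)"
    using seminorm_triangle[OF p, of "a - x" "b - y"] by (simp add: algebra_simps)
  then have "p ((a + b) - (x + y)) < 1"
    using a(2) b(2) by linarith
  then show "\<exists>c\<in>A. p (c - (x + y)) < 1"
    using subspace_add[OF A a(1) b(1)] by blast
qed

lemma closure_of_subspace_scale:
  assumes A: "subspace A" and x: "x \<in> E closure_of A"
  shows "smul c x \<in> E closure_of A"
  unfolding in_closure_of_iff_seminorm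
proof (intro allI impI)
  fix p assume p: "seminorm p"
  obtain a where a: "a \<in> A" "p (a - x) < 1 / (norm c + 1)"
    using in_closure_ofD[OF x p, of "1 / (norm c + 1)"] by (auto simp: add_nonneg_pos)
  have pos: "0 < norm c + 1"
    by (simp add: add_nonneg_pos)
  have "p (smul c a - smul c x) = norm c * p (a - x)"
    by (simp add: seminorm_scale[OF p] flip: scale_right_diff_distrib)
  also have "\<dots> \<le> (norm c + 1) * p (a - x)"
    using seminorm_nonneg[OF p] by (simp add: distrib_right)
  also have "\<dots> < 1"
    using a(2) pos by (simp add: field_simps)
  finally have "p (smul c a - smul c x) < 1" .
  then show "\<exists>b\<in>A. p (b - smul c x) < 1"
    using subspace_scale[OF A a(1)] by blast
qed

lemma closure_of_subspace_diff:
  assumes "subspace A" "x \<in> E closure_of A" "y \<in> E closure_of A"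
  shows "x - y \<in> E closure_of A"
  using closure_of_subspace_add[OF assms(1,2) closure_of_subspace_scale[OF assms(1,3), of "-1"]] by simp

lemma sum_in_span: "(\<Sum>i<n. smul (c i) (b i)) \<in> span (range b)"
  by (intro span_sum span_scale span_base) simp

lemma span_rangeE:
  assumes "x \<in> span (range b)"
  obtains n c where "x = (\<Sum>i<n::nat. smul (c i) (b i))"
proof -
  have "\<exists>n c. x = (\<Sum>i<n. smul (c i) (b i))"
    using assms
  proof (induction rule: span_induct_alt)
    case base
    show ?case by (intro exI[of _ 0]) simp
  next
    case (step a x y)
    then obtain k n c where x: "x = b k" and y: "y = (\<Sum>i<n. smul (c i) (b i))"
      by blast
    define c' where "c' = (\<lambda>i. if i < n then c i else 0)"
    define d where "d = (\<lambda>i. if i = k then a else 0)"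
    have "y = (\<Sum>i<n + Suc k. smul (c' i) (b i))"
      unfolding y by (rule sum.mono_neutral_cong_left) (auto simp: c'_def)
    moreover have "smul a x = (\<Sum>i<n + Suc k. smul (d i) (b i))"
    proof -
      have "(\<Sum>i<n + Suc k. smul (d i) (b i)) = (\<Sum>i\<in>{k}. smul (d i) (b i))"
        by (rule sum.mono_neutral_right) (auto simp: d_def)
      then show ?thesis by (simp add: d_def x)
    qed
    ultimately have "smul a x + y = (\<Sum>i<n + Suc k. smul (d i + c' i) (b i))"
      by (simp only: scale_left_distrib sum.distrib)
    then show ?case
      by (intro exI)
  qed
  then show thesis
    using that by blast
qed

section \<open>The coordinate map from the closed span into \<open>\<ell>\<^sub>1\<close>\<close>

context
  fixes p b f
  assumes p: "seminorm p" "dominates_ell1 p b" and bnd: "bounded_in smul E (range b)"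
    and f: "\<And>k. f k \<in> dual" "\<And>k n. f k (b n) = (if n = k then 1 else 0)"
begin

abbreviation closed_span :: "'a set" where
  "closed_span \<equiv> E closure_of span (range b)"

lemma coordinate_sum: "f k (\<Sum>i<n. smul (c i) (b i)) = (if k < n then c k else 0)"
  by (simp add: dual_sum[OF f(1)] dual_scale[OF f(1)] f(2) if_distrib sum.delta cong: if_cong)

lemma continuous_map_coordinates:
  "continuous_map E euclideanreal (\<lambda>x. \<Sum>k<m. norm (f k x))"
  using f(1) by (intro continuous_map_sum continuous_map_norm) (simp_all add: continuous_dual_def)

text \<open>Finite partial sums are continuous, so the inequality passes from the span to its
  closure for each \<open>m\<close> separately, before anything is known about the infinite
  sum.\<close>

lemma coordinates_le:
  assumes "x \<in> closed_span" shows "(\<Sum>k<m. norm (f k x)) \<le> p x"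
proof -
  have "(\<Sum>k<m. norm (f k x)) - p x \<le> 0"
  proof (rule closure_of_le[OF _ _ assms])
    show "continuous_map E euclideanreal (\<lambda>x. (\<Sum>k<m. norm (f k x)) - p x)"
      by (intro continuous_map_diff continuous_map_coordinates seminorm_continuous p)
    fix x assume "x \<in> span (range b)"
    then obtain n c where x: "x = (\<Sum>i<n. smul (c i) (b i))"
      by (rule span_rangeE)
    have "(\<Sum>k<m. norm (f k x)) = (\<Sum>k\<in>{..<m} \<inter> {..<n}. norm (c k))"
      by (simp add: x coordinate_sum if_distrib sum.inter_restrict cong: if_cong)
    also have "\<dots> \<le> (\<Sum>k<n. norm (c k))"
      by (rule sum_mono2) auto
    also have "\<dots> \<le> p x"
      using p(2) by (simp add: dominates_ell1_def x)
    finally show "(\<Sum>k<m. norm (f k x)) - p x \<le> 0" by simp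
  qed
  then show ?thesis by simp
qed

lemma coordinates_le_finite:
  assumes "x \<in> closed_span" "finite F" shows "(\<Sum>k\<in>F. norm (f k x)) \<le> p x"
proof -
  obtain m where "F \<subseteq> {..<m}"
    using finite_nat_iff_bounded[THEN iffD1, OF assms(2)] by blast
  then have "(\<Sum>k\<in>F. norm (f k x)) \<le> (\<Sum>k<m. norm (f k x))"
    by (intro sum_mono2) auto
  then show ?thesis
    using coordinates_le[OF assms(1), of m] by linarith
qed

lemma coordinates_in_ell1:
  assumes "x \<in> closed_span" shows "(\<lambda>k. f k x) \<in> ell1"
proof -
  have "(\<lambda>k. norm (f k x)) summable_on UNIV"
  proof (rule nonneg_bdd_above_summable_on)
    show "bdd_above (sum (\<lambda>k. norm (f k x)) ` {F. F \<subseteq> UNIV \<and> finite F})"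
      using coordinates_le_finite[OF assms] by (intro bdd_aboveI2[of _ _ "p x"]) simp
  qed simp
  then show ?thesis
    by (simp add: ell1_def)
qed

lemma infsum_coordinates_le:
  assumes "x \<in> closed_span" shows "(\<Sum>\<^sub>\<infinity>k. norm (f k x)) \<le> p x"
  using coordinates_in_ell1[OF assms] coordinates_le_finite[OF assms]
  by (intro infsum_le_finite_sums) (simp_all add: ell1_def)

lemma sum_coordinates_le_infsum:
  assumes "x \<in> closed_span" shows "(\<Sum>k<m. norm (f k x)) \<le> (\<Sum>\<^sub>\<infinity>k. norm (f k x))"
  using coordinates_in_ell1[OF assms] by (intro finite_sum_le_infsum) (simp_all add: ell1_def)

lemma closed_span_diff: "x \<in> closed_span \<Longrightarrow> y \<in> closed_span \<Longrightarrow> x - y \<in> closed_span"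
  by (rule closure_of_subspace_diff[OF subspace_span])

lemma span_subset_closed_span: "span (range b) \<subseteq> closed_span"
  by (rule closure_of_subset) (simp add: topspace_UNIV)

text \<open>On the span this is the triangle inequality. A point of the closure is approximated with
  respect to \<open>M * p + q\<close>, which controls the error of \<open>q\<close> and, through
  \<open>coordinates_le\<close>, the error of the coordinates at once.\<close>

lemma seminorm_le_infsum_coordinates:
  assumes q: "seminorm q" and M: "\<And>n. q (b n) \<le> M" "0 \<le> M" and x: "x \<in> closed_span"
  shows "q x \<le> M * (\<Sum>\<^sub>\<infinity>k. norm (f k x))"
proof (rule field_le_epsilon)
  fix e :: real assume e: "0 < e"
  define N where "N = (\<lambda>x. \<Sum>\<^sub>\<infinity>k. norm (f k x))"
  have "seminorm (\<lambda>x. M * p x + q x)"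
    by (intro seminorm_add seminorm_cmult p q M)
  from in_closure_ofD[OF x this e]
  obtain y where y: "y \<in> span (range b)" "M * p (y - x) + q (y - x) < e"
    by blast
  obtain n c where yc: "y = (\<Sum>i<n. smul (c i) (b i))"
    by (rule span_rangeE[OF y(1)])
  have "q y \<le> (\<Sum>i<n. q (smul (c i) (b i)))"
    unfolding yc by (rule seminorm_sum[OF q])
  also have "\<dots> \<le> (\<Sum>i<n. norm (f i y) * M)"
    by (intro sum_mono) (simp add: yc coordinate_sum seminorm_scale[OF q] M(1) mult_left_mono)
  also have "\<dots> = M * (\<Sum>i<n. norm (f i y))"
    by (simp add: sum_distrib_left mult.commute)
  finally have qy: "q y \<le> M * (\<Sum>i<n. norm (f i y))" .
  have "(\<Sum>i<n. norm (f i y)) \<le> (\<Sum>i<n. norm (f i x) + norm (f i (y - x)))"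
    by (intro sum_mono) (simp add: dual_diff[OF f(1)] norm_triangle_sub)
  also have "\<dots> \<le> N x + p (y - x)"
    using sum_coordinates_le_infsum[OF x, of n] coordinates_le[OF closed_span_diff[OF _ x], of y n]
      y(1) span_subset_closed_span by (auto simp: sum.distrib N_def intro: add_mono)
  finally have "q y \<le> M * (N x + p (y - x))"
    using qy M(2) by (meson mult_left_mono order_trans)
  moreover have "q x \<le> q y + q (y - x)"
    using seminorm_reverse_triangle[OF q, of x y] seminorm_minus_commute[OF q, of x y] by linarith
  ultimately show "q x \<le> M * (\<Sum>\<^sub>\<infinity>k. norm (f k x)) + e"
    using y(2) by (simp add: N_def distrib_left)
qed

lemma ell1_dist_coordinates:
  "ell1_dist (\<lambda>k. f k x) (\<lambda>k. f k y) = (\<Sum>\<^sub>\<infinity>k. norm (f k (x - y)))"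
  by (simp add: ell1_dist_def dual_diff[OF f(1)])

text \<open>The Hausdorff property enters: a seminorm that separates \<open>x\<close> from
  \<open>y\<close> is itself dominated by the sum of the coordinates of
  \<open>x - y\<close>.\<close>

lemma inj_on_coordinates: "inj_on (\<lambda>x k. f k x) closed_span"
proof (rule inj_onI, rule ccontr)
  fix x y assume xy: "x \<in> closed_span" "y \<in> closed_span" "(\<lambda>k. f k x) = (\<lambda>k. f k y)" "x \<noteq> y"
  obtain q where q: "seminorm q" "1 \<le> q (x - y)"
    using separating_seminorm[of "x - y"] xy(4) by auto
  obtain M where M: "\<And>n. q (b n) \<le> M"
    using bnd q(1) bounded_in_iff_seminorm by (metis rangeI)
  have "0 \<le> M"
    using seminorm_nonneg[OF q(1)] M order_trans by blast
  have "f k x = f k y" for k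
    using fun_cong[OF xy(3), of k] .
  then have "(\<Sum>\<^sub>\<infinity>k. norm (f k (x - y))) = 0"
    by (simp add: dual_diff[OF f(1)])
  then have "q (x - y) \<le> 0"
    using seminorm_le_infsum_coordinates[OF q(1) M \<open>0 \<le> M\<close> closed_span_diff[OF xy(1,2)]] by simp
  then show False
    using q(2) by simp
qed

interpretation ell1: Metric_space "ell1 :: (nat \<Rightarrow> 'k) set" ell1_dist
  by (rule Metric_space_ell1)

lemma continuous_map_coordinate_sequence:
  "continuous_map (subtopology E closed_span) ell1_topology (\<lambda>x k. f k x)"
  unfolding continuous_map_def
proof (intro conjI allI impI)
  show "(\<lambda>x k. f k x) \<in> topspace (subtopology E closed_span) \<rightarrow> topspace ell1_topology"
    using coordinates_in_ell1 by (auto simp: ell1_topology_def)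
  fix W :: "(nat \<Rightarrow> 'k) set" assume "openin ell1_topology W"
  then have W: "openin ell1.mtopology W"
    by (simp add: ell1_topology_def)
  show "openin (subtopology E closed_span) {x \<in> topspace (subtopology E closed_span). (\<lambda>k. f k x) \<in> W}"
  proof (subst openin_subopen, intro ballI)
    fix x assume "x \<in> {x \<in> topspace (subtopology E closed_span). (\<lambda>k. f k x) \<in> W}"
    then have x: "x \<in> closed_span" "(\<lambda>k. f k x) \<in> W"
      by auto
    then obtain e where e: "0 < e" "ell1.mball (\<lambda>k. f k x) e \<subseteq> W"
      using W unfolding ell1.openin_mtopology by blast
    define T where "T = {y. p (y - x) < e} \<inter> closed_span"
    have "openin (subtopology E closed_span) T"
      unfolding T_def openin_subtopology using openin_seminorm_ball[OF p(1)] by blast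
    moreover have "x \<in> T"
      using x(1) e(1) by (simp add: T_def seminorm_zero[OF p(1)])
    moreover have "y \<in> {x \<in> topspace (subtopology E closed_span). (\<lambda>k. f k x) \<in> W}" if y: "y \<in> T" for y
    proof -
      have yS: "y \<in> closed_span"
        using y by (simp add: T_def)
      have "ell1_dist (\<lambda>k. f k x) (\<lambda>k. f k y) \<le> p (x - y)"
        unfolding ell1_dist_coordinates by (rule infsum_coordinates_le[OF closed_span_diff[OF x(1) yS]])
      also have "\<dots> < e"
        using y by (simp add: T_def seminorm_minus_commute[OF p(1), of x y])
      finally have "(\<lambda>k. f k y) \<in> ell1.mball (\<lambda>k. f k x) e"
        using coordinates_in_ell1[OF x(1)] coordinates_in_ell1[OF yS] by simp
      then show ?thesis
        using e(2) yS by (auto simp: topspace_UNIV)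
    qed
    ultimately show "\<exists>T. openin (subtopology E closed_span) T \<and> x \<in> T \<and>
        T \<subseteq> {x \<in> topspace (subtopology E closed_span). (\<lambda>k. f k x) \<in> W}"
      by blast
  qed
qed

text \<open>On the closed span each seminorm \<open>q\<close> is bounded by its own multiple of the
  \<open>\<ell>\<^sub>1\<close> norm, so the norm topology there is fine enough for all of
  them.\<close>

lemma continuous_map_inverse_coordinates:
  "continuous_map (subtopology ell1_topology ((\<lambda>x k. f k x) ` closed_span)) (subtopology E closed_span)
     (inv_into closed_span (\<lambda>x k. f k x))"
proof -
  let ?R = "\<lambda>x k. f k x"
  let ?g = "inv_into closed_span ?R"
  have gR: "?g (?R x) = x" if "x \<in> closed_span" for x
    using inv_into_f_f[OF inj_on_coordinates that] .
  have top: "topspace (subtopology ell1_topology (?R ` closed_span)) = ?R ` closed_span"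
    using coordinates_in_ell1 by (auto simp: ell1_topology_def)
  have "continuous_map (subtopology ell1_topology (?R ` closed_span)) E ?g"
    unfolding continuous_map_def top
  proof (intro conjI allI impI)
    fix U assume U: "openin E U"
    show "openin (subtopology ell1_topology (?R ` closed_span)) {y \<in> ?R ` closed_span. ?g y \<in> U}"
    proof (subst openin_subopen, intro ballI)
      fix z assume "z \<in> {y \<in> ?R ` closed_span. ?g y \<in> U}"
      then obtain x where x: "x \<in> closed_span" "z = ?R x" "x \<in> U"
        using gR by auto
      then obtain q where q: "seminorm q" "{y. q (y - x) < 1} \<subseteq> U"
        using U openin_iff_seminorm by blast
      obtain M0 where M0: "\<And>n. q (b n) \<le> M0"
        using bnd q(1) bounded_in_iff_seminorm by (metis rangeI)
      define M where "M = max 1 M0"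
      have M: "0 < M" "\<And>n. q (b n) \<le> M"
        using M0 by (auto simp: M_def intro: max.coboundedI2)
      define T where "T = ell1.mball z (1 / M) \<inter> ?R ` closed_span"
      have "openin (subtopology ell1_topology (?R ` closed_span)) T"
        unfolding T_def openin_subtopology ell1_topology_def by (metis ell1.openin_mball)
      moreover have "z \<in> T"
        using x M(1) coordinates_in_ell1[OF x(1)] by (simp add: T_def)
      moreover have "y \<in> {y \<in> ?R ` closed_span. ?g y \<in> U}" if y: "y \<in> T" for y
      proof -
        obtain x' where x': "x' \<in> closed_span" "y = ?R x'"
          using y by (auto simp: T_def)
        have "ell1_dist (?R x) (?R x') < 1 / M"
          using y by (simp add: T_def x(2) x'(2))
        then have "(\<Sum>\<^sub>\<infinity>k. norm (f k (x - x'))) < 1 / M"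
          by (simp only: ell1_dist_coordinates)
        then have "M * (\<Sum>\<^sub>\<infinity>k. norm (f k (x - x'))) < 1"
          using M(1) by (simp add: field_simps)
        then have "q (x - x') < 1"
          using seminorm_le_infsum_coordinates[OF q(1) M(2) less_imp_le[OF M(1)] closed_span_diff[OF x(1) x'(1)]]
          by linarith
        then have "x' \<in> U"
          using q(2) by (auto simp: seminorm_minus_commute[OF q(1), of x x'])
        then show ?thesis
          using x' gR[OF x'(1)] by auto
      qed
      ultimately show "\<exists>T. openin (subtopology ell1_topology (?R ` closed_span)) T \<and> z \<in> T \<and>
          T \<subseteq> {y \<in> ?R ` closed_span. ?g y \<in> U}"
        by blast
    qed
  qed (simp add: topspace_UNIV)
  moreover have "?g ` (?R ` closed_span) \<subseteq> closed_span"
    using gR by auto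
  ultimately show ?thesis
    by (auto simp: continuous_map_in_subtopology top)
qed

lemma embedding_map_coordinates:
  "embedding_map (subtopology E closed_span) ell1_topology (\<lambda>x k. f k x)"
proof -
  let ?R = "\<lambda>x k. f k x"
  have top: "topspace (subtopology E closed_span) = closed_span"
    by (simp add: topspace_UNIV)
  have "homeomorphic_maps (subtopology E closed_span) (subtopology ell1_topology (?R ` closed_span))
      ?R (inv_into closed_span ?R)"
    unfolding homeomorphic_maps_def
  proof (intro conjI ballI)
    show "continuous_map (subtopology E closed_span) (subtopology ell1_topology (?R ` closed_span)) ?R"
      using continuous_map_coordinate_sequence by (auto simp: continuous_map_in_subtopology top)
    show "continuous_map (subtopology ell1_topology (?R ` closed_span)) (subtopology E closed_span)
        (inv_into closed_span ?R)"
      by (rule continuous_map_inverse_coordinates)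
    show "inv_into closed_span ?R (?R x) = x" if "x \<in> topspace (subtopology E closed_span)" for x
      using that inv_into_f_f[OF inj_on_coordinates] by (simp add: top)
    show "?R (inv_into closed_span ?R y) = y"
      if "y \<in> topspace (subtopology ell1_topology (?R ` closed_span))" for y
      using that by (intro f_inv_into_f) simp
  qed
  then show ?thesis
    unfolding embedding_map_def top by (rule homeomorphic_maps_imp_map)
qed

end

lemma equivalent_to_ell1_basis_if_dominates:
  assumes p: "seminorm p" "dominates_ell1 p b" and bnd: "bounded_in smul E (range b)"
  shows "equivalent_to_ell1_basis smul E b"
proof -
  have "\<exists>f. f \<in> dual \<and> (\<forall>n. f (b n) = (if n = k then 1 else 0))" for k :: nat
  proof -
    have "norm (if n = k then 1 else 0 :: 'k) \<le> 1" for n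
      by simp
    then show ?thesis
      by (rule ell1_interpolation[OF p, of "\<lambda>n. if n = k then 1 else 0"]) blast
  qed
  from choice[OF allI, OF this]
  obtain f where "\<forall>k. f k \<in> dual \<and> (\<forall>n. f k (b n) = (if n = k then 1 else 0))" ..
  then have f: "\<And>k. f k \<in> dual" "\<And>k n. f k (b n) = (if n = k then 1 else 0)"
    by blast+
  show ?thesis
    unfolding equivalent_to_ell1_basis_def Let_def
  proof (intro exI[of _ "\<lambda>x k. f k x"] conjI)
    show "embedding_map (subtopology E (E closure_of span (range b))) ell1_topology (\<lambda>x k. f k x)"
      by (rule embedding_map_coordinates[OF p bnd f])
    show "\<forall>n. (\<lambda>k. f k (b n)) = ell1_unit n"
      by (auto simp: f(2) ell1_unit_def)
  qed (simp_all add: dual_add[OF f(1)] dual_scale[OF f(1)])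
qed

text \<open>Continuity of \<open>R\<close> at 0 gives a seminorm whose unit ball within
  \<open>S\<close> is mapped into the unit ball of \<open>\<ell>\<^sub>1\<close>. As
  \<open>R\<close> sends a finite combination to its sequence of coefficients, homogeneity turns
  this into the estimate.\<close>

lemma equivalent_to_ell1_basis_imp_dominates:
  assumes "equivalent_to_ell1_basis smul E b"
  obtains p where "seminorm p" "dominates_ell1 p b"
proof -
  define S where "S = E closure_of span (range b)"
  interpret ell1: Metric_space "ell1 :: (nat \<Rightarrow> 'k) set" ell1_dist
    by (rule Metric_space_ell1)
  obtain R :: "'a \<Rightarrow> nat \<Rightarrow> 'k" where
    R: "\<And>x y. x \<in> S \<Longrightarrow> y \<in> S \<Longrightarrow> R (x + y) = (\<lambda>k. R x k + R y k)"
    "\<And>c x. x \<in> S \<Longrightarrow> R (smul c x) = (\<lambda>k. c * R x k)"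
    and emb: "embedding_map (subtopology E S) ell1_topology R"
    and unit: "\<And>n. R (b n) = ell1_unit n"
    using assms unfolding equivalent_to_ell1_basis_def Let_def S_def[symmetric] by blast
  have span_S: "span (range b) \<subseteq> S"
    unfolding S_def by (rule closure_of_subset) (simp add: topspace_UNIV)
  have topS: "topspace (subtopology E S) = S"
    by (simp add: topspace_UNIV)
  have S0: "0 \<in> S"
    using span_S span_zero by blast
  have R0: "R 0 = (\<lambda>k. 0)"
    using R(2)[OF S0, of 0] by simp
  have R_sum: "R (\<Sum>i<n. smul (c i) (b i)) = (\<lambda>k. if k < n then c k else 0)" for n c
  proof (induction n)
    case (Suc n)
    have "(\<Sum>i<n. smul (c i) (b i)) \<in> S" "smul (c n) (b n) \<in> S" "b n \<in> S"
      using span_S sum_in_span span_scale[OF span_base, of "b n" "range b"] span_base[of "b n" "range b"] by auto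
    then show ?case
      using Suc by (auto simp: R unit ell1_unit_def less_Suc_eq)
  qed (simp add: R0)
  have cont: "continuous_map (subtopology E S) ell1.mtopology R"
    using emb homeomorphic_imp_continuous_map continuous_map_in_subtopology
    unfolding embedding_map_def ell1_topology_def by blast
  have "openin (subtopology E S) {x \<in> S. R x \<in> ell1.mball (\<lambda>k. 0) 1}"
    using openin_continuous_map_preimage[OF cont ell1.openin_mball] unfolding topS .
  then obtain T where T: "openin E T" "{x \<in> S. R x \<in> ell1.mball (\<lambda>k. 0) 1} = T \<inter> S"
    unfolding openin_subtopology by blast
  have "(\<lambda>k. 0 :: 'k) \<in> ell1"
    by (simp add: ell1_def)
  then have "0 \<in> {x \<in> S. R x \<in> ell1.mball (\<lambda>k. 0) 1}"
    using S0 by (simp add: R0)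
  then have "0 \<in> T"
    unfolding T(2) by simp
  then obtain p where p: "seminorm p" "{x. p x < 1} \<subseteq> T"
    using openin_contains_seminorm_ball[OF T(1)] by blast
  have lt: "(\<Sum>i<n. norm (c i)) < 1" if small: "p (\<Sum>i<n. smul (c i) (b i)) < 1" for n and c :: "nat \<Rightarrow> 'k"
  proof -
    have "(\<Sum>i<n. smul (c i) (b i)) \<in> {x \<in> S. R x \<in> ell1.mball (\<lambda>k. 0) 1}"
      unfolding T(2) using p(2) small span_S sum_in_span by blast
    then have "ell1_dist (\<lambda>k. 0) (\<lambda>k. if k < n then c k else 0) < 1"
      by (simp add: R_sum)
    moreover have "ell1_dist (\<lambda>k. 0) (\<lambda>k. if k < n then c k else 0) = (\<Sum>\<^sub>\<infinity>k\<in>{..<n}. norm (c k))"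
      unfolding ell1_dist_def by (rule infsum_cong_neutral) auto
    ultimately show ?thesis by simp
  qed
  have "(\<Sum>i<n. norm (c i)) \<le> p (\<Sum>i<n. smul (c i) (b i))" for n and c :: "nat \<Rightarrow> 'k"
  proof (rule ccontr)
    define t where "t = (\<Sum>i<n. norm (c i))"
    assume "\<not> ?thesis"
    then have pt: "p (\<Sum>i<n. smul (c i) (b i)) < t"
      by (simp add: t_def)
    then have t: "0 < t"
      using seminorm_nonneg[OF p(1)] order_le_less_trans by blast
    let ?c = "\<lambda>i. of_real (inverse t) * c i"
    have "(\<Sum>i<n. smul (?c i) (b i)) = smul (of_real (inverse t)) (\<Sum>i<n. smul (c i) (b i))"
      by (simp add: scale_sum_right)
    then have "p (\<Sum>i<n. smul (?c i) (b i)) = p (\<Sum>i<n. smul (c i) (b i)) / t"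
      using t by (simp add: seminorm_scale[OF p(1)] norm_inverse divide_inverse mult.commute)
    also have "\<dots> < 1"
      using pt t by simp
    finally have "(\<Sum>i<n. norm (?c i)) < 1"
      by (rule lt)
    moreover have "(\<Sum>i<n. norm (?c i)) = inverse t * t"
    proof -
      have norm_c: "norm (?c i) = inverse t * norm (c i)" for i
        using t by (simp add: norm_mult norm_inverse)
      show ?thesis
        unfolding norm_c sum_distrib_left[symmetric] t_def[symmetric] ..
    qed
    ultimately show False
      using t by simp
  qed
  then show thesis
    using that p(1) by (auto simp: dominates_ell1_def)
qed

end

section \<open>The equivalences\<close>

context locally_convex_space
begin

section \<open>Sequences that witness a failure of the Schur property\<close>

lemma not_Schur_sequence:
  assumes "\<not> Schur_property smul E"
  obtains p e b l where "seminorm p" "(0::real) < e" "limitin weak b l sequentially"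
    "\<And>n::nat. e \<le> p (b n - l)"
proof -
  obtain a :: "nat \<Rightarrow> 'a" and l where a: "limitin weak a l sequentially" "\<not> limitin E a l sequentially"
    using assms by (auto simp: Schur_property_def)
  then obtain p where p: "seminorm p" "\<not> (\<lambda>n. p (a n - l)) \<longlonglongrightarrow> 0"
    by (auto simp: limitin_iff_seminorm)
  then obtain e where e: "0 < e" "\<not> (\<forall>\<^sub>F n in sequentially. dist (p (a n - l)) 0 < e)"
    by (auto simp: tendsto_iff)
  then have "infinite {n. \<not> dist (p (a n - l)) 0 < e}"
    by (simp add: eventually_cofinite flip: cofinite_eq_sequentially)
  then obtain r where r: "strict_mono (r :: nat \<Rightarrow> nat)" "\<And>n. \<not> dist (p (a (r n) - l)) 0 < e"
    using infinite_enumerate by blast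
  have "e \<le> p ((a \<circ> r) n - l)" for n
    using r(2)[of n] seminorm_nonneg[OF p(1), of "a (r n) - l"] by simp
  then show thesis
    using that p(1) e(1) limitin_subsequence[OF r(1) a(1)] by blast
qed

lemma weak_limit_not_precompact:
  assumes "quasi_complete smul E" "seminorm p" "(0::real) < e"
    and b: "limitin weak b l sequentially" "\<And>n::nat. e \<le> p (b n - l)"
  shows "\<not> precompact_in E (range b)"
proof
  assume "precompact_in E (range b)"
  then have "limitin E b l sequentially"
    using weak_limit_of_precompact[OF assms(1) b(1)] by blast
  then have "(\<lambda>n. p (b n - l)) \<longlonglongrightarrow> 0"
    using assms(2) limitin_iff_seminorm by blast
  then have "e \<le> 0"
    by (rule LIMSEQ_le_const) (use b(2) in auto)
  then show False
    using assms(3) by simp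
qed

text \<open>Interpolating alternating signs along the subsequence gives a continuous functional
  whose values do not converge, against weak convergence.\<close>

lemma Schur_if_ell1_subsequences:
  assumes "quasi_complete smul E"
    and ell1: "\<And>a :: nat \<Rightarrow> 'a. bounded_in smul E (range a) \<Longrightarrow> \<not> precompact_in E (range a) \<Longrightarrow>
      \<exists>r :: nat \<Rightarrow> nat. strict_mono r \<and> equivalent_to_ell1_basis smul E (a \<circ> r)"
  shows "Schur_property smul E"
proof (rule ccontr)
  assume "\<not> Schur_property smul E"
  then obtain p e b l where p: "seminorm p" "(0::real) < e" and b: "limitin weak b l sequentially"
    "\<And>n::nat. e \<le> p (b n - l)"
    using not_Schur_sequence by blast
  then obtain r where r: "strict_mono (r :: nat \<Rightarrow> nat)" "equivalent_to_ell1_basis smul E (b \<circ> r)"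
    using ell1[OF bounded_in_weakly_convergent[OF b(1)] weak_limit_not_precompact[OF assms(1) p b]] by blast
  obtain q where q: "seminorm q" "dominates_ell1 q (b \<circ> r)"
    using equivalent_to_ell1_basis_imp_dominates[OF r(2)] by blast
  have "norm ((- 1 :: 'k) ^ n) \<le> 1" for n
    by (simp add: norm_power)
  then obtain f where f: "f \<in> dual" "\<And>n. f ((b \<circ> r) n) = (- 1) ^ n"
    by (rule ell1_interpolation[OF q, of "\<lambda>n. (- 1) ^ n"]) (rule that)
  have "(\<lambda>n. f ((b \<circ> r) n)) \<longlonglongrightarrow> f l"
    using limitin_subsequence[OF r(1) b(1)] f(1) limitin_weak_iff by blast
  then have lim: "(\<lambda>n. (- 1 :: 'k) ^ n) \<longlonglongrightarrow> f l"
    unfolding f(2) .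
  have "(\<lambda>n. (- 1 :: 'k) ^ Suc n - (- 1) ^ n) \<longlonglongrightarrow> 0"
    using tendsto_diff[OF LIMSEQ_Suc[OF lim] lim] unfolding diff_self .
  then have "(\<lambda>n. norm ((- 1 :: 'k) ^ Suc n - (- 1) ^ n)) \<longlonglongrightarrow> 0"
    by (rule tendsto_norm_zero)
  moreover have "norm ((- 1 :: 'k) ^ Suc n - (- 1) ^ n) = 2" for n
  proof -
    have "(- 1 :: 'k) ^ Suc n - (- 1) ^ n = - 2 * (- 1) ^ n"
      by simp
    then show ?thesis
      by (simp only: norm_mult norm_power norm_minus_cancel norm_one norm_numeral) simp
  qed
  ultimately have "(\<lambda>n::nat. 2 :: real) \<longlonglongrightarrow> 0"
    by (simp only:)
  then show False
    by (simp add: LIMSEQ_const_iff)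
qed

text \<open>A finite range would yield a constant subsequence, whose value must be the weak limit
  \<open>l\<close>, although all terms keep distance \<open>e\<close> from \<open>l\<close>.\<close>

lemma infinite_range_weakly_convergent:
  assumes "seminorm p" "(0::real) < e" and b: "limitin weak b l sequentially" "\<And>n::nat. e \<le> p (b n - l)"
  shows "infinite (range b)"
proof
  assume "finite (range b)"
  then obtain n where "infinite {m. b m = b n}"
    using pigeonhole_infinite[of UNIV b] by auto
  then obtain s where s: "strict_mono (s :: nat \<Rightarrow> nat)" "\<And>m. b (s m) = b n"
    using constant_subsequence by metis
  have "limitin weak (b \<circ> s) l sequentially"
    by (rule limitin_subsequence[OF s(1) b(1)])
  then have 1: "limitin weak (\<lambda>m::nat. b n) l sequentially"
    by (simp add: o_def s(2))
  have 2: "limitin weak (\<lambda>m::nat. b n) (b n) sequentially"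
    by (simp add: limitin_weak_iff)
  have "b n = l"
    by (rule limitin_Hausdorff_unique[OF 2 1 _ Hausdorff_weak]) simp
  then show False
    using b(2)[of n] assms(2) seminorm_zero[OF assms(1)] by simp
qed

text \<open>An infinite range is essential: a finite set is discrete and C-embedded for trivial reasons.\<close>

lemma Schur_if_C_embedded_subsequences:
  assumes "quasi_complete smul E"
    and C: "\<And>a :: nat \<Rightarrow> 'a. bounded_in smul E (range a) \<Longrightarrow> \<not> precompact_in E (range a) \<Longrightarrow>
      \<exists>r :: nat \<Rightarrow> nat. strict_mono r \<and> discrete_subset weak (range (a \<circ> r)) \<and> C_embedded weak (range (a \<circ> r))"
  shows "Schur_property smul E"
proof (rule ccontr)
  assume "\<not> Schur_property smul E"
  then obtain p e b l where p: "seminorm p" "(0::real) < e" and b: "limitin weak b l sequentially"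
    "\<And>n::nat. e \<le> p (b n - l)"
    using not_Schur_sequence by blast
  then obtain r where r: "strict_mono (r :: nat \<Rightarrow> nat)"
    "discrete_subset weak (range (b \<circ> r))" "C_embedded weak (range (b \<circ> r))"
    using C[OF bounded_in_weakly_convergent[OF b(1)] weak_limit_not_precompact[OF assms(1) p b]] by blast
  have lim: "limitin weak (b \<circ> r) l sequentially"
    by (rule limitin_subsequence[OF r(1) b(1)])
  have "infinite (range (b \<circ> r))"
    by (rule infinite_range_weakly_convergent[OF p lim]) (simp add: b(2))
  then obtain x :: "nat \<Rightarrow> 'a" where x: "inj x" "range x \<subseteq> range (b \<circ> r)"
    using infinite_countable_subset by blast
  \<comment> \<open>Outside \<open>range x\<close> the value of \<open>inv x\<close> is arbitrary,
    which is harmless because every function on a discrete set is continuous. Unbounded on the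
    terms, \<open>F\<close> cannot extend to a weakly continuous \<open>g\<close>, since
    \<open>g\<close> would converge along \<open>b \<circ> r\<close>.\<close>
  define F where "F = (\<lambda>y. real (inv x y))"
  have "continuous_map (subtopology weak (range (b \<circ> r))) euclideanreal F"
    using r(2) by (simp add: discrete_subset_def)
  from r(3)[unfolded C_embedded_def, THEN conjunct2, rule_format, OF this]
  obtain g where g: "continuous_map weak euclideanreal g" "\<forall>y\<in>range (b \<circ> r). g y = F y"
    by (elim exE conjE)
  have "(\<lambda>n. g ((b \<circ> r) n)) \<longlonglongrightarrow> g l"
    using continuous_map_limit[OF g(1) lim] by (simp add: o_def)
  then obtain M where M: "\<And>n. norm (g ((b \<circ> r) n)) \<le> M"
    using convergent_imp_Bseq[of "\<lambda>n. g ((b \<circ> r) n)"] by (auto simp: convergent_def Bseq_def)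
  obtain n where n: "M < real n"
    using reals_Archimedean2 by blast
  have xn: "x n \<in> range (b \<circ> r)"
    using x(2) by blast
  then have "norm (g (x n)) \<le> M"
    using M by auto
  moreover have "g (x n) = real n"
    using g(2)[rule_format, OF xn] x(1) by (simp add: F_def)
  ultimately show False
    using n by simp
qed

text \<open>Serves all five properties at once: it asks of \<open>P\<close> only that weakly
  convergent sequences with their limits have it weakly and that it implies functional boundedness
  in \<open>E\<close>.\<close>

lemma Schur_if_weakly_respects:
  assumes "quasi_complete smul E" "weakly_respects smul E P"
    and "\<And>a l. limitin weak a l sequentially \<Longrightarrow> P weak (insert l (range a))"
    and "\<And>A. P E A \<Longrightarrow> functionally_bounded_in E A"
  shows "Schur_property smul E"
proof (rule Schur_if_weakly_compact_bounded[OF assms(1)])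
  fix a :: "nat \<Rightarrow> 'a" and l assume "limitin weak a l sequentially"
  then have "P weak (insert l (range a))"
    by (rule assms(3))
  then have "P E (insert l (range a))"
    using assms(2) unfolding weakly_respects_def by blast
  then show "functionally_bounded_in E (insert l (range a))"
    by (rule assms(4))
qed

section \<open>Consequences of the Schur property\<close>

context
  assumes quasi_complete: "quasi_complete smul E"
    and metrizable: "separable_bounded_sets_metrizable smul E"
    and Schur: "Schur_property smul E"
begin

text \<open>Two extractions: failure of precompactness gives a separated subsequence, and the Schur
  property lets the dichotomy extract from it one that dominates the \<open>\<ell>\<^sub>1\<close>
  norm.\<close>

lemma ell1_subsequence:
  assumes "bounded_in smul E (range a)" "\<not> precompact_in E (range a)"
  obtains r p where "strict_mono (r :: nat \<Rightarrow> nat)" "seminorm p" "dominates_ell1 p (a \<circ> r)"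
proof -
  obtain q e r where q: "seminorm q" "(0::real) < e" and r: "strict_mono (r :: nat \<Rightarrow> nat)"
    and sep: "\<And>m n. m < n \<Longrightarrow> e \<le> q (a (r n) - a (r m))"
    using not_precompact_subsequence[OF assms(2)] by metis
  have "bounded_in smul E (range (\<lambda>n. a (r n)))"
    by (rule bounded_in_subset[OF assms(1)]) auto
  from Schur_separated_subsequence[OF Schur metrizable this q sep]
  obtain s p where s: "strict_mono (s :: nat \<Rightarrow> nat)" "seminorm p" "dominates_ell1 p ((\<lambda>n. a (r n)) \<circ> s)"
    by metis
  have "dominates_ell1 p (a \<circ> (r \<circ> s))"
    using s(3) by (simp add: o_def)
  then show thesis
    using that strict_mono_o[OF r s(1)] s(2) by blast
qed

lemma Schur_imp_equivalent_subsequence: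
  assumes "bounded_in smul E (range a)" "\<not> precompact_in E (range a)"
  shows "\<exists>r :: nat \<Rightarrow> nat. strict_mono r \<and> equivalent_to_ell1_basis smul E (a \<circ> r)"
proof -
  obtain r p where r: "strict_mono (r :: nat \<Rightarrow> nat)" "seminorm p" "dominates_ell1 p (a \<circ> r)"
    using ell1_subsequence[OF assms] by blast
  have "bounded_in smul E (range (a \<circ> r))"
    by (rule bounded_in_subset[OF assms(1)]) auto
  then show ?thesis
    using equivalent_to_ell1_basis_if_dominates r by blast
qed

lemma Schur_imp_C_embedded_subsequence:
  assumes "bounded_in smul E (range a)" "\<not> precompact_in E (range a)"
  shows "\<exists>r :: nat \<Rightarrow> nat. strict_mono r \<and> discrete_subset weak (range (a \<circ> r)) \<and>
    C_embedded weak (range (a \<circ> r))"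
proof -
  obtain r p where r: "strict_mono (r :: nat \<Rightarrow> nat)" "seminorm p" "dominates_ell1 p (a \<circ> r)"
    using ell1_subsequence[OF assms] by blast
  obtain g where g: "continuous_map weak euclideanreal g" "\<And>n. real n \<le> g ((a \<circ> r) n)"
    using unbounded_weakly_continuous_function[OF r(2,3)] by blast
  obtain s where s: "strict_mono (s :: nat \<Rightarrow> nat)" "discrete_subset weak (range (a \<circ> r \<circ> s))"
    "C_embedded weak (range (a \<circ> r \<circ> s))"
    by (rule discrete_C_embedded_subsequence[OF g(1) _ g(2)]) (auto intro: that)
  show ?thesis
    using s strict_mono_o[OF r(1) s(1)] unfolding o_assoc[symmetric] by blast
qed

lemma precompact_if_weakly_functionally_bounded:
  assumes A: "functionally_bounded_in weak A"
  shows "precompact_in E A"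
proof (rule ccontr)
  assume "\<not> precompact_in E A"
  then obtain q e a where q: "seminorm q" "(0::real) < e" and a: "range (a :: nat \<Rightarrow> 'a) \<subseteq> A"
    and sep: "\<And>m n. m < n \<Longrightarrow> e \<le> q (a n - a m)"
    using not_precompact_sequence by metis
  have "bounded_in smul E (range a)"
    using bounded_in_subset[OF bounded_in_functionally_bounded[OF A] a] .
  from Schur_separated_subsequence[OF Schur metrizable this q sep]
  obtain s p where s: "strict_mono (s :: nat \<Rightarrow> nat)" "seminorm p" "dominates_ell1 p (a \<circ> s)"
    by metis
  obtain g where g: "continuous_map weak euclideanreal g" "\<And>n. real n \<le> g ((a \<circ> s) n)"
    using unbounded_weakly_continuous_function[OF s(2,3)] by blast
  have "bounded (g ` A)"
    using A g(1) by (simp add: functionally_bounded_in_def)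
  then obtain M where M: "\<And>x. x \<in> A \<Longrightarrow> norm (g x) \<le> M"
    by (auto simp: bounded_iff)
  obtain n where n: "M < real n"
    using reals_Archimedean2 by blast
  have "norm (g (a (s n))) \<le> M"
    using M a by blast
  then show False
    using g(2)[of n] n by simp
qed

lemma compactin_closure_of_weakly_functionally_bounded:
  assumes "functionally_bounded_in weak A"
  shows "compactin E (E closure_of A)"
  using compactin_closure_of_precompact[OF quasi_complete bounded_in_functionally_bounded[OF assms]
      precompact_if_weakly_functionally_bounded[OF assms]] .

lemma subset_closure_of: "A \<subseteq> E closure_of A"
  by (rule closure_of_subset) (simp add: topspace_UNIV)

lemma subtopology_eq_weak:
  assumes "functionally_bounded_in weak A"
  shows "subtopology E A = subtopology weak A"
proof -
  have "(E closure_of A) \<inter> A = A"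
    using subset_closure_of by blast
  then show ?thesis
    using compactin_imp_subtopology_eq_weak[OF compactin_closure_of_weakly_functionally_bounded[OF assms]]
    by (metis subtopology_subtopology)
qed

text \<open>Functional boundedness depends on the ambient space, so equality of the subspace
  topologies on \<open>A\<close> does not transfer it. Instead it is inherited from the closure of
  \<open>A\<close>, which is compact in \<open>E\<close>.\<close>

lemma functionally_bounded_iff_weakly: "functionally_bounded_in E A \<longleftrightarrow> functionally_bounded_in weak A"
proof
  show "functionally_bounded_in weak A" if "functionally_bounded_in E A"
    using functionally_bounded_continuous_map[OF continuous_map_E_weak that] .
  assume "functionally_bounded_in weak A"
  then have "compactin E (E closure_of A)"
    by (rule compactin_closure_of_weakly_functionally_bounded)
  then have "functionally_bounded_in E (E closure_of A)"
    using compactin_imp_countably_compactin countably_compactin_imp_pseudocompactin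
      pseudocompactin_imp_functionally_bounded by blast
  then show "functionally_bounded_in E A"
    unfolding functionally_bounded_in_def
    by (auto simp: topspace_UNIV intro: bounded_subset[OF _ image_mono[OF subset_closure_of]])
qed

text \<open>The four properties treated here are intrinsic to the subspace topology, expressed by
  \<open>Q\<close>. Each makes \<open>A\<close> functionally bounded, and on such sets
  \<open>E\<close> and its weak topology induce the same subspace.\<close>

lemma Schur_imp_weakly_respects:
  assumes P: "\<And>(X :: 'a topology) A. P X A \<longleftrightarrow> A \<subseteq> topspace X \<and> Q (subtopology X A)"
    and fb: "\<And>(X :: 'a topology) A. P X A \<Longrightarrow> functionally_bounded_in X A"
  shows "weakly_respects smul E P"
proof -
  have "P weak A \<longleftrightarrow> P E A" for A
    using fb[of weak A] fb[of E A] functionally_bounded_iff_weakly subtopology_eq_weak[of A]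
    by (auto simp: P topspace_UNIV)
  then show ?thesis
    by (simp add: weakly_respects_def)
qed

end

end

theorem theorem1p2:
  fixes smul :: "'k::real_or_complex_field \<Rightarrow> 'a::ab_group_add \<Rightarrow> 'a"
    and E :: "'a topology"
  assumes "locally_convex_space smul E"
    and "quasi_complete smul E"
    and "separable_bounded_sets_metrizable smul E"
  shows
    "(Schur_property smul E \<longleftrightarrow> weakly_respects smul E seq_compactin) \<and>
     (Schur_property smul E \<longleftrightarrow> weakly_respects smul E compactin) \<and>
     (Schur_property smul E \<longleftrightarrow> weakly_respects smul E countably_compactin) \<and>
     (Schur_property smul E \<longleftrightarrow> weakly_respects smul E pseudocompactin) \<and>
     (Schur_property smul E \<longleftrightarrow> weakly_respects smul E functionally_bounded_in) \<and>
     (Schur_property smul E \<longleftrightarrow>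
        (\<forall>a :: nat \<Rightarrow> 'a. bounded_in smul E (range a) \<and> \<not> precompact_in E (range a) \<longrightarrow>
           (\<exists>r :: nat \<Rightarrow> nat. strict_mono r \<and> equivalent_to_ell1_basis smul E (a \<circ> r)))) \<and>
     (Schur_property smul E \<longleftrightarrow>
        (\<forall>a :: nat \<Rightarrow> 'a. bounded_in smul E (range a) \<and> \<not> precompact_in E (range a) \<longrightarrow>
           (\<exists>r :: nat \<Rightarrow> nat. strict_mono r \<and>
              discrete_subset (weak_topology smul E) (range (a \<circ> r)) \<and>
              C_embedded (weak_topology smul E) (range (a \<circ> r))))) \<and>
     (Schur_property smul E \<longrightarrow>
        (\<forall>A. functionally_bounded_in (weak_topology smul E) A \<longrightarrow> relatively_compact_in E A))"
proof -
  interpret locally_convex_space smul E by fact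
  have fb: "functionally_bounded_in X A"
    if "seq_compactin X A \<or> compactin X A \<or> countably_compactin X A \<or> pseudocompactin X A"
    for X :: "'a topology" and A
    using that compactin_imp_countably_compactin countably_compactin_imp_pseudocompactin
      seq_compactin_imp_pseudocompactin pseudocompactin_imp_functionally_bounded by blast
  have conv: "seq_compactin weak (insert l (range a))" "compactin weak (insert l (range a))"
    "countably_compactin weak (insert l (range a))" "pseudocompactin weak (insert l (range a))"
    "functionally_bounded_in weak (insert l (range a))"
    if "limitin weak a l sequentially" for a l
  proof -
    show "seq_compactin weak (insert l (range a))" and compact: "compactin weak (insert l (range a))"
      using convergent_sequence_compactness[OF that] by auto
    show countable: "countably_compactin weak (insert l (range a))"
      by (rule compactin_imp_countably_compactin[OF compact])
    show "pseudocompactin weak (insert l (range a))" "functionally_bounded_in weak (insert l (range a))"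
      using countable countably_compactin_imp_pseudocompactin pseudocompactin_imp_functionally_bounded
      by blast+
  qed
  note if_respects = Schur_if_weakly_respects[OF assms(2)]
  note imp_respects = Schur_imp_weakly_respects[OF assms(2,3)]
  have "Schur_property smul E \<longleftrightarrow> weakly_respects smul E seq_compactin"
    using imp_respects[of seq_compactin seq_compact_space] if_respects[of seq_compactin] conv fb
    by (auto simp: seq_compactin_def)
  moreover have "Schur_property smul E \<longleftrightarrow> weakly_respects smul E compactin"
    using imp_respects[of compactin compact_space] if_respects[of compactin] conv fb
    by (auto simp: compactin_subspace)
  moreover have "Schur_property smul E \<longleftrightarrow> weakly_respects smul E countably_compactin"
    using imp_respects[of countably_compactin countably_compact_space] if_respects[of countably_compactin] conv fb
    by (auto simp: countably_compactin_def)
  moreover have "Schur_property smul E \<longleftrightarrow> weakly_respects smul E pseudocompactin"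
    using imp_respects[of pseudocompactin pseudocompact_space] if_respects[of pseudocompactin] conv fb
    by (auto simp: pseudocompactin_def)
  moreover have "Schur_property smul E \<longleftrightarrow> weakly_respects smul E functionally_bounded_in"
    using functionally_bounded_iff_weakly[OF assms(2,3)] if_respects[of functionally_bounded_in] conv
    by (auto simp: weakly_respects_def)
  moreover have "Schur_property smul E \<longleftrightarrow>
      (\<forall>a :: nat \<Rightarrow> 'a. bounded_in smul E (range a) \<and> \<not> precompact_in E (range a) \<longrightarrow>
         (\<exists>r :: nat \<Rightarrow> nat. strict_mono r \<and> equivalent_to_ell1_basis smul E (a \<circ> r)))"
    using Schur_imp_equivalent_subsequence[OF assms(2,3)] Schur_if_ell1_subsequences[OF assms(2)] by blast
  moreover have "Schur_property smul E \<longleftrightarrow>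
      (\<forall>a :: nat \<Rightarrow> 'a. bounded_in smul E (range a) \<and> \<not> precompact_in E (range a) \<longrightarrow>
         (\<exists>r :: nat \<Rightarrow> nat. strict_mono r \<and>
            discrete_subset (weak_topology smul E) (range (a \<circ> r)) \<and>
            C_embedded (weak_topology smul E) (range (a \<circ> r))))"
    using Schur_imp_C_embedded_subsequence[OF assms(2,3)] Schur_if_C_embedded_subsequences[OF assms(2)] by blast
  moreover have "Schur_property smul E \<longrightarrow>
      (\<forall>A. functionally_bounded_in (weak_topology smul E) A \<longrightarrow> relatively_compact_in E A)"
    using compactin_closure_of_weakly_functionally_bounded[OF assms(2,3)]
    by (simp add: relatively_compact_in_def topspace_UNIV)
  ultimately show ?thesis
    by blast
qed

end
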